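(* Let $n\ge1$ and let $A\in\mathcal L(F_1^2)$ be a finite sum of finite products of bounded Toeplitz operators with (possibly unbounded) symbols in $\mathrm{BMO}$. Then $A$ is compact if and only if $\widetilde A(z)\to0$ as $|z|\to\infty$.
   Context: Let $V$ be Lebesgue measure on $\mathbb{C}^n$, $z\cdot\overline w=\sum_j z_j\overline{w_j}$, $d\mu_t(z)=\frac1{(\pi t)^n}e^{-|z|^2/t}dV(z)$. Let $L_1^2=L^2(\mathbb{C}^n,\mu_1)$ with inner product $\langle\cdot,\cdot\rangle_1$, and let $F_1^2=L_1^2\cap\mathrm{Hol}(\mathbb{C}^n)$ be the Fock space, with reproducing kernel $K_z(w)=e^{w\cdot\overline z}$ and normalized kernel $k_z=e^{-|z|^2/2}K_z$. $\mathcal L(F_1^2)$ is the algebra of bounded operators on $F_1^2$, and $P:L_1^2\to F_1^2$ is the orthogonal projection. The Berezin transform of $A\in\mathcal L(F_1^2)$ is $\widetilde A(z)=\langle Ak_z,k_z\rangle_1$, $z\in\mathbb{C}^n$. Toeplitz operators: for measurable $f:\mathbb{C}^n\to\mathbb{C}$ with $fK_z\in L_1^2$ for all $z\in\mathbb{C}^n$ (standing assumption on symbols), $T_fh=P(fh)$ on the dense domain $\{h\in F_1^2: fh\in L_1^2\}$. $T_f$ is called bounded if it is bounded on this domain; it is then identified with its bounded extension to $F_1^2$. BMO: for $z\in\mathbb{C}^n$ let $\tau_z(w)=z-w$, and let $\widetilde f^{(t)}(z)=\int_{\mathbb{C}^n}f\circ\tau_z\,d\mu_t$. A function $f\in L^1_{\mathrm{loc}}(\mathbb{C}^n)$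 is in $\mathrm{BMO}$ if $\sup_{z\in\mathbb{C}^n}\int_{\mathbb{C}^n}|f\circ\tau_z-\widetilde f^{(t)}(z)|\,d\mu_t<\infty$; this notion is independent of the choice of $t>0$ (e.g. take $t=1$). *)

theory Defs
  imports "HOL-Analysis.Analysis"
begin

definition gauss :: "real \<Rightarrow> (complex ^ 'n) measure" where
  "gauss t = density lebesgue
     (\<lambda>z. ennreal (exp (- (norm z)\<^sup>2 / t) / (pi * t) ^ CARD('n)))"

definition hdot :: "complex ^ 'n \<Rightarrow> complex ^ 'n \<Rightarrow> complex" where
  "hdot z w = (\<Sum>j\<in>UNIV. z $ j * cnj (w $ j))"

text \<open>Elements of \<open>L\<^sup>2\<close> are represented by functions, without passing to classes modulo
  null sets; on the Fock space the representative is unique.\<close>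

definition L2_gauss :: "(complex ^ 'n \<Rightarrow> complex) set" where
  "L2_gauss = {f. f \<in> borel_measurable lebesgue \<and> integrable (gauss 1) (\<lambda>z. (cmod (f z))\<^sup>2)}"

definition inner_gauss :: "(complex ^ 'n \<Rightarrow> complex) \<Rightarrow> (complex ^ 'n \<Rightarrow> complex) \<Rightarrow> complex" where
  "inner_gauss f g = (LINT z|gauss 1. f z * cnj (g z))"

definition norm_gauss :: "(complex ^ 'n \<Rightarrow> complex) \<Rightarrow> real" where
  "norm_gauss f = sqrt (LINT z|gauss 1. (cmod (f z))\<^sup>2)"

text \<open>Holomorphy in several variables: the real derivative exists and is complex linear
  (it is additive because \<open>has_derivative\<close> makes it real linear).\<close>

definition entire :: "(complex ^ 'n \<Rightarrow> complex) \<Rightarrow> bool" where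
  "entire f \<longleftrightarrow>
     (\<forall>z. \<exists>D. (f has_derivative D) (at z) \<and> (\<forall>c v. D (c *s v) = c * D v))"

definition fock :: "(complex ^ 'n \<Rightarrow> complex) set" where
  "fock = {f. entire f} \<inter> L2_gauss"

definition fock_dist :: "(complex ^ 'n \<Rightarrow> complex) \<Rightarrow> (complex ^ 'n \<Rightarrow> complex) \<Rightarrow> real" where
  "fock_dist f g = norm_gauss (\<lambda>z. f z - g z)"

definition ker :: "complex ^ 'n \<Rightarrow> complex ^ 'n \<Rightarrow> complex" where
  "ker z w = exp (hdot w z)"

definition nker :: "complex ^ 'n \<Rightarrow> complex ^ 'n \<Rightarrow> complex" where
  "nker z w = of_real (exp (- (norm z)\<^sup>2 / 2)) * ker z w"

text \<open>Operators on the Fock space are functions on all of \<open>complex ^ 'n \<Rightarrow> complex\<close>; only their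
  restriction to \<^const>\<open>fock\<close> is meaningful, and they are compared only there.\<close>

definition fock_bounded_op :: "((complex ^ 'n \<Rightarrow> complex) \<Rightarrow> (complex ^ 'n \<Rightarrow> complex)) \<Rightarrow> bool" where
  "fock_bounded_op A \<longleftrightarrow>
     (\<forall>h\<in>fock. A h \<in> fock) \<and>
     (\<forall>g\<in>fock. \<forall>h\<in>fock. A (\<lambda>z. g z + h z) = (\<lambda>z. A g z + A h z)) \<and>
     (\<forall>c. \<forall>h\<in>fock. A (\<lambda>z. c * h z) = (\<lambda>z. c * A h z)) \<and>
     (\<exists>C. \<forall>h\<in>fock. norm_gauss (A h) \<le> C * norm_gauss h)"

definition fock_topology :: "(complex ^ 'n \<Rightarrow> complex) topology" where
  "fock_topology = Metric_space.mtopology fock fock_dist"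

definition fock_compact_op :: "((complex ^ 'n \<Rightarrow> complex) \<Rightarrow> (complex ^ 'n \<Rightarrow> complex)) \<Rightarrow> bool" where
  "fock_compact_op A \<longleftrightarrow> fock_bounded_op A \<and>
     compactin fock_topology (fock_topology closure_of (A ` {h \<in> fock. norm_gauss h \<le> 1}))"

definition berezin :: "((complex ^ 'n \<Rightarrow> complex) \<Rightarrow> (complex ^ 'n \<Rightarrow> complex)) \<Rightarrow> complex ^ 'n \<Rightarrow> complex" where
  "berezin A z = inner_gauss (A (nker z)) (nker z)"

definition fock_proj :: "(complex ^ 'n \<Rightarrow> complex) \<Rightarrow> (complex ^ 'n \<Rightarrow> complex)" where
  "fock_proj g = (THE h. h \<in> fock \<and> (\<forall>u\<in>fock. inner_gauss (\<lambda>z. g z - h z) u = 0))"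

definition symbol :: "(complex ^ 'n \<Rightarrow> complex) \<Rightarrow> bool" where
  "symbol f \<longleftrightarrow> f \<in> borel_measurable lebesgue \<and> (\<forall>z. (\<lambda>w. f w * ker z w) \<in> L2_gauss)"

definition toeplitz_dom :: "(complex ^ 'n \<Rightarrow> complex) \<Rightarrow> (complex ^ 'n \<Rightarrow> complex) set" where
  "toeplitz_dom f = {h \<in> fock. (\<lambda>w. f w * h w) \<in> L2_gauss}"

definition toeplitz :: "(complex ^ 'n \<Rightarrow> complex) \<Rightarrow> (complex ^ 'n \<Rightarrow> complex) \<Rightarrow> (complex ^ 'n \<Rightarrow> complex)" where
  "toeplitz f h = fock_proj (\<lambda>w. f w * h w)"

definition toeplitz_bounded :: "(complex ^ 'n \<Rightarrow> complex) \<Rightarrow> bool" where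
  "toeplitz_bounded f \<longleftrightarrow>
     (\<exists>C. \<forall>h\<in>toeplitz_dom f. norm_gauss (toeplitz f h) \<le> C * norm_gauss h)"

definition heat :: "real \<Rightarrow> (complex ^ 'n \<Rightarrow> complex) \<Rightarrow> complex ^ 'n \<Rightarrow> complex" where
  "heat t f z = (LINT w|gauss t. f (z - w))"

text \<open>The oscillation integral is taken in \<^typ>\<open>ennreal\<close>. If \<open>w \<mapsto> f (z - w)\<close> is not
  \<open>gauss t\<close>-integrable, the Bochner integral \<open>heat t f z\<close> has the junk value \<open>0\<close>, but then the
  oscillation at \<open>z\<close> is \<open>\<infinity>\<close>; so finiteness of the supremum entails existence of all the
  averages.\<close>

definition BMO_t :: "real \<Rightarrow> (complex ^ 'n \<Rightarrow> complex) set" where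
  "BMO_t t = {f. f \<in> borel_measurable lebesgue \<and>
     (\<forall>K. compact K \<longrightarrow> set_integrable lebesgue K f) \<and>
     (SUP z. \<integral>\<^sup>+ w. ennreal (cmod (f (z - w) - heat t f z)) \<partial>gauss t) < \<infinity>}"

definition BMO :: "(complex ^ 'n \<Rightarrow> complex) set" where
  "BMO = BMO_t 1"

text \<open>\<open>T\<close> is the bounded extension to the Fock space of a bounded Toeplitz operator with symbol in
  BMO. The extension is determined by the symbol, as \<open>toeplitz_dom f\<close> is dense for every
  \<open>symbol f\<close>.\<close>

definition bmo_toeplitz :: "((complex ^ 'n \<Rightarrow> complex) \<Rightarrow> (complex ^ 'n \<Rightarrow> complex)) \<Rightarrow> bool" where
  "bmo_toeplitz T \<longleftrightarrow> (\<exists>f. symbol f \<and> f \<in> BMO \<and> toeplitz_bounded f \<and>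
     fock_bounded_op T \<and> (\<forall>h\<in>toeplitz_dom f. T h = toeplitz f h))"

text \<open>The outer list is the sum, the inner lists are the products (composition). The empty product
  is the identity, which is the Toeplitz operator with symbol \<open>1\<close>, and the empty sum is \<open>0\<close>, the
  Toeplitz operator with symbol \<open>0\<close>.\<close>

definition bmo_toeplitz_algebra :: "((complex ^ 'n \<Rightarrow> complex) \<Rightarrow> (complex ^ 'n \<Rightarrow> complex)) \<Rightarrow> bool" where
  "bmo_toeplitz_algebra A \<longleftrightarrow>
     (\<exists>Tss. (\<forall>Ts\<in>set Tss. \<forall>T\<in>set Ts. bmo_toeplitz T) \<and>
        (\<forall>h\<in>fock. A h = (\<lambda>z. \<Sum>Ts\<leftarrow>Tss. foldr (\<circ>) Ts id h z)))"


text \<open>The topology above is the metric topology of an actual metric space.\<close>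

lemma entire_diff:
  assumes "entire f" "entire g" shows "entire (\<lambda>z. f z - g z)"
  unfolding entire_def
proof
  fix z
  from assms obtain D E where
    "(f has_derivative D) (at z)" "\<forall>c v. D (c *s v) = c * D v"
    "(g has_derivative E) (at z)" "\<forall>c v. E (c *s v) = c * E v"
    unfolding entire_def by meson
  then show "\<exists>D. ((\<lambda>z. f z - g z) has_derivative D) (at z) \<and> (\<forall>c v. D (c *s v) = c * D v)"
    by (intro exI[of _ "\<lambda>v. D v - E v"]) (auto intro!: derivative_intros simp: algebra_simps)
qed

lemma entire_continuous: "entire f \<Longrightarrow> continuous_on UNIV f"
  unfolding entire_def by (meson continuous_at_imp_continuous_on has_derivative_continuous)

lemma space_gauss [simp]: "space (gauss t) = UNIV"
  by (simp add: gauss_def)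

lemma sets_gauss [measurable_cong, simp]: "sets (gauss t) = sets lebesgue"
  by (simp add: gauss_def)

lemma L2_gauss_diff:
  assumes "f \<in> L2_gauss" "g \<in> L2_gauss" shows "(\<lambda>z. f z - g z) \<in> L2_gauss"
proof -
  have [measurable]: "f \<in> borel_measurable lebesgue" "g \<in> borel_measurable lebesgue"
    using assms by (auto simp: L2_gauss_def)
  have "integrable (gauss 1) (\<lambda>z. 2 * (cmod (f z))\<^sup>2 + 2 * (cmod (g z))\<^sup>2)"
    using assms by (auto simp: L2_gauss_def)
  then have "integrable (gauss 1) (\<lambda>z. (cmod (f z - g z))\<^sup>2)"
  proof (rule Bochner_Integration.integrable_bound)
    show "AE z in gauss 1. norm ((cmod (f z - g z))\<^sup>2)
        \<le> norm (2 * (cmod (f z))\<^sup>2 + 2 * (cmod (g z))\<^sup>2)"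
    proof (rule AE_I2)
      fix z
      have "(cmod (f z - g z))\<^sup>2 \<le> (cmod (f z) + cmod (g z))\<^sup>2"
        by (simp add: norm_triangle_ineq4 power_mono)
      also have "\<dots> \<le> 2 * (cmod (f z))\<^sup>2 + 2 * (cmod (g z))\<^sup>2"
        using sum_squares_bound[of "cmod (f z)" "cmod (g z)"]
        by (simp add: power2_sum)
      finally show "norm ((cmod (f z - g z))\<^sup>2) \<le> norm (2 * (cmod (f z))\<^sup>2 + 2 * (cmod (g z))\<^sup>2)"
        by simp
    qed
  qed measurable
  then show ?thesis by (simp add: L2_gauss_def)
qed

lemma fock_diff: "f \<in> fock \<Longrightarrow> g \<in> fock \<Longrightarrow> (\<lambda>z. f z - g z) \<in> fock"
  by (simp add: fock_def entire_diff L2_gauss_diff)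

lemma norm_gauss_nonneg: "0 \<le> norm_gauss f"
  by (simp add: norm_gauss_def)

lemma norm_gauss_eq_0D:
  fixes f :: "complex ^ 'n \<Rightarrow> complex"
  assumes "f \<in> fock" "norm_gauss f = 0" shows "f z = 0"
proof -
  have f: "entire f" "integrable (gauss 1) (\<lambda>z. (cmod (f z))\<^sup>2)"
    using assms by (auto simp: fock_def L2_gauss_def)
  have "(LINT z|gauss 1. (cmod (f z))\<^sup>2) = 0"
    using assms(2) by (simp add: norm_gauss_def)
  then have "AE z in gauss 1. (cmod (f z))\<^sup>2 = 0"
    using f(2) by (subst (asm) integral_nonneg_eq_0_iff_AE) auto
  then have "AE z in lebesgue. f z = 0"
    unfolding gauss_def by (subst (asm) AE_density) (auto simp: measurable_completion)
  then have "negligible {z. f z \<noteq> 0}"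
    by (simp add: completion.AE_iff_null_sets negligible_iff_null_sets)
  moreover have "open {z. f z \<noteq> 0}"
    using entire_continuous[OF f(1)] by (intro open_Collect_neq) auto
  ultimately show ?thesis
    using open_not_negligible by blast
qed

lemma norm_gauss_diff_eq_0D:
  assumes "f \<in> fock" "g \<in> fock" "norm_gauss (\<lambda>z. f z - g z) = 0" shows "f = g"
proof
  fix z
  have "f z - g z = 0"
    by (rule norm_gauss_eq_0D[OF fock_diff[OF assms(1,2)] assms(3)])
  then show "f z = g z" by (rule eq_iff_diff_eq_0[THEN iffD2])
qed

lemma norm_gauss_triangle:
  assumes u: "u \<in> L2_gauss" and v: "v \<in> L2_gauss"
    and uv: "(\<lambda>z. u z + v z) \<in> L2_gauss" and pos: "norm_gauss u > 0" "norm_gauss v > 0"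
  shows "norm_gauss (\<lambda>z. u z + v z) \<le> norm_gauss u + norm_gauss v"
proof -
  define a b where "a = norm_gauss u" and "b = norm_gauss v"
  have ab: "a > 0" "b > 0" using pos by (auto simp: a_def b_def)
  have sq: "(LINT z|gauss 1. (cmod (u z))\<^sup>2) = a\<^sup>2" "(LINT z|gauss 1. (cmod (v z))\<^sup>2) = b\<^sup>2"
    by (simp_all add: a_def b_def norm_gauss_def)
  have pw: "(cmod (x + y))\<^sup>2 \<le> (1 + b / a) * (cmod x)\<^sup>2 + (1 + a / b) * (cmod y)\<^sup>2" for x y
  proof -
    have "(cmod (x + y))\<^sup>2 \<le> (cmod x + cmod y)\<^sup>2"
      by (simp add: norm_triangle_ineq power_mono)
    moreover have "0 \<le> (b * cmod x - a * cmod y)\<^sup>2 / (a * b)"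
      using ab by simp
    moreover have "(b * cmod x - a * cmod y)\<^sup>2 / (a * b)
        = b / a * (cmod x)\<^sup>2 + a / b * (cmod y)\<^sup>2 - 2 * cmod x * cmod y"
      using ab by (simp add: field_simps power2_eq_square)
    ultimately show ?thesis by (simp add: power2_sum algebra_simps)
  qed
  have "(LINT z|gauss 1. (cmod (u z + v z))\<^sup>2)
      \<le> (LINT z|gauss 1. (1 + b / a) * (cmod (u z))\<^sup>2 + (1 + a / b) * (cmod (v z))\<^sup>2)"
    using u v uv pw by (intro integral_mono) (auto simp: L2_gauss_def)
  also have "\<dots> = (1 + b / a) * a\<^sup>2 + (1 + a / b) * b\<^sup>2"
    using u v sq by (simp add: L2_gauss_def)
  also have "\<dots> = (a + b)\<^sup>2"
    using ab by (simp add: field_simps power2_eq_square)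
  finally show ?thesis
    unfolding a_def[symmetric] b_def[symmetric] norm_gauss_def[of "\<lambda>z. u z + v z"]
    using ab by (intro real_le_lsqrt) auto
qed

lemma Metric_space_fock: "Metric_space (fock :: (complex ^ 'n \<Rightarrow> complex) set) fock_dist"
proof
  fix f g h :: "complex ^ 'n \<Rightarrow> complex"
  show "0 \<le> fock_dist f g"
    by (simp add: fock_dist_def norm_gauss_nonneg)
  have "(\<lambda>z. (cmod (f z - g z))\<^sup>2) = (\<lambda>z. (cmod (g z - f z))\<^sup>2)"
    by (rule ext) (metis norm_minus_commute)
  then show "fock_dist f g = fock_dist g f"
    by (simp only: fock_dist_def norm_gauss_def)
  assume fg: "f \<in> fock" "g \<in> fock"
  show "fock_dist f g = 0 \<longleftrightarrow> f = g"
    using norm_gauss_diff_eq_0D[OF fg] by (auto simp: fock_dist_def norm_gauss_def)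
  assume h: "h \<in> fock"
  show "fock_dist f h \<le> fock_dist f g + fock_dist g h"
  proof (cases "norm_gauss (\<lambda>z. f z - g z) = 0 \<or> norm_gauss (\<lambda>z. g z - h z) = 0")
    case True
    then have "f = g \<or> g = h"
      using norm_gauss_diff_eq_0D[OF fg] norm_gauss_diff_eq_0D[OF fg(2) h] by blast
    then show ?thesis
      by (auto simp: fock_dist_def norm_gauss_nonneg)
  next
    case False
    then show ?thesis
      using norm_gauss_triangle[of "\<lambda>z. f z - g z" "\<lambda>z. g z - h z"]
        fock_diff[OF fg] fock_diff[OF fg(2) h] fock_diff[OF fg(1) h]
        norm_gauss_nonneg[of "\<lambda>z. f z - g z"] norm_gauss_nonneg[of "\<lambda>z. g z - h z"]
      by (simp add: fock_dist_def fock_def)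
  qed
qed

end

theory Submission
  imports Defs "HOL-Probability.Distributions" "HOL-Complex_Analysis.Complex_Analysis"
begin

text \<open>
  For a bounded Toeplitz operator with symbol \<open>f\<close> in BMO, the entry \<open>\<langle>T k\<^sub>z, k\<^sub>w\<rangle>\<close> integrates \<open>f\<close> against
  \<open>exp (- |z - w|\<^sup>2 / 4)\<close> times a Gaussian centred at the midpoint \<open>m\<close>. Splitting \<open>f\<close> into its average
  at \<open>m\<close> (which is \<open>\<langle>T k\<^sub>m, k\<^sub>m\<rangle>\<close>, hence bounded) and its oscillation around it shows that the entries
  are \<open>O(exp (- |z - w|\<^sup>2 / 4))\<close>. Gaussian off-diagonal decay survives sums and products.

  If the Berezin transform vanishes at infinity, a Montel argument along complex lines gives
  \<open>\<langle>A k\<^sub>z, k\<^bsub>z+v\<^esub>\<rangle> \<rightarrow> 0\<close> for every \<open>v\<close>, so \<open>\<integral> |\<langle>A k\<^sub>z, k\<^sub>w\<rangle>| dw \<rightarrow> 0\<close> by dominated convergence, and Schur's test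
  shows that \<open>A\<close> maps bounded, pointwise convergent sequences to convergent ones. Conversely, if \<open>A\<close>
  is compact, the vectors \<open>A k\<^sub>z\<close> accumulate at some \<open>l\<close> in the Fock space, and \<open>\<langle>l, k\<^sub>z\<rangle> \<rightarrow> 0\<close>.
\<close>

section \<open>Gaussian measure and the mean value property\<close>

text \<open>Symbols in BMO may be unbounded, so \<open>f\<close> cannot be estimated pointwise; in
  the decay estimate the norm of \<open>T\<close> enters only through the diagonal, which is a
  Gaussian average of \<open>f\<close>. Midpoint and rate 1/4 both come from completing the square
  in the weight times |k_z| |k_w|: what remains is the Gaussian of parameter t = 1 moved to
  \<open>m\<close>, exactly the one that measures oscillation in \<open>BMO\<close>. The obstacle in
  the other half is that the Berezin transform sees only the diagonal. The kernel (A K_z)(w) is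
  antiholomorphic in z and holomorphic in w, so the diagonal determines it, but without any
  quantitative estimate. Normal families therefore give a mere limit for each fixed v, and the
  Gaussian decay supplies the integrable majorant that turns these limits into a statement about
  whole rows of the kernel. This is where the algebra enters: for arbitrary bounded operators a
  vanishing Berezin transform does not imply compactness.\<close>

lemma nn_integral_lborel_shift:
  fixes f :: "'a::euclidean_space \<Rightarrow> ennreal"
  assumes [measurable]: "f \<in> borel_measurable borel"
  shows "(\<integral>\<^sup>+x. f (c + x) \<partial>lborel) = (\<integral>\<^sup>+x. f x \<partial>lborel)"
proof -
  have "(\<integral>\<^sup>+x. f x \<partial>lborel) = (\<integral>\<^sup>+x. f x \<partial>distr lborel borel ((+) c))"
    by (simp add: lborel_distr_plus)
  also have "\<dots> = (\<integral>\<^sup>+x. f (c + x) \<partial>lborel)"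
    by (subst nn_integral_distr) auto
  finally show ?thesis by simp
qed

text \<open>Uniqueness of translation-invariant measures: the integral of \<open>f (R x + y)\<close> over all \<open>x\<close> and over
  \<open>y\<close> in the unit ball is evaluated in both orders.\<close>

lemma nn_integral_lborel_isometry:
  fixes R :: "'a::euclidean_space \<Rightarrow> 'a"
  assumes lin: "linear R" and iso: "\<And>x. norm (R x) = norm x"
    and f[measurable]: "f \<in> borel_measurable borel"
  shows "(\<integral>\<^sup>+x. f (R x) \<partial>lborel) = (\<integral>\<^sup>+x. f x \<partial>lborel)"
proof -
  interpret R: linear R by (rule lin)
  have Rm[measurable]: "R \<in> borel_measurable borel"
    by (intro borel_measurable_continuous_onI linear_continuous_on linear_conv_bounded_linear[THEN iffD1] lin)
  have "inj R"
    by (rule injI) (metis R.diff eq_iff_diff_eq_0 iso norm_eq_zero)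
  then have surj: "\<exists>x. R x = y" for y
    using linear_injective_imp_surjective[OF lin] by (metis surjD)
  define I :: "'a \<Rightarrow> ennreal" where "I = indicator (ball 0 1)"
  define m where "m = emeasure lborel (ball (0::'a) 1)"
  have Im[measurable]: "I \<in> borel_measurable borel" unfolding I_def by (intro borel_measurable_indicator) simp
  have m: "m = (\<integral>\<^sup>+y. I y \<partial>lborel)" by (simp add: I_def m_def)
  have mfin: "m < \<infinity>" unfolding m_def by (rule emeasure_lborel_ball_finite)
  have mpos: "m \<noteq> 0"
    using open_not_negligible[of "ball (0::'a) 1"]
    by (auto simp: m_def negligible_iff_null_sets null_sets_def)
  have shift: "(\<integral>\<^sup>+x. f (R x + y) \<partial>lborel) = (\<integral>\<^sup>+x. f (R x) \<partial>lborel)" for y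
  proof -
    obtain d where d: "R d = y" using surj by blast
    have "(\<integral>\<^sup>+x. f (R x + y) \<partial>lborel) = (\<integral>\<^sup>+x. f (R (d + x)) \<partial>lborel)"
      by (simp add: R.add d add.commute)
    also have "\<dots> = (\<integral>\<^sup>+x. f (R x) \<partial>lborel)"
      by (rule nn_integral_lborel_shift) simp
    finally show ?thesis .
  qed
  \<comment> \<open>As \<open>R\<close> is an isometry, the set of \<open>x\<close> with
    \<open>y - R x\<close> in the unit ball is again a unit ball, centred at the preimage
    \<open>d\<close> of \<open>y\<close>; so its volume does not depend on \<open>y\<close>.\<close>
  have ball: "(\<integral>\<^sup>+x. I (y - R x) \<partial>lborel) = m" for y
  proof -
    obtain d where d: "R d = y" using surj by blast
    have "I (y - R x) = indicator (ball d 1) x" for x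
    proof -
      have "norm (y - R x) = norm (d - x)"
        by (metis R.diff d iso)
      then show ?thesis by (simp add: I_def indicator_def dist_norm norm_minus_commute)
    qed
    then have "(\<integral>\<^sup>+x. I (y - R x) \<partial>lborel) = (\<integral>\<^sup>+x. indicator (ball d 1) x \<partial>lborel)"
      by simp
    also have "\<dots> = (\<integral>\<^sup>+x. indicator (ball d 1) (d + x) \<partial>lborel)"
      by (rule nn_integral_lborel_shift[symmetric]) (intro borel_measurable_indicator, simp)
    also have "(\<lambda>x. indicator (ball d 1) (d + x)) = I"
      by (auto simp: I_def fun_eq_iff indicator_def dist_norm)
    finally show ?thesis by (simp add: m)
  qed
  have "m * (\<integral>\<^sup>+x. f (R x) \<partial>lborel) = (\<integral>\<^sup>+y. I y * (\<integral>\<^sup>+x. f (R x + y) \<partial>lborel) \<partial>lborel)"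
    by (simp add: m shift nn_integral_multc)
  also have "\<dots> = (\<integral>\<^sup>+y. (\<integral>\<^sup>+x. I y * f (R x + y) \<partial>lborel) \<partial>lborel)"
    by (simp add: nn_integral_cmult)
  also have "\<dots> = (\<integral>\<^sup>+x. (\<integral>\<^sup>+y. I y * f (R x + y) \<partial>lborel) \<partial>lborel)"
    by (rule lborel_pair.Fubini') measurable
  also have "\<dots> = (\<integral>\<^sup>+x. (\<integral>\<^sup>+y. I (y - R x) * f y \<partial>lborel) \<partial>lborel)"
  proof (rule nn_integral_cong)
    fix x
    show "(\<integral>\<^sup>+y. I y * f (R x + y) \<partial>lborel) = (\<integral>\<^sup>+y. I (y - R x) * f y \<partial>lborel)"
      using nn_integral_lborel_shift[of "\<lambda>y. I (y - R x) * f y" "R x"] by simp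
  qed
  also have "\<dots> = (\<integral>\<^sup>+y. (\<integral>\<^sup>+x. I (y - R x) * f y \<partial>lborel) \<partial>lborel)"
    by (rule lborel_pair.Fubini') measurable
  also have "\<dots> = m * (\<integral>\<^sup>+y. f y \<partial>lborel)"
    by (simp add: nn_integral_multc ball nn_integral_cmult)
  finally show ?thesis
    using mfin mpos by (auto simp: ennreal_mult_cancel_left)
qed

lemma nn_integral_exp_norm_square:
  assumes "a > 0"
  shows "(\<integral>\<^sup>+x. ennreal (exp (- a * (norm x)\<^sup>2)) \<partial>(lborel :: 'a::euclidean_space measure))
    = ennreal (sqrt (pi / a) ^ DIM('a))"
proof -
  have one: "(\<integral>\<^sup>+x. ennreal (exp (- a * x\<^sup>2)) \<partial>lborel) = ennreal (sqrt (pi / a))"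
  proof -
    \<comment> \<open>With variance 1 / (2 a) the normal density is a multiple of exp (- a x^2), and
      its total mass 1 gives the one-dimensional integral.\<close>
    define s where "s = 1 / sqrt (2 * a)"
    have s: "s > 0" "2 * s\<^sup>2 = 1 / a" using assms by (auto simp: s_def power_divide)
    have eq: "exp (- a * x\<^sup>2) = sqrt (pi / a) * normal_density 0 s x" for x
    proof -
      have "2 * pi * s\<^sup>2 = pi / a" using s(2) assms by (simp add: field_simps)
      moreover have "- (x\<^sup>2) / (2 * s\<^sup>2) = - a * x\<^sup>2" unfolding s(2) using assms by simp
      ultimately show ?thesis using assms by (simp add: normal_density_def)
    qed
    have "(\<integral>\<^sup>+x. ennreal (sqrt (pi / a) * normal_density 0 s x) \<partial>lborel)
      = ennreal (\<integral>x. sqrt (pi / a) * normal_density 0 s x \<partial>lborel)"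
      using s assms by (intro nn_integral_eq_integral) auto
    also have "\<dots> = ennreal (sqrt (pi / a))"
      using s by simp
    finally show ?thesis unfolding eq .
  qed
  have "ennreal (exp (- a * (norm x)\<^sup>2)) = (\<Prod>b\<in>Basis. ennreal (exp (- a * (x \<bullet> b)\<^sup>2)))" for x :: 'a
  proof -
    have "(norm x)\<^sup>2 = (\<Sum>b\<in>Basis. (x \<bullet> b)\<^sup>2)"
      by (subst power2_norm_eq_inner, subst euclidean_inner) (simp add: power2_eq_square)
    then have "exp (- a * (norm x)\<^sup>2) = (\<Prod>b\<in>Basis. exp (- a * (x \<bullet> b)\<^sup>2))"
      by (simp add: sum_distrib_left flip: exp_sum sum_negf)
    then show ?thesis by (simp add: prod_ennreal)
  qed
  then have "(\<integral>\<^sup>+x. ennreal (exp (- a * (norm x)\<^sup>2)) \<partial>(lborel :: 'a measure))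
     = (\<Prod>b\<in>(Basis::'a set). (\<integral>\<^sup>+x. ennreal (exp (- a * x\<^sup>2)) \<partial>lborel))"
    by (simp only:) (subst nn_integral_lborel_prod[where f="\<lambda>b x. ennreal (exp (- a * x\<^sup>2))"], auto)
  also have "\<dots> = ennreal (sqrt (pi / a) ^ DIM('a))"
    unfolding one using assms by (simp add: ennreal_power)
  finally show ?thesis .
qed

section \<open>The Gaussian weight and its Borel version\<close>

definition gw :: "complex ^ 'n \<Rightarrow> real" where
  "gw z = exp (- (norm z)\<^sup>2) / pi ^ CARD('n)"

lemma gw_pos: "gw z > 0"
  by (simp add: gw_def)

lemma gw_nonneg [simp]: "0 \<le> gw z"
  using gw_pos[of z] by simp

lemma gw_measurable [measurable]: "gw \<in> borel_measurable borel"
  unfolding gw_def[abs_def] by measurable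

lemma gw_measurable_lebesgue [measurable]: "gw \<in> borel_measurable lebesgue"
  by (simp add: measurable_completion)

lemma gauss_eq: "gauss 1 = density lebesgue (\<lambda>z. ennreal (gw z))"
  by (simp add: gauss_def gw_def)

lemma nn_integral_gauss:
  assumes [measurable]: "f \<in> borel_measurable lebesgue"
  shows "(\<integral>\<^sup>+z. f z \<partial>gauss 1) = (\<integral>\<^sup>+z. ennreal (gw z) * f z \<partial>lborel)"
proof -
  have "(\<integral>\<^sup>+z. f z \<partial>gauss 1) = (\<integral>\<^sup>+z. ennreal (gw z) * f z \<partial>lebesgue)"
    unfolding gauss_eq by (rule nn_integral_density) auto
  then show ?thesis by (simp add: nn_integral_completion)
qed

text \<open>\<open>gauss 1\<close> lives on the Lebesgue sets, where continuous maps need not be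
  measurable and products are awkward. Entire functions are Borel, so their integrals may be
  computed with this measure, for which image measures and Fubini are available.\<close>

definition gauss_borel :: "(complex ^ 'n) measure" where
  "gauss_borel = density lborel (\<lambda>z. ennreal (gw z))"

lemma space_gauss_borel [simp]: "space gauss_borel = UNIV"
  by (simp add: gauss_borel_def)

lemma sets_gauss_borel [measurable_cong, simp]: "sets gauss_borel = sets borel"
  by (simp add: gauss_borel_def)

lemma nn_integral_gauss_borel:
  assumes [measurable]: "f \<in> borel_measurable borel"
  shows "(\<integral>\<^sup>+z. f z \<partial>gauss_borel) = (\<integral>\<^sup>+z. ennreal (gw z) * f z \<partial>lborel)"
  unfolding gauss_borel_def by (rule nn_integral_density) auto

lemma gauss_borel_eq:
  assumes f[measurable]: "(f :: complex ^ 'n \<Rightarrow> 'b::{banach,second_countable_topology}) \<in> borel_measurable borel"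
  shows integrable_gauss_borel_iff: "integrable gauss_borel f \<longleftrightarrow> integrable (gauss 1) f"
    and integral_gauss_borel: "(LINT z|gauss_borel. f z) = (LINT z|gauss 1. f z)"
  unfolding gauss_borel_def gauss_eq
  using f[THEN measurable_completion]
  by (simp_all add: integrable_density integral_density integrable_completion integral_completion
      measurable_completion)

lemma prob_space_gauss_borel: "prob_space (gauss_borel :: (complex ^ 'n) measure)"
proof
  have "emeasure (gauss_borel :: (complex ^ 'n) measure) (space gauss_borel)
      = (\<integral>\<^sup>+(z::complex ^ 'n). 1 \<partial>gauss_borel)"
    by simp
  also have "\<dots> = (\<integral>\<^sup>+(z::complex ^ 'n). ennreal (1 / pi ^ CARD('n)) * ennreal (exp (- 1 * (norm z)\<^sup>2)) \<partial>lborel)"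
    by (subst nn_integral_gauss_borel) (auto simp: gw_def ennreal_mult[symmetric])
  also have "\<dots> = ennreal (1 / pi ^ CARD('n)) * ennreal (sqrt pi ^ (2 * CARD('n)))"
    by (subst nn_integral_cmult, simp, subst nn_integral_exp_norm_square) (auto simp: mult.commute)
  also have "\<dots> = 1"
    by (simp add: power_mult ennreal_mult[symmetric])
  finally show "emeasure (gauss_borel :: (complex ^ 'n) measure) (space gauss_borel) = 1" .
qed

text \<open>Multiplication by a unimodular scalar is a real linear isometry and \<open>gw\<close> is
  radial. This is the symmetry over which the mean value property averages.\<close>

lemma gauss_borel_rotate:
  fixes c :: complex assumes "cmod c = 1"
  shows "distr gauss_borel gauss_borel (\<lambda>v. c *s v) = (gauss_borel :: (complex ^ 'n) measure)"
proof -
  have nrm: "norm (c *s v) = norm v" for v :: "complex ^ 'n"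
    using assms by (simp add: norm_vec_def norm_mult)
  have lin: "linear (\<lambda>v::complex ^ 'n. c *s v)"
    by (rule linearI) (auto simp: vec_eq_iff algebra_simps)
  have m[measurable]: "(\<lambda>v::complex ^ 'n. c *s v) \<in> borel_measurable borel"
    by (intro borel_measurable_continuous_onI linear_continuous_on linear_conv_bounded_linear[THEN iffD1] lin)
  show ?thesis
  proof (rule measure_eqI)
    fix A :: "(complex ^ 'n) set"
    assume "A \<in> sets (distr gauss_borel gauss_borel (\<lambda>v. c *s v))"
    then have [measurable]: "A \<in> sets borel" by simp
    have pre: "(\<lambda>v. c *s v) -` A \<in> sets borel"
      using measurable_sets[OF m, of A] by simp
    have "emeasure (distr gauss_borel gauss_borel (\<lambda>v. c *s v)) A = emeasure gauss_borel ((\<lambda>v. c *s v) -` A)"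
      by (subst emeasure_distr) auto
    also have "\<dots> = (\<integral>\<^sup>+z. indicator ((\<lambda>v. c *s v) -` A) z \<partial>gauss_borel)"
      using pre by (simp add: nn_integral_indicator)
    also have "\<dots> = (\<integral>\<^sup>+z. ennreal (gw z) * indicator ((\<lambda>v. c *s v) -` A) z \<partial>lborel)"
      using pre by (subst nn_integral_gauss_borel) auto
    also have "\<dots> = (\<integral>\<^sup>+z. ennreal (gw (c *s z)) * indicator A (c *s z) \<partial>lborel)"
      by (simp add: gw_def nrm indicator_def)
    also have "\<dots> = (\<integral>\<^sup>+z. ennreal (gw z) * indicator A z \<partial>lborel)"
      by (rule nn_integral_lborel_isometry[OF lin nrm]) simp
    also have "\<dots> = emeasure gauss_borel A"
      by (subst nn_integral_gauss_borel[symmetric]) auto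
    finally show "emeasure (distr gauss_borel gauss_borel (\<lambda>v. c *s v)) A = emeasure gauss_borel A" .
  qed simp
qed

section \<open>The mean value property of entire functions\<close>

text \<open>On the circle parametrised by t in [0, 1] one has d zeta = 2 pi i zeta dt, so the
  prefactor of Cauchy's formula cancels and the kernel zeta / (zeta - w) remains. The case w = 0 is
  the mean value property; general w is needed for the iterated formula in
  \<open>holomorphic_on_diagonal\<close>.\<close>

lemma Cauchy_circle:
  assumes f: "f holomorphic_on UNIV" and w: "cmod w < r"
  shows "((\<lambda>t. f (r * exp (2 * of_real pi * \<i> * of_real t)) *
      (r * exp (2 * of_real pi * \<i> * of_real t) / (r * exp (2 * of_real pi * \<i> * of_real t) - w)))
     has_integral f w) {0..1}"
proof -
  have r: "r > 0" using w by (smt (verit) norm_ge_zero)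
  have "((\<lambda>u. f u / (u - w)) has_contour_integral (2 * of_real pi * \<i> * f w)) (circlepath 0 r)"
    using f w by (intro Cauchy_integral_circlepath_simple) (auto intro: holomorphic_on_subset)
  then have "((\<lambda>t. f (circlepath 0 r t) / (circlepath 0 r t - w) *
      vector_derivative (circlepath 0 r) (at t within {0..1})) has_integral (2 * of_real pi * \<i> * f w)) {0..1}"
    by (simp add: has_contour_integral_def)
  then have "((\<lambda>t. f (circlepath 0 r t) / (circlepath 0 r t - w) *
      (2 * pi * \<i> * r * exp (2 * of_real pi * \<i> * of_real t))) has_integral (2 * of_real pi * \<i> * f w)) {0..1}"
    by (rule has_integral_eq[rotated]) (simp add: vector_derivative_circlepath01)
  then have "((\<lambda>t. inverse (2 * of_real pi * \<i>) * (f (circlepath 0 r t) / (circlepath 0 r t - w) *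
      (2 * pi * \<i> * r * exp (2 * of_real pi * \<i> * of_real t))))
      has_integral (inverse (2 * of_real pi * \<i>) * (2 * of_real pi * \<i> * f w))) {0..1}"
    by (rule has_integral_mult_right)
  then show ?thesis
    by (rule has_integral_eq_rhs[OF has_integral_eq[rotated]]) (auto simp: circlepath field_simps)
qed

lemma entire_line:
  assumes "entire f"
  shows "(\<lambda>l. f (a + l *s b)) holomorphic_on UNIV"
proof -
  have "\<exists>D'. ((\<lambda>l. f (a + l *s b)) has_field_derivative D') (at x)" for x
  proof -
    obtain D where D: "(f has_derivative D) (at (a + x *s b))" "\<And>c v. D (c *s v) = c * D v"
      using assms unfolding entire_def by blast
    have lin: "bounded_linear (\<lambda>l::complex. l *s b)"
      by (intro linear_conv_bounded_linear[THEN iffD1] linearI) (auto simp: vec_eq_iff algebra_simps)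
    have "((\<lambda>l. a + l *s b) has_derivative (\<lambda>l. l *s b)) (at x)"
      using bounded_linear.has_derivative[OF lin has_derivative_ident]
      by (auto intro!: derivative_eq_intros)
    then have "((\<lambda>l. f (a + l *s b)) has_derivative (\<lambda>l. D (l *s b))) (at x)"
      by (rule has_derivative_compose) (rule D(1))
    then have "((\<lambda>l. f (a + l *s b)) has_field_derivative (D b)) (at x)"
      unfolding has_field_derivative_def by (simp add: D(2) mult.commute[of _ "D b"])
    then show ?thesis ..
  qed
  then show ?thesis by (simp add: holomorphic_on_def field_differentiable_def)
qed

lemma continuous_on_smult [continuous_intros]:
  fixes g :: "'a::topological_space \<Rightarrow> complex ^ 'n"
  assumes "continuous_on S f" "continuous_on S g"
  shows "continuous_on S (\<lambda>x. f x *s g x)"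
  unfolding vector_scalar_mult_def
  by (intro continuous_on_vec_lambda continuous_intros assms)

lemma entire_borel_measurable: "entire f \<Longrightarrow> f \<in> borel_measurable borel"
  by (intro borel_measurable_continuous_onI entire_continuous)

text \<open>Rotation invariance allows \<open>G z\<close> to be replaced by its average over all
  \<open>e t *s z\<close>. By Fubini this average can be taken first, on the complex line through
  \<open>z\<close>, where the one-variable mean value property gives the constant
  \<open>G 0\<close>. Integrability of \<open>G\<close> takes the place of any growth
  condition.\<close>

lemma entire_mean_value:
  fixes G :: "complex ^ 'n \<Rightarrow> complex"
  assumes G: "entire G" and int: "integrable (gauss 1) G"
  shows "(LINT z|gauss 1. G z) = G 0"
proof -
  interpret prob_space "gauss_borel :: (complex ^ 'n) measure" by (rule prob_space_gauss_borel)
  have Gm[measurable]: "G \<in> borel_measurable borel" by (rule entire_borel_measurable[OF G])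
  have intb: "integrable gauss_borel G"
    using int by (simp add: integrable_gauss_borel_iff)
  define e :: "real \<Rightarrow> complex" where "e t = exp (2 * of_real pi * \<i> * of_real t)" for t
  have ce: "continuous_on UNIV e" unfolding e_def by (intro continuous_intros)
  have e1: "cmod (e t) = 1" for t by (simp add: e_def)
  define U :: "real measure" where "U = restrict_space lborel {0..1}"
  have sU: "space U = {0..1}" by (simp add: U_def space_restrict_space)
  have U: "prob_space U"
    by (rule prob_spaceI) (simp add: U_def emeasure_restrict_space space_restrict_space)
  interpret U: prob_space U by (rule U)
  interpret P: pair_sigma_finite U "gauss_borel :: (complex ^ 'n) measure" ..
  have gm: "(\<lambda>(t, z). G (e t *s z)) \<in> borel_measurable (U \<Otimes>\<^sub>M gauss_borel)"
  proof -
    have "(\<lambda>(t, z). G (e t *s z)) \<in> borel_measurable (borel \<Otimes>\<^sub>M borel)"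
      unfolding borel_prod case_prod_unfold
      by (intro borel_measurable_continuous_onI continuous_on_compose2[OF entire_continuous[OF G]]
          continuous_intros continuous_on_compose2[OF ce]) auto
    moreover have "(\<lambda>p. (fst p, snd p)) \<in> measurable (U \<Otimes>\<^sub>M gauss_borel) (borel \<Otimes>\<^sub>M borel)"
    proof (rule measurable_Pair)
      show "snd \<in> measurable (U \<Otimes>\<^sub>M gauss_borel) borel"
        using measurable_snd by (simp cong: measurable_cong_sets)
      have "(\<lambda>x. x) \<in> measurable U borel"
        unfolding U_def by (rule measurable_restrict_space1) simp
      then show "fst \<in> measurable (U \<Otimes>\<^sub>M gauss_borel) borel"
        by (rule measurable_compose[OF measurable_fst])
    qed
    ultimately show ?thesis
      by (auto dest: measurable_compose)
  qed
  have rot: "integrable gauss_borel (\<lambda>z. G (e t *s z))"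
      "(LINT z|gauss_borel. G (e t *s z)) = (LINT z|gauss_borel. G z)"
      "(LINT z|gauss_borel. cmod (G (e t *s z))) = (LINT z|gauss_borel. cmod (G z))" for t
  proof -
    have m: "(\<lambda>z::complex^'n. e t *s z) \<in> measurable gauss_borel gauss_borel"
      by (simp cong: measurable_cong_sets) (intro borel_measurable_continuous_onI continuous_intros)
    note d = gauss_borel_rotate[OF e1[of t], where 'n='n]
    show "integrable gauss_borel (\<lambda>z. G (e t *s z))"
      by (rule integrable_distr[OF m]) (simp add: d intb)
    show "(LINT z|gauss_borel. G (e t *s z)) = (LINT z|gauss_borel. G z)"
      by (subst integral_distr[OF m, symmetric]) (auto simp: d)
    show "(LINT z|gauss_borel. cmod (G (e t *s z))) = (LINT z|gauss_borel. cmod (G z))"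
      by (subst integral_distr[OF m, symmetric, where f="\<lambda>z. cmod (G z)"]) (auto simp: d)
  qed
  \<comment> \<open>The integral of |G (e t *s z)| over \<open>z\<close> is the same for all
    \<open>t\<close>, so joint integrability reduces to that of \<open>G\<close>.\<close>
  have pint: "integrable (U \<Otimes>\<^sub>M gauss_borel) (\<lambda>(t, z). G (e t *s z))"
    by (rule P.Fubini_integrable) (auto simp: gm rot)
  have "(LINT z|gauss_borel. G z) = (LINT t|U. (LINT z|gauss_borel. G (e t *s z)))"
    by (simp add: rot U.prob_space)
  also have "\<dots> = (LINT z|gauss_borel. (LINT t|U. G (e t *s z)))"
    using P.Fubini_integral[of "\<lambda>t z. G (e t *s z)", OF pint] by simp
  also have "\<dots> = (LINT z|(gauss_borel :: (complex ^ 'n) measure). G 0)"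
  proof (rule Bochner_Integration.integral_cong[OF refl])
    fix z :: "complex ^ 'n"
    have "((\<lambda>t. G (0 + (1 * e t) *s z) * (1 * e t / (1 * e t - 0))) has_integral G (0 + 0 *s z)) {0..1}"
      using Cauchy_circle[OF entire_line[OF G, of 0 z], of 0 1] by (simp add: e_def)
    then have hi: "((\<lambda>t. G (e t *s z)) has_integral G 0) {0..1}"
      by (rule has_integral_eq_rhs[OF has_integral_eq[rotated]]) (auto simp: e_def)
    have "set_integrable lborel {0..1} (\<lambda>t. G (e t *s z))"
      by (intro borel_integrable_atLeastAtMost' continuous_on_compose2[OF entire_continuous[OF G]]
          continuous_intros continuous_on_subset[OF ce]) auto
    then have "(LINT t:{0..1}|lborel. G (e t *s z)) = integral {0..1} (\<lambda>t. G (e t *s z))"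
      by (rule set_borel_integral_eq_integral(2))
    also have "\<dots> = G 0" using hi by (rule integral_unique)
    finally show "(LINT t|U. G (e t *s z)) = G 0"
      by (simp add: U_def integral_restrict_space set_lebesgue_integral_def)
  qed
  also have "\<dots> = G 0" using prob_space by simp
  finally show ?thesis by (simp add: integral_gauss_borel)
qed

section \<open>Reproducing kernels\<close>

lemma L2_gaussD:
  assumes "f \<in> L2_gauss"
  shows "f \<in> borel_measurable lebesgue" "integrable (gauss 1) (\<lambda>z. (cmod (f z))\<^sup>2)"
  using assms by (auto simp: L2_gauss_def)

lemma L2_gauss_cmult: "f \<in> L2_gauss \<Longrightarrow> (\<lambda>z. c * f z) \<in> L2_gauss"
  by (auto simp: L2_gauss_def norm_mult power_mult_distrib)

lemma L2_gauss_add: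
  assumes "f \<in> L2_gauss" "g \<in> L2_gauss" shows "(\<lambda>z. f z + g z) \<in> L2_gauss"
  using L2_gauss_diff[OF assms(1) L2_gauss_cmult[OF assms(2), of "-1"]] by simp

lemma nn_integral_norm_gauss:
  assumes "f \<in> L2_gauss"
  shows "(\<integral>\<^sup>+z. ennreal ((cmod (f z))\<^sup>2) \<partial>gauss 1) = ennreal ((norm_gauss f)\<^sup>2)"
  using L2_gaussD[OF assms] by (subst nn_integral_eq_integral) (auto simp: norm_gauss_def)

lemma L2_gauss_nnI:
  assumes [measurable]: "f \<in> borel_measurable lebesgue"
    and le: "(\<integral>\<^sup>+z. ennreal ((cmod (f z))\<^sup>2) \<partial>gauss 1) \<le> ennreal (B\<^sup>2)" and "0 \<le> B"
  shows "f \<in> L2_gauss" "norm_gauss f \<le> B"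
proof -
  have "integrable (gauss 1) (\<lambda>z. (cmod (f z))\<^sup>2)"
    using le by (intro integrableI_nonneg) (auto intro: le_less_trans)
  then show L2: "f \<in> L2_gauss" by (simp add: L2_gauss_def)
  have "ennreal ((norm_gauss f)\<^sup>2) \<le> ennreal (B\<^sup>2)"
    using le nn_integral_norm_gauss[OF L2] by simp
  then show "norm_gauss f \<le> B"
    using \<open>0 \<le> B\<close> norm_gauss_nonneg[of f] by (simp add: abs_le_square_iff[symmetric])
qed

lemma integrable_L2_mult:
  assumes "f \<in> L2_gauss" "g \<in> L2_gauss"
  shows "integrable (gauss 1) (\<lambda>z. f z * g z)"
proof (rule Bochner_Integration.integrable_bound)
  note [measurable] = L2_gaussD(1)[OF assms(1)] L2_gaussD(1)[OF assms(2)]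
  show "integrable (gauss 1) (\<lambda>z. (cmod (f z))\<^sup>2 + (cmod (g z))\<^sup>2)"
    using L2_gaussD(2)[OF assms(1)] L2_gaussD(2)[OF assms(2)] by auto
  show "(\<lambda>z. f z * g z) \<in> borel_measurable (gauss 1)" by measurable
  show "AE z in gauss 1. norm (f z * g z) \<le> norm ((cmod (f z))\<^sup>2 + (cmod (g z))\<^sup>2)"
  proof (rule AE_I2)
    fix z
    have "cmod (f z) * cmod (g z) \<le> (cmod (f z))\<^sup>2 + (cmod (g z))\<^sup>2"
      using sum_squares_bound[of "cmod (f z)" "cmod (g z)"]
        mult_nonneg_nonneg[of "cmod (f z)" "cmod (g z)"] by (simp add: mult.assoc del: mult_nonneg_nonneg)
    then show "norm (f z * g z) \<le> norm ((cmod (f z))\<^sup>2 + (cmod (g z))\<^sup>2)"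
      by (simp add: norm_mult)
  qed
qed

lemma cnj_measurable [measurable (raw)]:
  assumes "f \<in> borel_measurable M" shows "(\<lambda>x. cnj (f x)) \<in> borel_measurable M"
  using assms by (rule measurable_compose) (intro borel_measurable_continuous_onI continuous_intros)

lemma L2_gauss_cnj: "f \<in> L2_gauss \<Longrightarrow> (\<lambda>z. cnj (f z)) \<in> L2_gauss"
  by (auto simp: L2_gauss_def)

lemma integrable_inner_gauss:
  assumes "f \<in> L2_gauss" "g \<in> L2_gauss"
  shows "integrable (gauss 1) (\<lambda>z. f z * cnj (g z))"
  by (rule integrable_L2_mult[OF assms(1) L2_gauss_cnj[OF assms(2)]])

lemma integral_cmod_mult_le:
  assumes f: "f \<in> L2_gauss" and g: "g \<in> L2_gauss"
  shows "(LINT z|gauss 1. cmod (f z * g z)) \<le> norm_gauss f * norm_gauss g"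
proof -
  note [measurable] = L2_gaussD(1)[OF f] L2_gaussD(1)[OF g]
  let ?I = "LINT z|gauss 1. cmod (f z * g z)"
  have "ennreal (?I\<^sup>2) = (\<integral>\<^sup>+z. ennreal (cmod (f z)) * ennreal (cmod (g z)) \<partial>gauss 1)\<^sup>2"
    by (subst ennreal_mult[symmetric], simp, simp, subst nn_integral_eq_integral)
       (use integrable_norm[OF integrable_L2_mult[OF f g]] in \<open>auto simp: norm_mult ennreal_power\<close>)
  also have "\<dots> \<le> (\<integral>\<^sup>+z. (ennreal (cmod (f z)))\<^sup>2 \<partial>gauss 1) * (\<integral>\<^sup>+z. (ennreal (cmod (g z)))\<^sup>2 \<partial>gauss 1)"
    by (rule Cauchy_Schwarz_nn_integral) measurable
  also have "\<dots> = ennreal ((norm_gauss f * norm_gauss g)\<^sup>2)"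
    using f g by (simp add: ennreal_power nn_integral_norm_gauss ennreal_mult[symmetric] power_mult_distrib)
  finally have "?I\<^sup>2 \<le> (norm_gauss f * norm_gauss g)\<^sup>2"
    by simp
  then show ?thesis
    by (rule power2_le_imp_le) (simp add: norm_gauss_nonneg)
qed

lemma norm_gauss_cnj: "norm_gauss (\<lambda>z. cnj (f z)) = norm_gauss f"
  by (simp add: norm_gauss_def)

lemma inner_gauss_le:
  assumes f: "f \<in> L2_gauss" and g: "g \<in> L2_gauss"
  shows "cmod (inner_gauss f g) \<le> norm_gauss f * norm_gauss g"
proof -
  have "cmod (inner_gauss f g) \<le> (LINT z|gauss 1. cmod (f z * cnj (g z)))"
    unfolding inner_gauss_def by (rule integral_norm_bound)
  also have "\<dots> \<le> norm_gauss f * norm_gauss g"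
    using integral_cmod_mult_le[OF f L2_gauss_cnj[OF g]] by (simp add: norm_gauss_cnj)
  finally show ?thesis .
qed

lemma inner_gauss_add_left:
  "f \<in> L2_gauss \<Longrightarrow> g \<in> L2_gauss \<Longrightarrow> u \<in> L2_gauss \<Longrightarrow>
    inner_gauss (\<lambda>z. f z + g z) u = inner_gauss f u + inner_gauss g u"
  unfolding inner_gauss_def
  by (simp add: distrib_right integrable_inner_gauss)

lemma inner_gauss_diff_left:
  "f \<in> L2_gauss \<Longrightarrow> g \<in> L2_gauss \<Longrightarrow> u \<in> L2_gauss \<Longrightarrow>
    inner_gauss (\<lambda>z. f z - g z) u = inner_gauss f u - inner_gauss g u"
  unfolding inner_gauss_def
  by (simp add: left_diff_distrib integrable_inner_gauss)

lemma inner_gauss_cmult_left: "inner_gauss (\<lambda>z. c * f z) u = c * inner_gauss f u"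
  unfolding inner_gauss_def by (simp add: mult.assoc)

lemma inner_gauss_commute: "inner_gauss g f = cnj (inner_gauss f g)"
  unfolding inner_gauss_def by (simp flip: Bochner_Integration.integral_cnj add: mult.commute)

lemma inner_gauss_cmult_right: "inner_gauss f (\<lambda>z. c * u z) = cnj c * inner_gauss f u"
  by (metis complex_cnj_mult inner_gauss_cmult_left inner_gauss_commute)

lemma norm_gauss_cmult: "norm_gauss (\<lambda>z. c * f z) = cmod c * norm_gauss f"
  by (simp add: norm_gauss_def norm_mult power_mult_distrib real_sqrt_mult)

lemma norm_gauss_add_square:
  assumes f: "f \<in> L2_gauss" and g: "g \<in> L2_gauss"
  shows "(norm_gauss (\<lambda>z. f z + g z))\<^sup>2 = (norm_gauss f)\<^sup>2 + 2 * Re (inner_gauss f g) + (norm_gauss g)\<^sup>2"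
proof -
  have sq: "(norm_gauss u)\<^sup>2 = (LINT z|gauss 1. (cmod (u z))\<^sup>2)" for u :: "complex ^ 'n \<Rightarrow> complex"
    by (simp add: norm_gauss_def)
  have "Re (inner_gauss f g) = (LINT z|gauss 1. Re (f z * cnj (g z)))"
    unfolding inner_gauss_def using integrable_inner_gauss[OF f g] by (rule integral_Re[symmetric])
  moreover have "integrable (gauss 1) (\<lambda>z. Re (f z * cnj (g z)))"
    using integrable_inner_gauss[OF f g] by (rule integrable_Re)
  moreover have "(cmod (x + y))\<^sup>2 = (cmod x)\<^sup>2 + 2 * Re (x * cnj y) + (cmod y)\<^sup>2" for x y
    by (simp add: cmod_power2 power2_sum algebra_simps)
  ultimately show ?thesis
    unfolding sq using L2_gaussD(2)[OF f] L2_gaussD(2)[OF g]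
    by (simp del: times_complex.simps)
qed

section \<open>Entire functions and the Hermitian product\<close>

lemma entire_mult:
  assumes "entire f" "entire g" shows "entire (\<lambda>z. f z * g z)"
  unfolding entire_def
proof
  fix z
  from assms obtain D E where
    "(f has_derivative D) (at z)" "\<forall>c v. D (c *s v) = c * D v"
    "(g has_derivative E) (at z)" "\<forall>c v. E (c *s v) = c * E v"
    unfolding entire_def by meson
  then show "\<exists>D. ((\<lambda>z. f z * g z) has_derivative D) (at z) \<and> (\<forall>c v. D (c *s v) = c * D v)"
    by (intro exI[of _ "\<lambda>v. f z * E v + D v * g z"] conjI has_derivative_mult) (auto simp: algebra_simps)
qed

lemma entire_const: "entire (\<lambda>z. c)"
  unfolding entire_def by (auto intro!: exI[of _ "\<lambda>v. 0"])

lemma entire_cmult: "entire f \<Longrightarrow> entire (\<lambda>z. c * f z)"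
  by (rule entire_mult[OF entire_const])

lemma entire_add:
  assumes "entire f" "entire g" shows "entire (\<lambda>z. f z + g z)"
  using entire_diff[OF assms(1) entire_cmult[OF assms(2), of "-1"]] by simp

lemma entire_shift:
  assumes "entire f" shows "entire (\<lambda>z. f (a + z))"
  unfolding entire_def
proof
  fix z
  from assms obtain D where D: "(f has_derivative D) (at (a + z))" "\<forall>c v. D (c *s v) = c * D v"
    unfolding entire_def by meson
  have "((\<lambda>z. a + z) has_derivative (\<lambda>v. v)) (at z)"
    by (auto intro!: derivative_eq_intros)
  then have "((\<lambda>z. f (a + z)) has_derivative (\<lambda>v. D v)) (at z)"
    by (rule has_derivative_compose) (rule D(1))
  with D(2) show "\<exists>D. ((\<lambda>z. f (a + z)) has_derivative D) (at z) \<and> (\<forall>c v. D (c *s v) = c * D v)"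
    by auto
qed

lemma hdot_add_right: "hdot w (u + v) = hdot w u + hdot w v"
  by (simp add: hdot_def algebra_simps sum.distrib)

lemma hdot_smult_left: "hdot (c *s u) w = c * hdot u w"
  by (simp add: hdot_def algebra_simps sum_distrib_left)

lemma hdot_smult_right: "hdot w (c *s u) = cnj c * hdot w u"
  by (simp add: hdot_def algebra_simps sum_distrib_left)

lemma cnj_hdot: "cnj (hdot u w) = hdot w u"
  by (simp add: hdot_def mult.commute)

lemma Re_hdot: "Re (hdot u w) = u \<bullet> w"
  by (simp add: hdot_def inner_vec_def inner_complex_def)

lemma hdot_self: "hdot u u = of_real ((norm u)\<^sup>2)"
proof -
  have "Im (hdot u u) = 0" using cnj_hdot[of u u] by (metis Reals_cnj_iff complex_is_Real_iff)
  then show ?thesis by (simp add: complex_eq_iff Re_hdot power2_norm_eq_inner)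
qed

lemma bounded_linear_hdot_left: "bounded_linear (\<lambda>u. hdot u w)"
  by (intro linear_conv_bounded_linear[THEN iffD1] linearI)
     (auto simp: hdot_def algebra_simps sum.distrib scaleR_sum_right)

lemma entire_exp_hdot: "entire (\<lambda>w. exp (c * hdot w z))"
  unfolding entire_def
proof
  fix w
  let ?D = "\<lambda>v. c * hdot v z"
  have "((\<lambda>w. c * hdot w z) has_derivative ?D) (at w)"
    by (intro has_derivative_mult_right bounded_linear.has_derivative[OF bounded_linear_hdot_left] has_derivative_ident)
  then have "((\<lambda>w. exp (c * hdot w z)) has_derivative (\<lambda>v. exp (c * hdot w z) * ?D v)) (at w)"
    by (rule has_derivative_compose)
      (use DERIV_exp[of "c * hdot w z"] in \<open>simp add: has_field_derivative_def\<close>)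
  then show "\<exists>D. ((\<lambda>w. exp (c * hdot w z)) has_derivative D) (at w) \<and> (\<forall>c v. D (c *s v) = c * D v)"
    by (intro exI[of _ "\<lambda>v. exp (c * hdot w z) * ?D v"]) (simp add: hdot_smult_left)
qed

lemma continuous_on_hdot [continuous_intros]:
  fixes f g :: "'a::topological_space \<Rightarrow> complex ^ 'n"
  assumes "continuous_on S f" "continuous_on S g"
  shows "continuous_on S (\<lambda>x. hdot (f x) (g x))"
  unfolding hdot_def
  by (intro continuous_intros assms)

lemma entire_ker: "entire (ker z)"
  using entire_exp_hdot[of 1 z] by (simp add: ker_def[abs_def])

lemma fockD: "f \<in> fock \<Longrightarrow> entire f" "f \<in> fock \<Longrightarrow> f \<in> L2_gauss"
  by (auto simp: fock_def)

lemma fock_borel_measurable: "f \<in> fock \<Longrightarrow> f \<in> borel_measurable borel"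
  by (intro entire_borel_measurable fockD)

lemma fock_add: "f \<in> fock \<Longrightarrow> g \<in> fock \<Longrightarrow> (\<lambda>z. f z + g z) \<in> fock"
  by (simp add: fock_def entire_add L2_gauss_add)

lemma fock_cmult: "f \<in> fock \<Longrightarrow> (\<lambda>z. c * f z) \<in> fock"
  by (simp add: fock_def entire_cmult L2_gauss_cmult)

section \<open>Kernel functions and the reproducing formula\<close>

lemma cmod_ker: "cmod (ker z w) = exp (z \<bullet> w)"
  by (simp add: ker_def Re_hdot inner_commute)

text \<open>Completing the square. It turns the squared norm of K_z into the total mass of a
  Gaussian translated to \<open>z\<close>.\<close>

lemma gw_mult_cmod_ker_square: "gw w * (cmod (ker z w))\<^sup>2 = exp ((norm z)\<^sup>2) * gw (- z + w)"
proof -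
  have "(norm (- z + w))\<^sup>2 = (norm z)\<^sup>2 - 2 * (z \<bullet> w) + (norm w)\<^sup>2"
    by (simp add: power2_norm_eq_inner algebra_simps inner_commute)
  then show ?thesis
    by (simp add: cmod_ker gw_def power2_eq_square flip: exp_add)
qed

lemma nn_integral_gw: "(\<integral>\<^sup>+z. ennreal (gw (z :: complex ^ 'n)) \<partial>lborel) = 1"
proof -
  interpret prob_space "gauss_borel :: (complex ^ 'n) measure" by (rule prob_space_gauss_borel)
  have "(\<integral>\<^sup>+z. ennreal (gw (z :: complex ^ 'n)) \<partial>lborel) = (\<integral>\<^sup>+(z :: complex ^ 'n). 1 \<partial>gauss_borel)"
    by (subst nn_integral_gauss_borel) auto
  then show ?thesis using emeasure_space_1 by simp
qed

lemma nn_integral_ker: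
  "(\<integral>\<^sup>+w. ennreal ((cmod (ker z w))\<^sup>2) \<partial>gauss 1) = ennreal (exp ((norm z)\<^sup>2))"
proof -
  have [measurable]: "ker z \<in> borel_measurable borel" by (intro entire_borel_measurable entire_ker)
  have "(\<integral>\<^sup>+w. ennreal ((cmod (ker z w))\<^sup>2) \<partial>gauss 1)
      = (\<integral>\<^sup>+w. ennreal (exp ((norm z)\<^sup>2)) * ennreal (gw (- z + w)) \<partial>lborel)"
    by (subst nn_integral_gauss) (auto simp: measurable_completion gw_mult_cmod_ker_square simp flip: ennreal_mult)
  also have "\<dots> = ennreal (exp ((norm z)\<^sup>2))"
    by (subst nn_integral_cmult, simp, subst nn_integral_lborel_shift) (auto simp: nn_integral_gw)
  finally show ?thesis .
qed

lemma ker_in_fock: "ker z \<in> fock"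
  and norm_gauss_ker: "norm_gauss (ker z) = exp ((norm z)\<^sup>2 / 2)"
proof -
  have [measurable]: "ker z \<in> borel_measurable borel" by (intro entire_borel_measurable entire_ker)
  have "ker z \<in> L2_gauss"
    by (rule L2_gauss_nnI(1)[where B="exp ((norm z)\<^sup>2 / 2)"])
       (auto simp: measurable_completion nn_integral_ker simp flip: exp_double)
  then show K: "ker z \<in> fock" by (simp add: fock_def entire_ker)
  have "ennreal ((norm_gauss (ker z))\<^sup>2) = ennreal (exp ((norm z)\<^sup>2))"
    using nn_integral_norm_gauss[OF fockD(2)[OF K]] nn_integral_ker[of z] by simp
  then have "(norm_gauss (ker z))\<^sup>2 = (exp ((norm z)\<^sup>2 / 2))\<^sup>2"
    by (simp flip: exp_double)
  then show "norm_gauss (ker z) = exp ((norm z)\<^sup>2 / 2)"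
    by (rule power2_eq_imp_eq) (auto simp: norm_gauss_nonneg)
qed

text \<open>The substitution w = z + v for a measure that is not translation invariant: the change
  of the weight is absorbed into \<open>G\<close> through \<open>eq\<close>.\<close>

lemma integral_gauss_shift:
  fixes F :: "complex ^ 'n \<Rightarrow> complex"
  assumes F[measurable]: "F \<in> borel_measurable borel" and G[measurable]: "G \<in> borel_measurable borel"
    and eq: "\<And>v. gw (z + v) *\<^sub>R F (z + v) = gw v *\<^sub>R G v"
  shows "integrable (gauss 1) F \<longleftrightarrow> integrable (gauss 1) G"
    and "(LINT w|gauss 1. F w) = (LINT w|gauss 1. G w)"
proof -
  have d: "integrable gauss_borel H \<longleftrightarrow> integrable lborel (\<lambda>w. gw w *\<^sub>R H w)"
     "(LINT w|gauss_borel. H w) = (LINT w|lborel. gw w *\<^sub>R H w)" if "H \<in> borel_measurable borel"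
     for H :: "complex ^ 'n \<Rightarrow> complex"
    unfolding gauss_borel_def using that by (simp_all add: integrable_density integral_density)
  have "integrable lborel (\<lambda>w. gw w *\<^sub>R F w) \<longleftrightarrow> integrable (distr lborel borel ((+) z)) (\<lambda>w. gw w *\<^sub>R F w)"
    by (simp add: lborel_distr_plus)
  also have "\<dots> \<longleftrightarrow> integrable lborel (\<lambda>w. gw w *\<^sub>R G w)"
    by (subst integrable_distr_eq) (auto simp: eq)
  finally show "integrable (gauss 1) F \<longleftrightarrow> integrable (gauss 1) G"
    by (simp add: d flip: integrable_gauss_borel_iff)
  have "(LINT w|lborel. gw w *\<^sub>R F w) = (LINT w|distr lborel borel ((+) z). gw w *\<^sub>R F w)"
    by (simp add: lborel_distr_plus)
  also have "\<dots> = (LINT w|lborel. gw w *\<^sub>R G w)"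
    by (subst integral_distr) (auto simp: eq)
  finally show "(LINT w|gauss 1. F w) = (LINT w|gauss 1. G w)"
    by (simp add: d flip: integral_gauss_borel)
qed

text \<open>Moving the centre of the Gaussian to \<open>z\<close> turns the inner product into the
  mean of an entire function \<open>G\<close> with \<open>G 0 = h z\<close>.\<close>

lemma fock_reproducing:
  fixes h :: "complex ^ 'n \<Rightarrow> complex"
  assumes h: "h \<in> fock"
  shows "inner_gauss h (ker z) = h z"
proof -
  have [measurable]: "h \<in> borel_measurable borel" by (rule fock_borel_measurable[OF h])
  have [measurable]: "ker z \<in> borel_measurable borel" by (intro entire_borel_measurable entire_ker)
  define G where "G v = h (z + v) * exp (- 1 * hdot v z)" for v
  have G: "entire G"
    unfolding G_def by (intro entire_mult entire_shift fockD(1)[OF h] entire_exp_hdot)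
  note [measurable] = entire_borel_measurable[OF G]
  \<comment> \<open>Since 2 (z \<bullet> v) is the sum of \<open>hdot v z\<close> and
    \<open>hdot z v\<close>, the factor conj K_z cancels the part of the shifted weight that is
    antiholomorphic in \<open>v\<close>; only the centred Gaussian and the holomorphic factor exp (-
    \<open>hdot v z\<close>) survive.\<close>
  have eq: "gw (z + v) *\<^sub>R (h (z + v) * cnj (ker z (z + v))) = gw v *\<^sub>R G v" for v
  proof -
    have n: "(norm (z + v))\<^sup>2 = (norm z)\<^sup>2 + 2 * (z \<bullet> v) + (norm v)\<^sup>2"
      by (simp add: power2_norm_eq_inner algebra_simps inner_commute)
    have c: "hdot v z + hdot z v = of_real (2 * (z \<bullet> v))"
      using Re_hdot[of z v] cnj_hdot[of z v] by (metis add.commute complex_add_cnj)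
    have "complex_of_real (exp (- (norm (z + v))\<^sup>2)) * exp (hdot z (z + v))
        = exp (- of_real ((norm z)\<^sup>2 + 2 * (z \<bullet> v) + (norm v)\<^sup>2) + (hdot z z + hdot z v))"
      unfolding n by (simp add: exp_of_real[symmetric] hdot_add_right exp_add)
    also have "\<dots> = exp (- of_real ((norm v)\<^sup>2) - hdot v z)"
      using c by (intro arg_cong[where f=exp]) (simp add: hdot_self algebra_simps)
    also have "\<dots> = of_real (exp (- (norm v)\<^sup>2)) * exp (- hdot v z)"
      by (simp add: exp_of_real[symmetric] exp_diff exp_minus field_simps)
    finally show ?thesis
      by (simp add: G_def gw_def ker_def exp_cnj cnj_hdot scaleR_conv_of_real field_simps)
  qed
  have int: "integrable (gauss 1) (\<lambda>w. h w * cnj (ker z w))"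
    by (intro integrable_inner_gauss fockD(2) h ker_in_fock)
  have m: "(\<lambda>w. h w * cnj (ker z w)) \<in> borel_measurable borel" by measurable
  have "inner_gauss h (ker z) = (LINT w|gauss 1. G w)"
    unfolding inner_gauss_def by (rule integral_gauss_shift(2)[OF m _ eq]) measurable
  also have "\<dots> = G 0"
    by (rule entire_mean_value[OF G])
       (subst integral_gauss_shift(1)[OF m _ eq, symmetric], measurable, rule int)
  finally show ?thesis by (simp add: G_def hdot_def)
qed

lemma fock_pointwise_bound:
  assumes h: "h \<in> fock"
  shows "cmod (h z) \<le> exp ((norm z)\<^sup>2 / 2) * norm_gauss h"
  using inner_gauss_le[OF fockD(2)[OF h] fockD(2)[OF ker_in_fock[of z]]]
  by (simp add: fock_reproducing[OF h] norm_gauss_ker mult.commute)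

section \<open>Completeness and Riesz representation\<close>

lemma norm_smult: "norm (c *s v) = cmod c * norm (v :: complex ^ 'n)"
  by (simp add: norm_vec_def norm_mult L2_set_right_distrib)

lemma norm_eq_scaled_unit:
  fixes v :: "complex ^ 'n" assumes "v \<noteq> 0"
  shows "\<exists>u. v = of_real (norm v) *s u \<and> norm u = 1"
proof (intro exI conjI)
  show "v = of_real (norm v) *s (of_real (1 / norm v) *s v)"
    using assms by (simp add: vec_eq_iff)
  show "norm (of_real (1 / norm v) *s v) = 1" using assms by (simp add: norm_smult norm_divide)
qed

text \<open>Cauchy's inequality on the unit disc of the complex line through \<open>z\<close> in the
  direction of \<open>v\<close>; complex linearity of \<open>D\<close> restores the length of
  \<open>v\<close>.\<close>

lemma entire_derivative_bound:
  fixes h :: "complex ^ 'n \<Rightarrow> complex"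
  assumes h: "entire h" and D: "(h has_derivative D) (at z)" "\<And>c v. D (c *s v) = c * D v"
    and B: "\<And>w. norm (w - z) \<le> 1 \<Longrightarrow> cmod (h w) \<le> B"
  shows "cmod (D v) \<le> B * norm v"
proof (cases "v = 0")
  case True
  then show ?thesis using D(2)[of 0 0] by simp
next
  case False
  then obtain u where u: "v = of_real (norm v) *s u" "norm u = 1"
    using norm_eq_scaled_unit by blast
  define p where "p l = h (z + l *s u)" for l
  have hol: "p holomorphic_on UNIV" unfolding p_def by (rule entire_line[OF h])
  have lin: "bounded_linear (\<lambda>l::complex. l *s u)"
    by (intro linear_conv_bounded_linear[THEN iffD1] linearI) (auto simp: vec_eq_iff algebra_simps)
  have "((\<lambda>l. z + l *s u) has_derivative (\<lambda>l. l *s u)) (at 0)"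
    using bounded_linear.has_derivative[OF lin has_derivative_ident]
    by (auto intro!: derivative_eq_intros)
  then have "(p has_derivative (\<lambda>l. D (l *s u))) (at 0)"
    unfolding p_def by (rule has_derivative_compose) (simp add: D(1))
  then have "(p has_field_derivative D u) (at 0)"
    unfolding has_field_derivative_def by (simp add: D(2) mult.commute[of _ "D u"])
  then have dp: "deriv p 0 = D u" by (rule DERIV_imp_deriv)
  have "cmod ((deriv ^^ 1) p 0) \<le> fact 1 * B / 1 ^ 1"
  proof (rule Cauchy_inequality)
    show "p holomorphic_on ball 0 1" "continuous_on (cball 0 1) p"
      using hol by (auto intro: holomorphic_on_subset holomorphic_on_imp_continuous_on)
    show "norm (p x) \<le> B" if "norm (0 - x) = 1" for x
      unfolding p_def using that u by (intro B) (simp add: norm_smult)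
  qed simp
  then have "cmod (D u) \<le> B" by (simp add: dp)
  moreover have "cmod (D v) = norm v * cmod (D u)"
    by (subst u(1)) (simp add: D(2) norm_mult)
  ultimately show ?thesis by (simp add: mult.commute[of B] mult_left_mono)
qed

text \<open>Closeness in norm is locally uniform closeness by \<open>fock_pointwise_bound\<close>,
  and by Cauchy's inequality also closeness of derivatives. So the derivatives converge locally
  uniformly, the limit is differentiable, and complex linearity of the derivative passes to the
  limit.\<close>

lemma fock_Cauchy_limit_entire:
  fixes f :: "nat \<Rightarrow> complex ^ 'n \<Rightarrow> complex"
  assumes f: "\<And>n. f n \<in> fock"
    and cau: "\<And>e. e > 0 \<Longrightarrow> \<exists>N. \<forall>m\<ge>N. \<forall>n\<ge>N. norm_gauss (\<lambda>z. f m z - f n z) < e"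
    and g: "\<And>z. (\<lambda>n. f n z) \<longlonglongrightarrow> g z"
  shows "entire g"
proof -
  have "\<exists>D. (f n has_derivative D) (at z) \<and> (\<forall>c v. D (c *s v) = c * D v)" for n z
    using fockD(1)[OF f[of n]] unfolding entire_def by blast
  then obtain D where D: "\<And>n z. (f n has_derivative D n z) (at z)"
      "\<And>n z c v. D n z (c *s v) = c * D n z v"
    by metis
  \<comment> \<open>The radius is \<open>R + 1\<close> because the derivative at \<open>z\<close> is
    controlled by values on the unit ball around \<open>z\<close>.\<close>
  have bnd: "cmod (D m z v - D n z v) \<le> exp ((R + 1)\<^sup>2 / 2) * e * norm v"
    if "norm z \<le> R" "norm_gauss (\<lambda>z. f m z - f n z) < e" for m n z v R e
  proof (rule entire_derivative_bound[where h="\<lambda>z. f m z - f n z" and D="\<lambda>v. D m z v - D n z v" and z=z])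
    show "entire (\<lambda>z. f m z - f n z)" by (intro entire_diff fockD f)
    show "((\<lambda>z. f m z - f n z) has_derivative (\<lambda>v. D m z v - D n z v)) (at z)"
      by (intro has_derivative_diff D)
    show "D m z (c *s v) - D n z (c *s v) = c * (D m z v - D n z v)" for c v
      by (simp add: D algebra_simps)
    fix w assume "norm (w - z) \<le> 1"
    then have "norm w \<le> R + 1" using norm_triangle_sub[of w z] that(1) by simp
    then have "exp ((norm w)\<^sup>2 / 2) \<le> exp ((R + 1)\<^sup>2 / 2)" by (simp add: power_mono)
    moreover have "cmod (f m w - f n w) \<le> exp ((norm w)\<^sup>2 / 2) * norm_gauss (\<lambda>z. f m z - f n z)"
      by (rule fock_pointwise_bound[OF fock_diff[OF f f]])
    moreover have "exp ((norm w)\<^sup>2 / 2) * norm_gauss (\<lambda>z. f m z - f n z) \<le> exp ((R + 1)\<^sup>2 / 2) * e"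
      using that(2) calculation(1) by (intro mult_mono) (auto simp: norm_gauss_nonneg)
    ultimately show "cmod (f m w - f n w) \<le> exp ((R + 1)\<^sup>2 / 2) * e" by linarith
  qed
  have "\<exists>l. (\<lambda>n. D n z v) \<longlonglongrightarrow> l" for z v
  proof -
    have "Cauchy (\<lambda>n. D n z v)"
    proof (rule metric_CauchyI)
      fix e :: real assume e: "e > 0"
      \<comment> \<open>The summand 1 next to \<open>norm v\<close> makes the final estimate strict
        for \<open>v = 0\<close> as well.\<close>
      define c where "c = exp ((norm z + 1)\<^sup>2 / 2) * (norm v + 1)"
      have c: "c > 0" unfolding c_def by (intro mult_pos_pos) (auto simp: add_nonneg_pos)
      obtain N where N: "\<forall>m\<ge>N. \<forall>n\<ge>N. norm_gauss (\<lambda>z. f m z - f n z) < e / c"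
        using cau[of "e / c"] e c by auto
      show "\<exists>M. \<forall>m\<ge>M. \<forall>n\<ge>M. dist (D m z v) (D n z v) < e"
      proof (intro exI allI impI)
        fix m n assume "m \<ge> N" "n \<ge> N"
        then have "cmod (D m z v - D n z v) \<le> exp ((norm z + 1)\<^sup>2 / 2) * (e / c) * norm v"
          using N by (intro bnd) auto
        also have "\<dots> < exp ((norm z + 1)\<^sup>2 / 2) * (e / c) * (norm v + 1)"
          using e c by (intro mult_strict_left_mono) auto
        also have "\<dots> = e"
        proof -
          have "norm v + 1 \<noteq> 0" using norm_ge_zero[of v] by linarith
          then show ?thesis by (simp add: c_def)
        qed
        finally show "dist (D m z v) (D n z v) < e" by (simp add: dist_norm)
      qed
    qed
    then show ?thesis by (simp add: Cauchy_convergent_iff convergent_def)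
  qed
  then obtain E where E: "\<And>z v. (\<lambda>n. D n z v) \<longlonglongrightarrow> E z v" by metis
  show ?thesis
    unfolding entire_def
  proof
    fix z :: "complex ^ 'n"
    define R where "R = norm z + 1"
    have "\<exists>G. \<forall>x\<in>ball 0 R. (\<lambda>n. f n x) \<longlonglongrightarrow> G x \<and> (G has_derivative E x) (at x within ball 0 R)"
    proof (rule has_derivative_sequence)
      show "convex (ball (0::complex ^ 'n) R)" by simp
      show "(f n has_derivative D n x) (at x within ball 0 R)" for n x
        by (rule has_derivative_at_withinI[OF D(1)])
      show "0 \<in> ball (0::complex ^ 'n) R" by (simp add: R_def add_nonneg_pos)
      show "(\<lambda>n. f n 0) \<longlonglongrightarrow> g 0" by (rule g)
      fix e :: real assume e: "e > 0"
      define c where "c = exp ((R + 1)\<^sup>2 / 2)"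
      have c: "c > 0" by (simp add: c_def)
      obtain N where N: "\<forall>m\<ge>N. \<forall>n\<ge>N. norm_gauss (\<lambda>z. f m z - f n z) < e / c"
        using cau[of "e / c"] e c by auto
      show "\<forall>\<^sub>F n in sequentially. \<forall>x\<in>ball 0 R. \<forall>h. norm (D n x h - E x h) \<le> e * norm h"
      proof (rule eventually_sequentiallyI[of N], intro ballI allI)
        fix n x and h :: "complex ^ 'n" assume n: "n \<ge> N" and x: "x \<in> ball (0::complex ^ 'n) R"
        have "(\<lambda>m. norm (D n x h - D m x h)) \<longlonglongrightarrow> norm (D n x h - E x h)"
          by (intro tendsto_intros E)
        moreover have "norm (D n x h - D m x h) \<le> e * norm h" if "m \<ge> N" for m
        proof -
          have "norm (D n x h - D m x h) \<le> exp ((R + 1)\<^sup>2 / 2) * (e / c) * norm h"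
            using N n that x by (intro bnd) auto
          then show ?thesis by (simp add: c_def)
        qed
        then have "\<forall>\<^sub>F m in sequentially. norm (D n x h - D m x h) \<le> e * norm h"
          by (rule eventually_sequentiallyI)
        ultimately show "norm (D n x h - E x h) \<le> e * norm h"
          by (rule tendsto_upperbound) simp
      qed
    qed
    then obtain G where G: "\<And>x. x \<in> ball 0 R \<Longrightarrow> (\<lambda>n. f n x) \<longlonglongrightarrow> G x"
      "\<And>x. x \<in> ball 0 R \<Longrightarrow> (G has_derivative E x) (at x within ball 0 R)" by blast
    have z: "z \<in> ball 0 R" by (simp add: R_def)
    have "(G has_derivative E z) (at z)"
      using G(2)[OF z] z by (simp add: at_within_open[OF z])
    then have "(g has_derivative E z) (at z)"
      by (rule has_derivative_transform_within_open[OF _ open_ball z]) (use G(1) g LIMSEQ_unique in blast)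
    moreover have "E z (c *s v) = c * E z v" for c v
    proof (rule LIMSEQ_unique[OF E])
      show "(\<lambda>n. D n z (c *s v)) \<longlonglongrightarrow> c * E z v"
        unfolding D(2) by (intro tendsto_intros E)
    qed
    ultimately show "\<exists>D. (g has_derivative D) (at z) \<and> (\<forall>c v. D (c *s v) = c * D v)" by blast
  qed
qed

text \<open>Point evaluations are continuous, so a Cauchy sequence has a genuine pointwise limit,
  and Fatou's lemma upgrades pointwise convergence to convergence in norm. No almost everywhere
  representatives occur.\<close>

lemma fock_complete:
  fixes f :: "nat \<Rightarrow> complex ^ 'n \<Rightarrow> complex"
  assumes f: "\<And>n. f n \<in> fock"
    and cau: "\<And>e. e > 0 \<Longrightarrow> \<exists>N. \<forall>m\<ge>N. \<forall>n\<ge>N. norm_gauss (\<lambda>z. f m z - f n z) < e"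
  obtains g where "g \<in> fock" "(\<lambda>n. norm_gauss (\<lambda>z. f n z - g z)) \<longlonglongrightarrow> 0"
proof -
  have "\<exists>l. (\<lambda>n. f n z) \<longlonglongrightarrow> l" for z
  proof -
    have "Cauchy (\<lambda>n. f n z)"
    proof (rule metric_CauchyI)
      fix e :: real assume e: "e > 0"
      define c where "c = exp ((norm z)\<^sup>2 / 2)"
      have c: "c > 0" by (simp add: c_def)
      obtain N where N: "\<forall>m\<ge>N. \<forall>n\<ge>N. norm_gauss (\<lambda>z. f m z - f n z) < e / c"
        using cau[of "e / c"] e c by auto
      have "dist (f m z) (f n z) < e" if "m \<ge> N" "n \<ge> N" for m n
      proof -
        have "cmod (f m z - f n z) \<le> c * norm_gauss (\<lambda>z. f m z - f n z)"
          unfolding c_def by (rule fock_pointwise_bound[OF fock_diff[OF f f]])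
        also have "\<dots> < c * (e / c)" using N that c by (intro mult_strict_left_mono) auto
        finally show ?thesis using c by (simp add: dist_norm)
      qed
      then show "\<exists>M. \<forall>m\<ge>M. \<forall>n\<ge>M. dist (f m z) (f n z) < e" by blast
    qed
    then show ?thesis by (simp add: Cauchy_convergent_iff convergent_def)
  qed
  then obtain g where g: "\<And>z. (\<lambda>n. f n z) \<longlonglongrightarrow> g z" by metis
  have eg: "entire g" by (rule fock_Cauchy_limit_entire[OF f cau g])
  have fm[measurable]: "f n \<in> borel_measurable lebesgue" for n
    by (intro L2_gaussD fockD f)
  have gm[measurable]: "g \<in> borel_measurable lebesgue"
    by (intro measurable_completion) (simp add: entire_borel_measurable[OF eg])
  \<comment> \<open>Fatou's lemma in \<open>m\<close> for fixed \<open>n\<close>: the Cauchy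
    estimate for \<open>f n - f m\<close> survives when \<open>f m\<close> is replaced by its
    pointwise limit \<open>g\<close>.\<close>
  have close: "(\<lambda>z. f n z - g z) \<in> L2_gauss \<and> norm_gauss (\<lambda>z. f n z - g z) \<le> e"
    if e: "e > 0" and N: "\<And>m. m \<ge> N \<Longrightarrow> norm_gauss (\<lambda>z. f n z - f m z) < e" for n N e
  proof -
    have lim: "(\<lambda>m. ennreal ((cmod (f n z - f m z))\<^sup>2)) \<longlonglongrightarrow> ennreal ((cmod (f n z - g z))\<^sup>2)" for z
      by (intro tendsto_intros g)
    have "(\<integral>\<^sup>+z. ennreal ((cmod (f n z - g z))\<^sup>2) \<partial>gauss 1)
        = (\<integral>\<^sup>+z. liminf (\<lambda>m. ennreal ((cmod (f n z - f m z))\<^sup>2)) \<partial>gauss 1)"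
      using lim_imp_Liminf[OF _ lim] by simp
    also have "\<dots> \<le> liminf (\<lambda>m. (\<integral>\<^sup>+z. ennreal ((cmod (f n z - f m z))\<^sup>2) \<partial>gauss 1))"
      by (rule nn_integral_liminf) measurable
    also have "\<dots> \<le> ennreal (e\<^sup>2)"
    proof (rule Liminf_le)
      have "(\<integral>\<^sup>+z. ennreal ((cmod (f n z - f m z))\<^sup>2) \<partial>gauss 1) \<le> ennreal (e\<^sup>2)" if "m \<ge> N" for m
        using N[OF that] e
        by (subst nn_integral_norm_gauss[OF fockD(2)[OF fock_diff[OF f f]]])
           (auto intro!: ennreal_leI power_mono simp: norm_gauss_nonneg)
      then show "\<forall>\<^sub>F m in sequentially. (\<integral>\<^sup>+z. ennreal ((cmod (f n z - f m z))\<^sup>2) \<partial>gauss 1) \<le> ennreal (e\<^sup>2)"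
        by (rule eventually_sequentiallyI)
    qed simp
    finally show ?thesis using e by (auto intro: L2_gauss_nnI)
  qed
  have gL: "g \<in> fock"
  proof -
    obtain N where N: "\<forall>m\<ge>N. \<forall>n\<ge>N. norm_gauss (\<lambda>z. f m z - f n z) < 1"
      using cau[of 1] by auto
    then have "(\<lambda>z. f N z - g z) \<in> L2_gauss" using close[of 1 N N] by auto
    then have "(\<lambda>z. f N z - (f N z - g z)) \<in> L2_gauss"
      by (rule L2_gauss_diff[OF fockD(2)[OF f]])
    then show ?thesis using eg by (simp add: fock_def)
  qed
  have "(\<lambda>n. norm_gauss (\<lambda>z. f n z - g z)) \<longlonglongrightarrow> 0"
  proof (rule LIMSEQ_I)
    fix r :: real assume r: "r > 0"
    obtain N where N: "\<forall>m\<ge>N. \<forall>n\<ge>N. norm_gauss (\<lambda>z. f m z - f n z) < r / 2"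
      using cau[of "r / 2"] r by auto
    have "norm_gauss (\<lambda>z. f n z - g z) \<le> r / 2" if "n \<ge> N" for n
      using close[of "r / 2" N n] N r that by auto
    then have "norm (norm_gauss (\<lambda>z. f n z - g z) - 0) < r" if "n \<ge> N" for n
      using that r norm_gauss_nonneg[of "\<lambda>z. f n z - g z"] by fastforce
    then show "\<exists>no. \<forall>n\<ge>no. norm (norm_gauss (\<lambda>z. f n z - g z) - 0) < r" by blast
  qed
  with gL show ?thesis by (rule that)
qed

text \<open>The representing vector minimises \<open>norm h ^ 2 - 2 Re (L h)\<close>; by the parallelogram law
  minimising sequences are Cauchy.\<close>

lemma fock_riesz:
  fixes L :: "(complex ^ 'n \<Rightarrow> complex) \<Rightarrow> complex"
  assumes add: "\<And>g h. g \<in> fock \<Longrightarrow> h \<in> fock \<Longrightarrow> L (\<lambda>z. g z + h z) = L g + L h"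
    and cmult: "\<And>c h. h \<in> fock \<Longrightarrow> L (\<lambda>z. c * h z) = c * L h"
    and bound: "\<And>h. h \<in> fock \<Longrightarrow> cmod (L h) \<le> C * norm_gauss h"
  obtains g where "g \<in> fock" "\<And>h. h \<in> fock \<Longrightarrow> L h = inner_gauss h g"
proof -
  define J where "J h = (norm_gauss h)\<^sup>2 - 2 * Re (L h)" for h
  define F :: "(complex ^ 'n \<Rightarrow> complex) set" where "F = fock"
  have F: "h \<in> L2_gauss" if "h \<in> F" for h using that by (simp add: F_def fock_def)
  have J_add: "J (\<lambda>z. g z + h z) = J g + 2 * Re (inner_gauss g h) - 2 * Re (L h) + (norm_gauss h)\<^sup>2"
    if "g \<in> F" "h \<in> F" for g h
    using that norm_gauss_add_square[OF F F] by (simp add: J_def add F_def)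
  have lower: "J h \<ge> - C\<^sup>2" if "h \<in> F" for h
  proof -
    have "Re (L h) \<le> C * norm_gauss h"
      using bound[of h] that complex_Re_le_cmod[of "L h"] by (simp add: F_def)
    moreover have "0 \<le> (norm_gauss h - C)\<^sup>2" by simp
    ultimately show ?thesis unfolding J_def power2_diff by (simp add: algebra_simps)
  qed
  define I where "I = (INF h\<in>F. J h)"
  have Fne: "F \<noteq> {}" using ker_in_fock by (auto simp: F_def)
  have bdd: "bdd_below (J ` F)" by (rule bdd_belowI2) (rule lower)
  have I: "I \<le> J h" if "h \<in> F" for h
    unfolding I_def by (rule cINF_lower[OF bdd that])
  have "\<exists>h\<in>F. J h < I + 1 / Suc n" for n
    unfolding I_def using cINF_less_iff[OF Fne bdd, of "(INF h\<in>F. J h) + 1 / Suc n"] by simp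
  then obtain f where f: "\<And>n. f n \<in> F" "\<And>n. J (f n) < I + 1 / Suc n" by metis
  \<comment> \<open>With midpoint \<open>m\<close> and half difference \<open>d\<close> one has g =
    m + d and h = m - d, so the cross terms cancel in \<open>J g + J h\<close>, and
    \<open>J m\<close> is at least \<open>I\<close>.\<close>
  have par: "(norm_gauss (\<lambda>z. g z - h z))\<^sup>2 \<le> 2 * (J g - I) + 2 * (J h - I)" if gh: "g \<in> F" "h \<in> F" for g h
  proof -
    define m where "m = (\<lambda>z. (1/2) * (g z + h z))"
    define d where "d = (\<lambda>z. (1/2) * (g z - h z))"
    have md: "m \<in> F" "d \<in> F"
      using gh by (auto simp: F_def m_def d_def simp del: times_divide_eq_left mult_1 intro!: fock_cmult fock_add fock_diff)
    have d': "(\<lambda>z. - 1 * d z) \<in> F" unfolding F_def by (rule fock_cmult) (use md in \<open>simp add: F_def\<close>)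
    have "g = (\<lambda>z. m z + d z)" by (auto simp: m_def d_def field_simps)
    then have 1: "J g = J m + 2 * Re (inner_gauss m d) - 2 * Re (L d) + (norm_gauss d)\<^sup>2"
      using J_add[OF md] by simp
    have "h = (\<lambda>z. m z + (- 1 * d z))" by (auto simp: m_def d_def field_simps)
    moreover have "inner_gauss m (\<lambda>z. - 1 * d z) = - inner_gauss m d"
      by (subst inner_gauss_cmult_right) simp
    moreover have "L (\<lambda>z. - 1 * d z) = - L d"
      using cmult[of d "-1"] md by (simp add: F_def)
    moreover have "norm_gauss (\<lambda>z. - 1 * d z) = norm_gauss d"
      by (subst norm_gauss_cmult) simp
    ultimately have 2: "J h = J m - 2 * Re (inner_gauss m d) + 2 * Re (L d) + (norm_gauss d)\<^sup>2"
      using J_add[OF md(1) d'] by simp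
    have "norm_gauss (\<lambda>z. g z - h z) = norm_gauss (\<lambda>z. 2 * d z)"
      by (intro arg_cong[where f=norm_gauss] ext) (simp add: d_def field_simps)
    then have "(norm_gauss (\<lambda>z. g z - h z))\<^sup>2 = 4 * (norm_gauss d)\<^sup>2"
      by (simp add: norm_gauss_cmult power_mult_distrib)
    with 1 2 I[OF md(1)] show ?thesis by simp
  qed
  have cau: "\<exists>N. \<forall>m\<ge>N. \<forall>n\<ge>N. norm_gauss (\<lambda>z. f m z - f n z) < e" if e: "e > 0" for e
  proof -
    obtain N where N: "1 / Suc N < e\<^sup>2 / 4"
      using reals_Archimedean[of "e\<^sup>2 / 4"] e by (auto simp: inverse_eq_divide)
    have "norm_gauss (\<lambda>z. f m z - f n z) < e" if "m \<ge> N" "n \<ge> N" for m n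
    proof -
      have "1 / Suc k \<le> 1 / Suc N" if "k \<ge> N" for k using that by (simp add: frac_le)
      then have "J (f m) - I < e\<^sup>2 / 4" "J (f n) - I < e\<^sup>2 / 4"
        using f(2)[of m] f(2)[of n] that N by (smt (verit))+
      then have "(norm_gauss (\<lambda>z. f m z - f n z))\<^sup>2 < e\<^sup>2"
        using par[OF f(1) f(1), of m n] by (simp add: field_simps)
      then show ?thesis using e by (simp add: power2_less_imp_less)
    qed
    then show ?thesis by blast
  qed
  obtain g where g: "g \<in> F" "(\<lambda>n. norm_gauss (\<lambda>z. f n z - g z)) \<longlonglongrightarrow> 0"
    using fock_complete[of f] f(1) cau unfolding F_def by blast
  have Jg: "J g \<le> I"
  proof -
    define u where "u n = norm_gauss (\<lambda>z. f n z - g z)" for n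
    have u0: "u \<longlonglongrightarrow> 0" using g(2) unfolding u_def .
    have "J g \<le> I + 1 / Suc n + 2 * norm_gauss g * u n + 2 * C * u n" for n
    proof -
      define d where "d = (\<lambda>z. f n z - g z)"
      have d: "d \<in> F" using f(1)[of n] g(1) by (simp add: d_def F_def fock_diff)
      have "f n = (\<lambda>z. g z + d z)" by (simp add: d_def)
      then have "J (f n) = J g + 2 * Re (inner_gauss g d) - 2 * Re (L d) + (norm_gauss d)\<^sup>2"
        using J_add[OF g(1) d] by simp
      moreover have "\<bar>Re (inner_gauss g d)\<bar> \<le> norm_gauss g * u n"
        using abs_Re_le_cmod[of "inner_gauss g d"] inner_gauss_le[OF F[OF g(1)] F[OF d]]
        by (simp add: u_def d_def)
      moreover have "\<bar>Re (L d)\<bar> \<le> C * u n"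
        using abs_Re_le_cmod[of "L d"] bound[of d] d by (simp add: u_def d_def F_def)
      ultimately show ?thesis using f(2)[of n] zero_le_power2[of "norm_gauss d"] by linarith
    qed
    moreover have "(\<lambda>n. I + 1 / Suc n + 2 * norm_gauss g * u n + 2 * C * u n) \<longlonglongrightarrow> I + 0 + 2 * norm_gauss g * 0 + 2 * C * 0"
      using LIMSEQ_inverse_real_of_nat by (intro tendsto_intros u0) (simp add: inverse_eq_divide)
    ultimately show ?thesis by (intro LIMSEQ_le_const[where a="J g"]) auto
  qed
  have re: "Re (inner_gauss h g) = Re (L h)" if h: "h \<in> F" for h
  proof (rule ccontr)
    define a where "a = Re (inner_gauss g h) - Re (L h)"
    assume "Re (inner_gauss h g) \<noteq> Re (L h)"
    then have a: "a \<noteq> 0" by (simp add: a_def inner_gauss_commute[of g h])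
    have q: "0 \<le> 2 * t * a + t\<^sup>2 * (norm_gauss h)\<^sup>2" for t :: real
    proof -
      define v where "v = (\<lambda>z. of_real t * h z)"
      have v: "v \<in> F" using h by (simp add: v_def F_def fock_cmult)
      have "J g \<le> J (\<lambda>z. g z + v z)"
        using Jg I[of "\<lambda>z. g z + v z"] g(1) v by (simp add: F_def fock_add)
      also have "\<dots> = J g + 2 * t * a + t\<^sup>2 * (norm_gauss h)\<^sup>2"
        using J_add[OF g(1) v] cmult[of h "of_real t"] h
        by (simp add: v_def inner_gauss_cmult_right norm_gauss_cmult F_def a_def power_mult_distrib algebra_simps)
      finally show ?thesis by simp
    qed
    \<comment> \<open>At t = - a / s the quadratic equals (a / s)^2 times (norm h)^2 - 2 s, which is
      negative. The summand 1 keeps \<open>s\<close> positive even when \<open>h\<close> has norm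
      0.\<close>
    define s where "s = 1 + (norm_gauss h)\<^sup>2"
    have s: "s > 0" "(norm_gauss h)\<^sup>2 < 2 * s" by (auto simp: s_def add_pos_nonneg intro: order.strict_trans1[of _ "1 + (norm_gauss h)\<^sup>2"])
    have "0 \<le> 2 * (- a / s) * a + (- a / s)\<^sup>2 * (norm_gauss h)\<^sup>2" by (rule q)
    also have "\<dots> = (a / s)\<^sup>2 * ((norm_gauss h)\<^sup>2 - 2 * s)"
      using s by (simp add: power2_eq_square field_simps)
    also have "\<dots> < 0"
      using a s by (intro mult_pos_neg) auto
    finally show False by simp
  qed
  have "L h = inner_gauss h g" if h: "h \<in> F" for h
  proof -
    \<comment> \<open>Both sides are complex linear in \<open>h\<close>, so the identity of real
      parts applied to \<i> \<open>h\<close> yields the imaginary parts.\<close>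
    have "Re (\<i> * L h) = Re (\<i> * inner_gauss h g)"
      using re[of "\<lambda>z. \<i> * h z"] h cmult[of h \<i>]
      by (simp add: F_def fock_cmult inner_gauss_cmult_left del: times_complex.sel)
    then show ?thesis using re[OF h] by (simp add: complex_eq_iff)
  qed
  with g(1) show ?thesis by (intro that) (auto simp: F_def)
qed

section \<open>Operators with Gaussian off-diagonal decay\<close>

text \<open>For \<open>h\<close> in the Fock space this is |\<langle>h, k_z\<rangle>|, so
  \<open>nmod (A (nker z)) w\<close> is the modulus of the entry \<langle>A k_z, k_w\<rangle>. Its
  square, divided by pi^n, is the density whose Lebesgue integral is the squared norm of
  \<open>h\<close>.\<close>

definition nmod :: "(complex ^ 'n \<Rightarrow> complex) \<Rightarrow> complex ^ 'n \<Rightarrow> real" where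
  "nmod h z = cmod (h z) * exp (- (norm z)\<^sup>2 / 2)"

lemma nmod_nonneg [simp]: "0 \<le> nmod h z"
  by (simp add: nmod_def)

lemma nker_in_fock: "nker z \<in> fock"
  using fock_cmult[OF ker_in_fock] by (simp add: nker_def[abs_def])

lemma norm_gauss_nker: "norm_gauss (nker z) = 1"
  unfolding nker_def[abs_def] norm_gauss_cmult norm_gauss_ker by (simp flip: exp_add)

lemma inner_gauss_nker:
  assumes "h \<in> fock" shows "inner_gauss h (nker z) = of_real (exp (- (norm z)\<^sup>2 / 2)) * h z"
  unfolding nker_def[abs_def] inner_gauss_cmult_right fock_reproducing[OF assms] by simp

lemma cmod_inner_gauss_nker: "h \<in> fock \<Longrightarrow> cmod (inner_gauss h (nker z)) = nmod h z"
  by (simp add: inner_gauss_nker nmod_def norm_mult)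

lemma nmod_le: "h \<in> fock \<Longrightarrow> nmod h z \<le> norm_gauss h"
  using inner_gauss_le[OF fockD(2) fockD(2)[OF nker_in_fock], of h z]
  by (simp add: cmod_inner_gauss_nker norm_gauss_nker)

lemma norm_gauss_nmod:
  assumes "h \<in> fock"
  shows "(\<integral>\<^sup>+z. ennreal ((nmod h z)\<^sup>2 / pi ^ CARD('n)) \<partial>lborel) = ennreal ((norm_gauss (h :: complex ^ 'n \<Rightarrow> complex))\<^sup>2)"
proof -
  have [measurable]: "h \<in> borel_measurable borel" by (rule fock_borel_measurable[OF assms])
  have "(nmod h z)\<^sup>2 / pi ^ CARD('n) = gw z * (cmod (h z))\<^sup>2" for z
    by (simp add: nmod_def gw_def power_mult_distrib flip: exp_double)
  then show ?thesis
    using nn_integral_norm_gauss[OF fockD(2)[OF assms]]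
    by (simp add: nn_integral_gauss measurable_completion ennreal_mult)
qed

lemma cmod_nker: "cmod (nker z w) = exp (- (norm z)\<^sup>2 / 2 + z \<bullet> w)"
  by (simp add: nker_def norm_mult cmod_ker flip: exp_add)

lemma nmod_nker: "nmod (nker z) w = exp (- (norm (z - w))\<^sup>2 / 2)"
  by (simp add: nmod_def cmod_nker power2_norm_eq_inner inner_commute algebra_simps add_divide_distrib diff_divide_distrib flip: exp_add)

text \<open>By the parallelogram law, |u|^2 + |z|^2/2 + |w|^2/2 - (z + w) \<bullet> u equals |z -
  w|^2/4 + |u - (z + w)/2|^2.\<close>

lemma gw_cmod_nker:
  "gw u * (cmod (nker z u) * cmod (nker w u)) = exp (- (norm (z - w))\<^sup>2 / 4) * gw ((1/2) *\<^sub>R (z + w) - u)"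
  by (simp add: gw_def cmod_nker power2_norm_eq_inner inner_commute algebra_simps add_divide_distrib diff_divide_distrib flip: exp_add)

section \<open>Bounded operators and their integral kernels\<close>

lemma fock_bounded_opD:
  assumes "fock_bounded_op A"
  shows "h \<in> fock \<Longrightarrow> A h \<in> fock"
    and "g \<in> fock \<Longrightarrow> h \<in> fock \<Longrightarrow> A (\<lambda>z. g z + h z) = (\<lambda>z. A g z + A h z)"
    and "h \<in> fock \<Longrightarrow> A (\<lambda>z. c * h z) = (\<lambda>z. c * A h z)"
  using assms by (auto simp: fock_bounded_op_def)

lemma fock_bounded_op_bound:
  assumes "fock_bounded_op A"
  obtains C where "C > 0" "\<And>h. h \<in> fock \<Longrightarrow> norm_gauss (A h) \<le> C * norm_gauss h"
proof -
  obtain C where C: "\<And>h. h \<in> fock \<Longrightarrow> norm_gauss (A h) \<le> C * norm_gauss h"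
    using assms unfolding fock_bounded_op_def by blast
  have "norm_gauss (A h) \<le> max C 1 * norm_gauss h" if "h \<in> fock" for h
    using C[OF that] mult_right_mono[OF max.cobounded1[of C 1] norm_gauss_nonneg[of h]] by (rule order_trans)
  then show ?thesis by (intro that[of "max C 1"]) auto
qed

lemma fock_bounded_op_diff:
  assumes A: "fock_bounded_op A" and "g \<in> fock" "h \<in> fock"
  shows "A (\<lambda>z. g z - h z) = (\<lambda>z. A g z - A h z)"
  using fock_bounded_opD(2)[OF A assms(2) fock_cmult[OF assms(3)], of "-1"]
    fock_bounded_opD(3)[OF A assms(3), of "-1"] by simp

lemma bounded_op_nker:
  fixes A :: "(complex ^ 'n \<Rightarrow> complex) \<Rightarrow> (complex ^ 'n \<Rightarrow> complex)"
  assumes "fock_bounded_op A"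
  shows "A (nker z) w = of_real (exp (- (norm z)\<^sup>2 / 2)) * A (ker z) w"
  using fock_bounded_opD(3)[OF assms ker_in_fock, of "of_real (exp (- (norm z)\<^sup>2 / 2))" z]
  by (simp add: nker_def[abs_def])

text \<open>The vector \<open>g\<close> is A^* K_w, found as the representative of h \<mapsto> (A
  h)(w) without constructing the adjoint. It shows that (A K_u)(w) is antiholomorphic in
  \<open>u\<close>.\<close>

lemma bounded_op_riesz:
  fixes A :: "(complex ^ 'n \<Rightarrow> complex) \<Rightarrow> (complex ^ 'n \<Rightarrow> complex)"
  assumes A: "fock_bounded_op A"
  obtains g where "g \<in> fock" "\<And>u. A (ker u) w = cnj (g u)" "\<And>h. h \<in> fock \<Longrightarrow> A h w = inner_gauss h g"
proof -
  obtain C where C: "C > 0" "\<And>h. h \<in> fock \<Longrightarrow> norm_gauss (A h) \<le> C * norm_gauss h"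
    by (rule fock_bounded_op_bound[OF A]) blast
  obtain g where g: "g \<in> fock" "\<And>h. h \<in> fock \<Longrightarrow> A h w = inner_gauss h g"
  proof (rule fock_riesz[of "\<lambda>h. A h w" "exp ((norm w)\<^sup>2 / 2) * C"])
    show "cmod (A h w) \<le> exp ((norm w)\<^sup>2 / 2) * C * norm_gauss h" if "h \<in> fock" for h
      using order_trans[OF fock_pointwise_bound[OF fock_bounded_opD(1)[OF A that], of w]
          mult_left_mono[OF C(2)[OF that], of "exp ((norm w)\<^sup>2 / 2)"]]
      by (simp add: mult.assoc)
  qed (auto simp: fock_bounded_opD[OF A])
  have "A (ker u) w = cnj (g u)" for u
    using g(2)[OF ker_in_fock[of u]] inner_gauss_commute[of "ker u" g] fock_reproducing[OF g(1), of u]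
    by simp
  with g show ?thesis by (intro that)
qed

text \<open>Writing (A h)(w) = \<langle>h, A^* K_w\<rangle> as an integral over \<open>u\<close>
  exhibits \<open>A\<close> as an integral operator on the coefficients of \<open>h\<close>, with
  the entries \<langle>A k_u, k_w\<rangle> as kernel; then absolute values are taken inside.\<close>

lemma nmod_op_le:
  fixes A :: "(complex ^ 'n \<Rightarrow> complex) \<Rightarrow> (complex ^ 'n \<Rightarrow> complex)"
  assumes A: "fock_bounded_op A" and h: "h \<in> fock"
  shows "ennreal (nmod (A h) w) \<le> (\<integral>\<^sup>+u. ennreal (nmod h u * nmod (A (nker u)) w / pi ^ CARD('n)) \<partial>lborel)"
proof -
  obtain g where g: "g \<in> fock" "\<And>u. A (ker u) w = cnj (g u)" "\<And>h. h \<in> fock \<Longrightarrow> A h w = inner_gauss h g"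
    by (rule bounded_op_riesz[OF A, of w]) blast
  have [measurable]: "h \<in> borel_measurable borel" "g \<in> borel_measurable borel"
    by (intro fock_borel_measurable h g)+
  have [measurable]: "h \<in> borel_measurable lebesgue" "g \<in> borel_measurable lebesgue"
    by (intro L2_gaussD fockD h g)+
  have eq: "ennreal (gw u) * ennreal (cmod (h u * cnj (g u)) * exp (- (norm w)\<^sup>2 / 2))
      = ennreal (nmod h u * nmod (A (nker u)) w / pi ^ CARD('n))" for u
  proof -
    \<comment> \<open>The weight is split evenly: one half normalises \<open>h u\<close>, the other
      normalises the kernel vector K_u.\<close>
    have "gw u = exp (- (norm u)\<^sup>2 / 2) * exp (- (norm u)\<^sup>2 / 2) / pi ^ CARD('n)"
      by (simp add: gw_def flip: exp_add)
    then have "gw u * (cmod (h u * cnj (g u)) * exp (- (norm w)\<^sup>2 / 2))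
      = nmod h u * nmod (A (nker u)) w / pi ^ CARD('n)"
      unfolding nmod_def bounded_op_nker[OF A] g(2) by (simp add: norm_mult)
    then show ?thesis by (metis ennreal_mult' gw_nonneg)
  qed
  have "ennreal (nmod (A h) w) = ennreal (cmod (inner_gauss h g)) * ennreal (exp (- (norm w)\<^sup>2 / 2))"
    by (simp add: nmod_def g(3)[OF h] ennreal_mult)
  also have "\<dots> \<le> (\<integral>\<^sup>+u. ennreal (cmod (h u * cnj (g u))) \<partial>gauss 1) * ennreal (exp (- (norm w)\<^sup>2 / 2))"
    unfolding inner_gauss_def
    by (intro mult_right_mono integral_norm_bound_ennreal integrable_inner_gauss fockD(2) h g) auto
  also have "\<dots> = (\<integral>\<^sup>+u. ennreal (cmod (h u * cnj (g u)) * exp (- (norm w)\<^sup>2 / 2)) \<partial>gauss 1)"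
    by (subst nn_integral_multc[symmetric]) (auto simp: ennreal_mult measurable_completion)
  also have "\<dots> = (\<integral>\<^sup>+u. ennreal (nmod h u * nmod (A (nker u)) w / pi ^ CARD('n)) \<partial>lborel)"
    by (subst nn_integral_gauss) (simp_all only: eq, measurable)
  finally show ?thesis .
qed

section \<open>Stability of Gaussian decay under sums and products\<close>

text \<open>The rate \<open>c\<close> may depend on the operator, because compositions make it
  worse.\<close>

definition localized :: "((complex ^ 'n \<Rightarrow> complex) \<Rightarrow> (complex ^ 'n \<Rightarrow> complex)) \<Rightarrow> bool" where
  "localized A \<longleftrightarrow> (\<exists>C c. C \<ge> 0 \<and> c > 0 \<and> (\<forall>z w. nmod (A (nker z)) w \<le> C * exp (- c * (norm (z - w))\<^sup>2)))"

lemma localizedI: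
  "0 \<le> C \<Longrightarrow> 0 < c \<Longrightarrow> (\<And>z w. nmod (A (nker z)) w \<le> C * exp (- c * (norm (z - w))\<^sup>2)) \<Longrightarrow> localized A"
  unfolding localized_def by blast

lemma localizedE:
  assumes "localized A"
  obtains C c where "0 \<le> C" "0 < c" "\<And>z w. nmod (A (nker z)) w \<le> C * exp (- c * (norm (z - w))\<^sup>2)"
  using assms unfolding localized_def by blast

lemma localized_id: "localized id"
  by (rule localizedI[of 1 "1/2"]) (auto simp: nmod_nker)

lemma localized_zero: "localized (\<lambda>h z. 0)"
  by (rule localizedI[of 0 1]) (auto simp: nmod_def)

lemma exp_decay_mono:
  assumes "nmod h w \<le> C * exp (- c * (norm (z - w))\<^sup>2)" "0 \<le> C" "c' \<le> c"
  shows "nmod h w \<le> C * exp (- c' * (norm (z - w))\<^sup>2)"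
proof -
  have "C * exp (- c * (norm (z - w))\<^sup>2) \<le> C * exp (- c' * (norm (z - w))\<^sup>2)"
    using assms by (intro mult_left_mono) (auto simp: mult_right_mono)
  with assms(1) show ?thesis by linarith
qed

lemma localized_add:
  assumes "localized A" "localized B"
  shows "localized (\<lambda>h z. A h z + B h z)"
proof -
  obtain C c where C: "0 \<le> C" "0 < c" "\<And>z w. nmod (A (nker z)) w \<le> C * exp (- c * (norm (z - w))\<^sup>2)"
    using assms(1) by (rule localizedE) blast
  obtain D d where D: "0 \<le> D" "0 < d" "\<And>z w. nmod (B (nker z)) w \<le> D * exp (- d * (norm (z - w))\<^sup>2)"
    using assms(2) by (rule localizedE) blast
  show ?thesis
  proof (rule localizedI[of "C + D" "min c d"])
    fix z w
    have "nmod (\<lambda>u. A (nker z) u + B (nker z) u) w \<le> nmod (A (nker z)) w + nmod (B (nker z)) w"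
      unfolding nmod_def distrib_right[symmetric] by (intro mult_right_mono norm_triangle_ineq) auto
    also have "\<dots> \<le> C * exp (- min c d * (norm (z - w))\<^sup>2) + D * exp (- min c d * (norm (z - w))\<^sup>2)"
      by (intro add_mono exp_decay_mono[OF C(3) C(1)] exp_decay_mono[OF D(3) D(1)]) auto
    finally show "nmod (\<lambda>u. A (nker z) u + B (nker z) u) w \<le> (C + D) * exp (- min c d * (norm (z - w))\<^sup>2)"
      by (simp add: distrib_right)
  qed (use C D in auto)
qed

lemma norm_diff_square_le:
  fixes x y z :: "'a::real_normed_vector"
  shows "(norm (x - z))\<^sup>2 \<le> 2 * (norm (x - y))\<^sup>2 + 2 * (norm (y - z))\<^sup>2"
proof -
  have "(norm (x - z))\<^sup>2 \<le> (norm (x - y) + norm (y - z))\<^sup>2"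
    using norm_triangle_ineq[of "x - y" "y - z"] by (intro power_mono) auto
  also have "\<dots> \<le> 2 * (norm (x - y))\<^sup>2 + 2 * (norm (y - z))\<^sup>2"
    using sum_squares_bound[of "norm (x - y)" "norm (y - z)"] by (simp add: power2_sum)
  finally show ?thesis .
qed

lemma nn_integral_exp_shifted:
  fixes w :: "'a::euclidean_space"
  assumes "a > 0"
  shows "(\<integral>\<^sup>+u. ennreal (exp (- a * (norm (u - w))\<^sup>2)) \<partial>lborel) = ennreal (sqrt (pi / a) ^ DIM('a))"
proof -
  have "(\<integral>\<^sup>+u. ennreal (exp (- a * (norm (- w + u))\<^sup>2)) \<partial>lborel) = ennreal (sqrt (pi / a) ^ DIM('a))"
    by (subst nn_integral_lborel_shift[of "\<lambda>u::'a. ennreal (exp (- a * (norm u)\<^sup>2))"], simp)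
       (rule nn_integral_exp_norm_square[OF assms])
  then show ?thesis by simp
qed

text \<open>By \<open>nmod_op_le\<close> the entries of the product are dominated by a convolution
  of two Gaussians, which again has Gaussian decay.\<close>

lemma localized_comp:
  fixes A B :: "(complex ^ 'n \<Rightarrow> complex) \<Rightarrow> (complex ^ 'n \<Rightarrow> complex)"
  assumes A: "fock_bounded_op A" "localized A" and B: "fock_bounded_op B" "localized B"
  shows "localized (A \<circ> B)"
proof -
  obtain C c where C: "0 \<le> C" "0 < c" "\<And>z w. nmod (A (nker z)) w \<le> C * exp (- c * (norm (z - w))\<^sup>2)"
    using A(2) by (rule localizedE) blast
  obtain D d where D: "0 \<le> D" "0 < d" "\<And>z w. nmod (B (nker z)) w \<le> D * exp (- d * (norm (z - w))\<^sup>2)"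
    using B(2) by (rule localizedE) blast
  define e where "e = min c d"
  have e: "e > 0" using C D by (simp add: e_def)
  define K where "K = sqrt (pi / (e / 2)) ^ DIM(complex ^ 'n)"
  have K: "K \<ge> 0" using e by (simp add: K_def)
  define M where "M = D * C / pi ^ CARD('n)"
  have M: "M \<ge> 0" using C D by (simp add: M_def)
  show ?thesis
  proof (rule localizedI[of "M * K" "e / 4"])
    fix z w :: "complex ^ 'n"
    have pt: "nmod (B (nker z)) u * nmod (A (nker u)) w / pi ^ CARD('n)
        \<le> M * exp (- (e / 4) * (norm (z - w))\<^sup>2) * exp (- (e / 2) * (norm (u - w))\<^sup>2)" for u
    proof -
      have "nmod (B (nker z)) u * nmod (A (nker u)) w
          \<le> (D * exp (- e * (norm (z - u))\<^sup>2)) * (C * exp (- e * (norm (u - w))\<^sup>2))"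
        using D C by (intro mult_mono exp_decay_mono[OF C(3) C(1)] exp_decay_mono[OF D(3) D(1)]) (auto simp: e_def)
      also have "\<dots> = D * C * exp (- e * ((norm (z - u))\<^sup>2 + (norm (u - w))\<^sup>2))"
        by (simp add: algebra_simps flip: exp_add)
      \<comment> \<open>A quarter of |z - w|^2 costs at most half of |z - u|^2 plus half of |u -
        w|^2. What is left of |u - w|^2 makes the integral over \<open>u\<close> finite, hence the
        rates e / 4 and e / 2.\<close>
      also have "\<dots> \<le> D * C * exp (- (e / 4) * (norm (z - w))\<^sup>2 - (e / 2) * (norm (u - w))\<^sup>2)"
      proof -
        have "(norm (z - w))\<^sup>2 / 4 + (norm (u - w))\<^sup>2 / 2 \<le> (norm (z - u))\<^sup>2 + (norm (u - w))\<^sup>2"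
          using norm_diff_square_le[of z w u] zero_le_power2[of "norm (z - u)"] by linarith
        then have "e * ((norm (z - w))\<^sup>2 / 4 + (norm (u - w))\<^sup>2 / 2) \<le> e * ((norm (z - u))\<^sup>2 + (norm (u - w))\<^sup>2)"
          using e by (intro mult_left_mono) auto
        then show ?thesis using C D by (intro mult_left_mono) (auto simp: algebra_simps)
      qed
      also have "\<dots> = D * C * (exp (- (e / 4) * (norm (z - w))\<^sup>2) * exp (- (e / 2) * (norm (u - w))\<^sup>2))"
        by (subst exp_add[symmetric]) simp
      finally have "nmod (B (nker z)) u * nmod (A (nker u)) w / pi ^ CARD('n)
          \<le> D * C * (exp (- (e / 4) * (norm (z - w))\<^sup>2) * exp (- (e / 2) * (norm (u - w))\<^sup>2)) / pi ^ CARD('n)"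
        by (rule divide_right_mono) simp
      then show ?thesis by (simp only: M_def mult.assoc times_divide_eq_left times_divide_eq_right)
    qed
    have "ennreal (nmod (A (B (nker z))) w)
        \<le> (\<integral>\<^sup>+u. ennreal (nmod (B (nker z)) u * nmod (A (nker u)) w / pi ^ CARD('n)) \<partial>lborel)"
      by (rule nmod_op_le[OF A(1) fock_bounded_opD(1)[OF B(1) nker_in_fock]])
    also have "\<dots> \<le> (\<integral>\<^sup>+u. ennreal (M * exp (- (e / 4) * (norm (z - w))\<^sup>2)) * ennreal (exp (- (e / 2) * (norm (u - w))\<^sup>2)) \<partial>lborel)"
      using M pt by (intro nn_integral_mono) (simp add: ennreal_leI flip: ennreal_mult)
    also have "\<dots> = ennreal (M * exp (- (e / 4) * (norm (z - w))\<^sup>2)) * ennreal K"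
      by (subst nn_integral_cmult, simp, subst nn_integral_exp_shifted) (use e in \<open>auto simp: K_def\<close>)
    also have "\<dots> = ennreal (M * exp (- (e / 4) * (norm (z - w))\<^sup>2) * K)"
      using M K by (simp add: ennreal_mult)
    finally have "nmod (A (B (nker z))) w \<le> M * exp (- (e / 4) * (norm (z - w))\<^sup>2) * K"
      using M K by simp
    then show "nmod ((A \<circ> B) (nker z)) w \<le> M * K * exp (- (e / 4) * (norm (z - w))\<^sup>2)"
      by (simp add: algebra_simps)
  qed (use M K e in auto)
qed

lemma fock_bounded_op_id: "fock_bounded_op id"
  unfolding fock_bounded_op_def by (auto intro!: exI[of _ 1])

lemma fock_bounded_op_comp:
  assumes A: "fock_bounded_op A" and B: "fock_bounded_op B"
  shows "fock_bounded_op (A \<circ> B)"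
proof -
  obtain C where C: "C > 0" "\<And>h. h \<in> fock \<Longrightarrow> norm_gauss (A h) \<le> C * norm_gauss h"
    using fock_bounded_op_bound[OF A] by blast
  obtain D where D: "D > 0" "\<And>h. h \<in> fock \<Longrightarrow> norm_gauss (B h) \<le> D * norm_gauss h"
    using fock_bounded_op_bound[OF B] by blast
  have "norm_gauss (A (B h)) \<le> C * D * norm_gauss h" if h: "h \<in> fock" for h
    using order_trans[OF C(2)[OF fock_bounded_opD(1)[OF B h]] mult_left_mono[OF D(2)[OF h], of C]] C(1) by (simp add: mult.assoc)
  then show ?thesis
    unfolding fock_bounded_op_def o_def
    using fock_bounded_opD[OF A] fock_bounded_opD[OF B] by (auto intro!: exI[of _ "C * D"])
qed

section \<open>Toeplitz operators with BMO symbols\<close>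

text \<open>Existence comes from representing the functional u \<mapsto> \<langle>u, g\<rangle>,
  uniqueness from testing against the kernels K_z. Together they make the description by
  \<open>THE\<close> meaningful.\<close>

lemma fock_proj:
  assumes g: "g \<in> L2_gauss"
  shows "fock_proj g \<in> fock" and "u \<in> fock \<Longrightarrow> inner_gauss (fock_proj g) u = inner_gauss g u"
proof -
  obtain h where h: "h \<in> fock" "\<And>u. u \<in> fock \<Longrightarrow> inner_gauss u g = inner_gauss u h"
  proof (rule fock_riesz[of "\<lambda>u. inner_gauss u g" "norm_gauss g"])
    show "cmod (inner_gauss u g) \<le> norm_gauss g * norm_gauss u" if "u \<in> fock" for u
      using inner_gauss_le[OF fockD(2)[OF that] g] by (simp add: mult.commute)
  qed (auto simp: inner_gauss_add_left inner_gauss_cmult_left fockD g)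
  have char: "(h \<in> fock \<and> (\<forall>u\<in>fock. inner_gauss (\<lambda>z. g z - h z) u = 0)) \<longleftrightarrow>
      (h \<in> fock \<and> (\<forall>u\<in>fock. inner_gauss h u = inner_gauss g u))" for h
    by (auto simp: inner_gauss_diff_left g fockD)
  have h': "inner_gauss h u = inner_gauss g u" if "u \<in> fock" for u
    using h(2)[OF that] by (metis inner_gauss_commute)
  have "fock_proj g = h"
    unfolding fock_proj_def char
  proof (rule the_equality)
    show "h \<in> fock \<and> (\<forall>u\<in>fock. inner_gauss h u = inner_gauss g u)" using h h' by blast
    fix k assume k: "k \<in> fock \<and> (\<forall>u\<in>fock. inner_gauss k u = inner_gauss g u)"
    show "k = h"
    proof
      fix z
      show "k z = h z"
        using k h' fock_reproducing[of k z] fock_reproducing[OF h(1), of z] ker_in_fock by metis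
    qed
  qed
  with h(1) h' show "fock_proj g \<in> fock" "u \<in> fock \<Longrightarrow> inner_gauss (fock_proj g) u = inner_gauss g u"
    by auto
qed

text \<open>\<open>heat\<close> and \<open>BMO_t\<close> average f (m - v) for a symbol that is only
  Lebesgue measurable, so the reflection has to be measurable between the completed sigma-algebras;
  it is an affine map with all coefficients -1.\<close>

lemma lebesgue_reflect:
  fixes m :: "'a::euclidean_space"
  shows "(\<lambda>v. m - v) \<in> lebesgue \<rightarrow>\<^sub>M lebesgue" "distr lebesgue lebesgue (\<lambda>v. m - v) = lebesgue"
proof -
  have T: "(\<lambda>v. m + (\<Sum>j\<in>Basis. (- 1 * (v \<bullet> j)) *\<^sub>R j)) = (\<lambda>v. m - v)"
    by (simp add: sum_negf euclidean_representation fun_eq_iff)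
  show "(\<lambda>v. m - v) \<in> lebesgue \<rightarrow>\<^sub>M lebesgue"
    using lebesgue_affine_measurable[of "\<lambda>_. -1" m] unfolding T by simp
  show "distr lebesgue lebesgue (\<lambda>v. m - v) = lebesgue"
    using lebesgue_affine_euclidean[of "\<lambda>_. -1" m] unfolding T by (simp add: density_1 flip: one_ennreal_def)
qed

lemma bmo_toeplitz_localized:
  fixes T :: "(complex ^ 'n \<Rightarrow> complex) \<Rightarrow> (complex ^ 'n \<Rightarrow> complex)"
  assumes "bmo_toeplitz T"
  shows "localized T"
proof -
  obtain f where f: "symbol f" "f \<in> BMO" and T: "fock_bounded_op T" "\<And>h. h \<in> toeplitz_dom f \<Longrightarrow> T h = toeplitz f h"
    using assms unfolding bmo_toeplitz_def by blast
  have fm[measurable]: "f \<in> borel_measurable lebesgue" using f(1) by (simp add: symbol_def)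
  have fr[measurable]: "(\<lambda>v. f (m - v)) \<in> borel_measurable lebesgue" for m
    by (rule measurable_compose[OF lebesgue_reflect(1) fm])
  have km[measurable]: "nker z \<in> borel_measurable lebesgue" for z :: "complex ^ 'n"
    by (intro L2_gaussD fockD nker_in_fock)
  have L2: "(\<lambda>w. f w * nker z w) \<in> L2_gauss" for z
    using L2_gauss_cmult[of "\<lambda>w. f w * ker z w" "of_real (exp (- (norm z)\<^sup>2 / 2))"] f(1)
    by (simp add: symbol_def nker_def mult.left_commute)
  have Tk: "cmod (inner_gauss (\<lambda>u. f u * nker z u) (nker w)) = nmod (T (nker z)) w" for z w
  proof -
    \<comment> \<open>The condition in \<open>symbol\<close> puts every k_z into the Toeplitz
      domain, so \<open>T\<close> is given by the projection there and its entries are integrals of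
      \<open>f\<close>.\<close>
    have "T (nker z) = fock_proj (\<lambda>w. f w * nker z w)"
      using T(2)[of "nker z"] L2[of z] nker_in_fock[of z] by (simp add: toeplitz_dom_def toeplitz_def)
    then have "inner_gauss (\<lambda>u. f u * nker z u) (nker w) = inner_gauss (T (nker z)) (nker w)"
      by (simp add: fock_proj[OF L2] nker_in_fock)
    then show ?thesis
      by (simp add: cmod_inner_gauss_nker[OF fock_bounded_opD(1)[OF T(1) nker_in_fock]])
  qed
  define S where "S = (SUP z. \<integral>\<^sup>+ w. ennreal (cmod (f (z - w) - heat 1 f z)) \<partial>gauss 1)"
  have S: "S < \<infinity>" using f(2) by (simp add: BMO_def BMO_t_def S_def)
  define s where "s = enn2real S"
  have osc: "(\<integral>\<^sup>+ w. ennreal (cmod (f (z - w) - heat 1 f z)) \<partial>gauss 1) \<le> ennreal s" for z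
  proof -
    have "(\<integral>\<^sup>+ w. ennreal (cmod (f (z - w) - heat 1 f z)) \<partial>gauss 1) \<le> S"
      unfolding S_def by (rule SUP_upper) simp
    then show ?thesis using S by (simp add: s_def)
  qed
  obtain C where C: "C > 0" "\<And>h. h \<in> fock \<Longrightarrow> norm_gauss (T h) \<le> C * norm_gauss h"
    by (rule fock_bounded_op_bound[OF T(1)]) blast
  \<comment> \<open>The average of \<open>f\<close> at \<open>m\<close> is the diagonal entry
    \<langle>T k_m, k_m\<rangle> because |k_m|^2 times the weight is the weight recentred at
    \<open>m\<close>.\<close>
  have heat: "cmod (heat 1 f m) \<le> C" for m
  proof -
    have "heat 1 f m = (LINT v|lebesgue. gw v *\<^sub>R f (m - v))"
      unfolding heat_def gauss_eq
      by (subst integral_density) (auto intro: measurable_compose[OF lebesgue_reflect(1) fm])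
    \<comment> \<open>Now the integrand depends on \<open>v\<close> through m - v alone and can be
      pushed forward under the reflection.\<close>
    also have "\<dots> = (LINT v|lebesgue. gw (m - (m - v)) *\<^sub>R f (m - v))" by simp
    also have "\<dots> = (LINT u|distr lebesgue lebesgue (\<lambda>v. m - v). gw (m - u) *\<^sub>R f u)"
      by (subst integral_distr[OF lebesgue_reflect(1)])
         (auto intro!: borel_measurable_scaleR measurable_compose[OF lebesgue_reflect(1) gw_measurable_lebesgue])
    also have "\<dots> = (LINT u|lebesgue. gw (m - u) *\<^sub>R f u)"
      by (simp add: lebesgue_reflect(2))
    also have "\<dots> = (LINT u|lebesgue. gw u *\<^sub>R (f u * nker m u * cnj (nker m u)))"
    proof (intro Bochner_Integration.integral_cong refl)
      fix u
      have "gw (m - u) = gw u * (cmod (nker m u))\<^sup>2"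
        using gw_cmod_nker[of u m m] by (simp add: power2_eq_square scaleR_2[symmetric])
      then show "gw (m - u) *\<^sub>R f u = gw u *\<^sub>R (f u * nker m u * cnj (nker m u))"
        by (simp add: scaleR_conv_of_real complex_norm_square mult.assoc mult.left_commute del: of_real_power)
    qed
    also have "\<dots> = inner_gauss (\<lambda>u. f u * nker m u) (nker m)"
      unfolding inner_gauss_def gauss_eq by (subst integral_density) auto
    finally have "cmod (heat 1 f m) = nmod (T (nker m)) m" by (simp add: Tk)
    also have "\<dots> \<le> norm_gauss (T (nker m))"
      by (rule nmod_le[OF fock_bounded_opD(1)[OF T(1) nker_in_fock]])
    also have "\<dots> \<le> C" using C(2)[OF nker_in_fock[of m]] by (simp add: norm_gauss_nker)
    finally show ?thesis .
  qed
  show ?thesis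
  proof (rule localizedI[of "s + C" "1/4"])
    fix z w :: "complex ^ 'n"
    define m where "m = (1/2) *\<^sub>R (z + w)"
    define c where "c = heat 1 f m"
    define E where "E = exp (- (norm (z - w))\<^sup>2 / 4)"
    have L2c: "(\<lambda>u. (f u - c) * nker z u) \<in> L2_gauss"
      using L2_gauss_diff[OF L2[of z] L2_gauss_cmult[OF fockD(2)[OF nker_in_fock[of z]], of c]]
      by (simp add: algebra_simps)
    have "ennreal (cmod (inner_gauss (\<lambda>u. (f u - c) * nker z u) (nker w)))
      \<le> (\<integral>\<^sup>+u. ennreal (cmod ((f u - c) * nker z u * cnj (nker w u))) \<partial>gauss 1)"
      unfolding inner_gauss_def
      by (intro integral_norm_bound_ennreal integrable_inner_gauss L2c fockD(2)[OF nker_in_fock])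
    also have "\<dots> = (\<integral>\<^sup>+u. ennreal (gw u) * ennreal (cmod ((f u - c) * nker z u * cnj (nker w u))) \<partial>lebesgue)"
      unfolding gauss_eq by (rule nn_integral_density) auto
    also have "\<dots> = (\<integral>\<^sup>+u. ennreal E * ennreal (gw (m - u) * cmod (f u - c)) \<partial>lebesgue)"
    proof (intro nn_integral_cong)
      fix u
      have "gw u * cmod ((f u - c) * nker z u * cnj (nker w u)) = E * (gw (m - u) * cmod (f u - c))"
      proof -
        have "gw u * cmod ((f u - c) * nker z u * cnj (nker w u))
            = (gw u * (cmod (nker z u) * cmod (nker w u))) * cmod (f u - c)"
          by (simp only: norm_mult complex_mod_cnj mult_ac)
        then show ?thesis by (simp only: gw_cmod_nker E_def m_def mult.assoc)
      qed
      then show "ennreal (gw u) * ennreal (cmod ((f u - c) * nker z u * cnj (nker w u)))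
          = ennreal E * ennreal (gw (m - u) * cmod (f u - c))"
        by (simp add: E_def flip: ennreal_mult')
    qed
    also have "\<dots> = ennreal E * (\<integral>\<^sup>+u. ennreal (gw (m - u) * cmod (f u - c)) \<partial>lebesgue)"
      by (intro nn_integral_cmult measurable_compose[OF _ measurable_ennreal] borel_measurable_times
          measurable_compose[OF lebesgue_reflect(1) gw_measurable_lebesgue]) measurable
    also have "(\<integral>\<^sup>+u. ennreal (gw (m - u) * cmod (f u - c)) \<partial>lebesgue)
        = (\<integral>\<^sup>+u. ennreal (gw (m - u) * cmod (f u - c)) \<partial>distr lebesgue lebesgue (\<lambda>v. m - v))"
      by (simp add: lebesgue_reflect(2))
    also have "\<dots> = (\<integral>\<^sup>+v. ennreal (gw v * cmod (f (m - v) - c)) \<partial>lebesgue)"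
      by (subst nn_integral_distr[OF lebesgue_reflect(1)])
         (auto intro!: measurable_compose[OF _ measurable_ennreal] borel_measurable_times
          measurable_compose[OF lebesgue_reflect(1) gw_measurable_lebesgue])
    also have "\<dots> = (\<integral>\<^sup>+v. ennreal (cmod (f (m - v) - c)) \<partial>gauss 1)"
      unfolding gauss_eq
      by (subst nn_integral_density) (simp_all add: ennreal_mult)
    also have "ennreal E * \<dots> \<le> ennreal E * ennreal s"
      unfolding c_def by (intro mult_left_mono osc) auto
    finally have 1: "cmod (inner_gauss (\<lambda>u. (f u - c) * nker z u) (nker w)) \<le> E * s"
      by (simp add: E_def s_def flip: ennreal_mult)
    have "inner_gauss (\<lambda>u. f u * nker z u) (nker w)
        = inner_gauss (\<lambda>u. (f u - c) * nker z u + c * nker z u) (nker w)"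
      by (simp add: algebra_simps)
    also have "\<dots> = inner_gauss (\<lambda>u. (f u - c) * nker z u) (nker w) + c * inner_gauss (nker z) (nker w)"
      by (simp only: inner_gauss_add_left[OF L2c L2_gauss_cmult[OF fockD(2)[OF nker_in_fock]] fockD(2)[OF nker_in_fock]]
          inner_gauss_cmult_left)
    finally have "nmod (T (nker z)) w \<le> E * s + cmod c * cmod (inner_gauss (nker z) (nker w))"
      using 1 norm_triangle_ineq[of "inner_gauss (\<lambda>u. (f u - c) * nker z u) (nker w)" "c * inner_gauss (nker z) (nker w)"]
      by (simp add: norm_mult flip: Tk)
    \<comment> \<open>The entry \<langle>k_z, k_w\<rangle> decays at rate 1/2, faster than the rate
      1/4 in \<open>E\<close>.\<close>
    also have "\<dots> \<le> E * s + C * E"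
      unfolding cmod_inner_gauss_nker[OF nker_in_fock] nmod_nker c_def E_def
      using C(1) heat[of m] by (intro add_left_mono mult_mono) auto
    finally show "nmod (T (nker z)) w \<le> (s + C) * exp (- (1/4) * (norm (z - w))\<^sup>2)"
      by (simp add: E_def algebra_simps)
  qed (use C in \<open>auto simp: s_def\<close>)
qed

text \<open>Boundedness is carried through the induction because \<open>localized_comp\<close> asks
  for it in both factors.\<close>

lemma bmo_toeplitz_prod:
  assumes "\<forall>T\<in>set Ts. bmo_toeplitz T"
  shows "fock_bounded_op (foldr (\<circ>) Ts id) \<and> localized (foldr (\<circ>) Ts id)"
  using assms
proof (induction Ts)
  case Nil
  then show ?case using fock_bounded_op_id localized_id by (simp add: id_def)
next
  case (Cons T Ts)
  then have "bmo_toeplitz T" by simp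
  then have T: "fock_bounded_op T" "localized T"
    using bmo_toeplitz_localized unfolding bmo_toeplitz_def by blast+
  have "\<forall>T\<in>set Ts. bmo_toeplitz T" using Cons.prems by simp
  from Cons.IH[OF this]
  have "fock_bounded_op (foldr (\<circ>) Ts id)" "localized (foldr (\<circ>) Ts id)" by blast+
  moreover have "foldr (\<circ>) (T # Ts) id = T \<circ> foldr (\<circ>) Ts id" by simp
  ultimately show ?case
    using T by (simp only: fock_bounded_op_comp localized_comp)
qed

lemma bmo_toeplitz_algebra_localized:
  assumes "bmo_toeplitz_algebra A"
  shows "localized A"
proof -
  obtain Tss where Tss: "\<forall>Ts\<in>set Tss. \<forall>T\<in>set Ts. bmo_toeplitz T"
      "\<And>h. h \<in> fock \<Longrightarrow> A h = (\<lambda>z. \<Sum>Ts\<leftarrow>Tss. foldr (\<circ>) Ts id h z)"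
    using assms unfolding bmo_toeplitz_algebra_def by blast
  have "localized (\<lambda>h z. \<Sum>Ts\<leftarrow>Tss. foldr (\<circ>) Ts id h z)"
    using Tss(1)
  proof (induction Tss)
    case Nil
    then show ?case by (simp add: localized_zero)
  next
    case (Cons Ts Tss)
    then have "localized (foldr (\<circ>) Ts id)" using bmo_toeplitz_prod[of Ts] by auto
    moreover have "localized (\<lambda>h z. \<Sum>Ts\<leftarrow>Tss. foldr (\<circ>) Ts id h z)"
      by (rule Cons.IH) (use Cons.prems in auto)
    ultimately show ?case
      unfolding list.map sum_list.Cons by (rule localized_add)
  qed
  \<comment> \<open>Localization tests an operator only on the k_z, so agreement with the sum of
    products on \<open>fock\<close> is enough.\<close>
  then show ?thesis
    unfolding localized_def Tss(2)[OF nker_in_fock] by simp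
qed

section \<open>From the diagonal to the off-diagonal entries\<close>

text \<open>The iterated Cauchy formula puts the whole dependence on \<open>x\<close> into explicit kernels, so that
  the diagonal can be differentiated under the integral sign.\<close>

lemma holomorphic_on_diagonal:
  fixes G :: "complex \<Rightarrow> complex \<Rightarrow> complex"
  assumes G1: "\<And>y. (\<lambda>x. G x y) holomorphic_on UNIV" and G2: "\<And>x. (\<lambda>y. G x y) holomorphic_on UNIV"
    and cont: "continuous_on UNIV (\<lambda>(x, y). G x y)"
  shows "(\<lambda>x. G x x) holomorphic_on UNIV"
proof -
  have "(\<lambda>x. G x x) holomorphic_on ball 0 R" if R: "R > 0" for R
  proof -
    define e where "e t = of_real R * exp (2 * of_real pi * \<i> * of_real t)" for t
    have ce: "continuous_on UNIV e" unfolding e_def by (intro continuous_intros)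
    have eR: "cmod (e t) = R" for t using R by (simp add: e_def norm_mult)
    \<comment> \<open>The contour has radius \<open>R\<close>, so the denominators of both Cauchy
      kernels stay away from 0 for \<open>x\<close> inside the ball.\<close>
    have ne: "e t - x \<noteq> 0" if "x \<in> ball 0 R" for t x using eR[of t] that by auto
    have cG: "continuous_on S (\<lambda>p. G (f p) (g p))" if "continuous_on S f" "continuous_on S g"
      for S and f g :: "'b::topological_space \<Rightarrow> complex"
      using continuous_on_compose2[OF cont, of S "\<lambda>p. (f p, g p)"] that by (auto intro: continuous_on_Pair)
    define k where "k t x = e t / (e t - x)" for t x
    define f where "f x p = G (e (fst p)) (e (snd p)) * (k (fst p) x * k (snd p) x)" for x and p :: "real \<times> real"
    define fx where "fx x p = G (e (fst p)) (e (snd p)) *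
      (e (fst p) / (e (fst p) - x)\<^sup>2 * k (snd p) x + k (fst p) x * (e (snd p) / (e (snd p) - x)\<^sup>2))" for x and p :: "real \<times> real"
    have dk: "((\<lambda>x. k t x) has_field_derivative e t / (e t - x)\<^sup>2) (at x within S)" if "x \<in> ball 0 R" for t x S
      unfolding k_def using ne[OF that, of t]
      by (auto intro!: derivative_eq_intros simp: power2_eq_square)
    have cf: "continuous_on S (f x)" if "x \<in> ball 0 R" for x S
      unfolding f_def k_def using ne[OF that]
      by (intro continuous_intros cG continuous_on_compose2[OF ce]) auto
    have "(\<lambda>x. integral (cbox (0, 0) (1, 1)) (f x)) holomorphic_on ball 0 R"
    proof (rule leibniz_rule_holomorphic)
      show "((\<lambda>x. f x t) has_field_derivative fx x t) (at x within ball 0 R)"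
        if "x \<in> ball 0 R" for x t
        unfolding f_def fx_def using that
        by (auto intro!: derivative_eq_intros dk)
      show "f x integrable_on cbox (0, 0) (1, 1)" if "x \<in> ball 0 R" for x
        by (intro integrable_continuous cf that)
      show "continuous_on (ball 0 R \<times> cbox (0, 0) (1, 1)) (\<lambda>(x, t). fx x t)"
        unfolding fx_def k_def case_prod_unfold
        using ne by (intro continuous_intros cG continuous_on_compose2[OF ce]) auto
    qed simp
    moreover have "integral (cbox (0, 0) (1, 1)) (f x) = G x x" if x: "x \<in> ball 0 R" for x
    proof -
      have xR: "cmod x < R" using x by simp
      \<comment> \<open>Cauchy's formula in the second variable removes the inner integral; the
        formula in the first variable then removes the outer one.\<close>
      have inner: "integral (cbox 0 1) (\<lambda>t. f x (s, t)) = k s x * G (e s) x" for s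
      proof -
        have "((\<lambda>t. G (e s) (e t) * k t x) has_integral G (e s) x) {0..1}"
          using Cauchy_circle[OF G2[of "e s"] xR] by (simp add: e_def k_def)
        then have "((\<lambda>t. k s x * (G (e s) (e t) * k t x)) has_integral k s x * G (e s) x) {0..1}"
          by (rule has_integral_mult_right)
        then show ?thesis by (intro integral_unique) (simp add: f_def mult_ac)
      qed
      have "integral (cbox (0, 0) (1, 1)) (f x) = integral (cbox 0 1) (\<lambda>s. k s x * G (e s) x)"
        by (simp only: integral_prod_continuous[OF cf[OF x]] inner)
      also have "\<dots> = G x x"
        using Cauchy_circle[OF G1[of x] xR]
        by (intro integral_unique) (simp add: e_def k_def mult.commute)
      finally show ?thesis .
    qed
    ultimately show ?thesis
      by (rule holomorphic_transform)
  qed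
  then have "(\<lambda>x. G x x) field_differentiable at x" for x
    using holomorphic_on_imp_differentiable_at[of _ "ball 0 (cmod x + 1)" x] add_nonneg_pos[of "cmod x" 1] by auto
  then show ?thesis by (simp add: holomorphic_on_def field_differentiable_at_within)
qed

text \<open>Montel's theorem gives a limit function along a subsequence. It vanishes on the real
  axis, hence everywhere by the identity theorem.\<close>

lemma entire_small_on_reals:
  fixes p :: "nat \<Rightarrow> complex \<Rightarrow> complex"
  assumes hol: "\<And>n. p n holomorphic_on UNIV"
    and bnd: "\<And>n x. cmod (p n x) \<le> B x" and B: "continuous_on UNIV B"
    and real: "\<And>x::real. (\<lambda>n. p n (of_real x)) \<longlonglongrightarrow> 0"
  obtains r where "strict_mono (r :: nat \<Rightarrow> nat)" "(\<lambda>n. p (r n) w) \<longlonglongrightarrow> 0"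
proof -
  obtain g r where g: "g holomorphic_on UNIV" and r: "strict_mono (r :: nat \<Rightarrow> nat)"
    "\<And>x. x \<in> UNIV \<Longrightarrow> (\<lambda>n. p (r n) x) \<longlonglongrightarrow> g x"
  proof (rule Montel[of UNIV "{h. h holomorphic_on UNIV \<and> (\<forall>x. cmod (h x) \<le> B x)}" p])
    show "\<exists>b. \<forall>h\<in>{h. h holomorphic_on UNIV \<and> (\<forall>x. cmod (h x) \<le> B x)}. \<forall>z\<in>K. cmod (h z) \<le> b"
      if "compact K" for K
    proof -
      have "bounded (B ` K)"
        using that B by (intro compact_imp_bounded compact_continuous_image) (auto intro: continuous_on_subset)
      then obtain b where "\<forall>x\<in>K. \<bar>B x\<bar> \<le> b" by (auto simp: bounded_iff)
      then have "\<forall>x\<in>K. B x \<le> b" by (simp add: abs_le_iff)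
      then show ?thesis by (intro exI[of _ b]) (auto intro: order_trans)
    qed
  qed (use hol bnd in auto)
  have g0: "g (of_real x) = 0" for x :: real
    using LIMSEQ_unique[OF r(2)[of "of_real x"] LIMSEQ_subseq_LIMSEQ[OF real[of x] r(1), unfolded o_def]] by simp
  have lim: "(0::complex) islimpt range of_real"
    unfolding islimpt_approachable
  proof (intro allI impI)
    fix e :: real assume "e > 0"
    then show "\<exists>x'\<in>range complex_of_real. x' \<noteq> 0 \<and> dist x' 0 < e"
      by (intro bexI[of _ "of_real (e / 2)"]) (auto simp: norm_divide simp del: of_real_divide)
  qed
  have "g w = 0"
    by (rule analytic_continuation[OF g open_UNIV connected_UNIV subset_UNIV UNIV_I lim _ UNIV_I])
       (use g0 in auto)
  then show ?thesis using that[OF r(1)] r(2)[of w] by simp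
qed

text \<open>If every sequence escaping to infinity has a subsequence along which \<open>f\<close>
  tends to 0, no escaping sequence can keep \<open>f\<close> away from 0. The freedom to pass to a
  subsequence is what Montel's theorem and compactness require.\<close>

lemma tendsto_0_at_infinity_seqI:
  fixes f :: "'a::real_normed_vector \<Rightarrow> real"
  assumes seq: "\<And>\<zeta>. filterlim \<zeta> at_infinity sequentially \<Longrightarrow>
      \<exists>r. strict_mono (r :: nat \<Rightarrow> nat) \<and> (\<lambda>n. f (\<zeta> (r n))) \<longlonglongrightarrow> 0"
  shows "(f \<longlongrightarrow> 0) at_infinity"
proof (rule tendstoI)
  fix e :: real assume e: "e > 0"
  show "\<forall>\<^sub>F x in at_infinity. dist (f x) 0 < e"
  proof (rule ccontr)
    assume "\<not> (\<forall>\<^sub>F x in at_infinity. dist (f x) 0 < e)"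
    then have "\<exists>x. norm x \<ge> real n \<and> \<not> dist (f x) 0 < e" for n
      by (auto simp: eventually_at_infinity)
    then obtain \<zeta> where \<zeta>: "\<And>n. norm (\<zeta> n) \<ge> real n" "\<And>n. \<not> dist (f (\<zeta> n)) 0 < e" by metis
    have "filterlim (\<lambda>n. norm (\<zeta> n)) at_top sequentially"
      using \<zeta>(1) by (rule filterlim_at_top_mono[OF filterlim_real_sequentially always_eventually[OF allI]])
    then have "filterlim \<zeta> at_infinity sequentially"
      by (rule filterlim_norm_at_top_imp_at_infinity)
    then obtain r where "strict_mono (r :: nat \<Rightarrow> nat)" "(\<lambda>n. f (\<zeta> (r n))) \<longlonglongrightarrow> 0"
      using seq by blast
    then have "\<forall>\<^sub>F n in sequentially. dist (f (\<zeta> (r n))) 0 < e"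
      using e by (auto dest: tendstoD)
    then show False using \<zeta>(2) by (auto simp: eventually_sequentially)
  qed
qed

section \<open>Continuity and holomorphy of operator kernels\<close>

text \<open>By the reproducing formula this bounds |h z - h z'| on the unit ball of the Fock space,
  so it serves as a common modulus of continuity.\<close>

definition ker_dist :: "complex ^ 'n \<Rightarrow> complex ^ 'n \<Rightarrow> real" where
  "ker_dist z z' = norm_gauss (\<lambda>w. ker z w - ker z' w)"

lemma ker_dist_square:
  "(ker_dist z z')\<^sup>2 = exp ((norm z)\<^sup>2) - 2 * Re (ker z z') + exp ((norm z')\<^sup>2)"
proof -
  have "(ker_dist z z')\<^sup>2 = (norm_gauss (\<lambda>w. ker z w + (- 1) * ker z' w))\<^sup>2"
    by (simp add: ker_dist_def)
  also have "\<dots> = (norm_gauss (ker z))\<^sup>2 + 2 * Re (inner_gauss (ker z) (\<lambda>w. (- 1) * ker z' w))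
      + (norm_gauss (\<lambda>w. (- 1) * ker z' w))\<^sup>2"
    by (intro norm_gauss_add_square L2_gauss_cmult fockD(2)[OF ker_in_fock])
  also have "\<dots> = exp ((norm z)\<^sup>2) - 2 * Re (ker z z') + exp ((norm z')\<^sup>2)"
    by (subst inner_gauss_cmult_right, subst norm_gauss_cmult)
       (simp add: fock_reproducing[OF ker_in_fock] norm_gauss_ker flip: exp_double)
  finally show ?thesis .
qed

lemma continuous_on_ker_dist: "continuous_on UNIV (\<lambda>z. ker_dist z z')"
proof -
  have "ker_dist z z' = sqrt (exp ((norm z)\<^sup>2) - 2 * Re (exp (hdot z' z)) + exp ((norm z')\<^sup>2))" for z
    using ker_dist_square[of z z'] by (metis ker_def ker_dist_def norm_gauss_nonneg real_sqrt_abs abs_of_nonneg)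
  then show ?thesis by (simp only:) (intro continuous_intros)
qed

lemma ker_dist_self: "ker_dist z z = 0"
  by (simp add: ker_dist_def norm_gauss_def)

text \<open>Moving \<open>z\<close> changes A K_z in norm by at most a multiple of
  \<open>ker_dist\<close>, hence pointwise with a constant locally bounded in \<open>w\<close>;
  moving \<open>w\<close> at a fixed \<open>z0\<close> is continuity of one entire function. The
  majorant \<open>B\<close> adds the two contributions.\<close>

lemma continuous_on_op_ker:
  fixes A :: "(complex ^ 'n \<Rightarrow> complex) \<Rightarrow> (complex ^ 'n \<Rightarrow> complex)"
  assumes A: "fock_bounded_op A"
  shows "continuous_on UNIV (\<lambda>(z, w). A (ker z) w)"
proof -
  obtain C where C: "C > 0" "\<And>h. h \<in> fock \<Longrightarrow> norm_gauss (A h) \<le> C * norm_gauss h"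
    using fock_bounded_op_bound[OF A] by blast
  have "isCont (\<lambda>(z, w). A (ker z) w) q" for q :: "(complex ^ 'n) \<times> (complex ^ 'n)"
  proof -
    obtain z0 w0 where q: "q = (z0, w0)" by (cases q)
    define h where "h = A (ker z0)"
    have h: "h \<in> fock" unfolding h_def by (intro fock_bounded_opD[OF A] ker_in_fock)
    define B where "B p = exp ((norm (snd p))\<^sup>2 / 2) * (C * ker_dist (fst p) z0) + cmod (h (snd p) - h w0)"
      for p :: "(complex ^ 'n) \<times> (complex ^ 'n)"
    have "continuous_on UNIV B"
      unfolding B_def
      by (intro continuous_intros continuous_on_compose2[OF continuous_on_ker_dist]
          continuous_on_compose2[OF entire_continuous[OF fockD(1)[OF h]]]) auto
    then have "(B \<longlongrightarrow> B q) (at q)"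
      by (simp add: continuous_on_eq_continuous_at isCont_def q)
    then have B: "(B \<longlongrightarrow> 0) (at q)" by (simp add: B_def q ker_dist_self)
    have le: "norm ((case p of (z, w) \<Rightarrow> A (ker z) w) - h w0) \<le> B p" for p
    proof -
      obtain z w where p: "p = (z, w)" by (cases p)
      have d: "(\<lambda>u. ker z u - ker z0 u) \<in> fock" by (intro fock_diff ker_in_fock)
      have "cmod (A (\<lambda>u. ker z u - ker z0 u) w) \<le> exp ((norm w)\<^sup>2 / 2) * norm_gauss (A (\<lambda>u. ker z u - ker z0 u))"
        by (rule fock_pointwise_bound[OF fock_bounded_opD(1)[OF A d]])
      also have "\<dots> \<le> exp ((norm w)\<^sup>2 / 2) * (C * ker_dist z z0)"
        unfolding ker_dist_def by (intro mult_left_mono C(2) d) auto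
      finally have 1: "cmod (A (ker z) w - h w) \<le> exp ((norm w)\<^sup>2 / 2) * (C * ker_dist z z0)"
        by (simp add: fock_bounded_op_diff[OF A ker_in_fock ker_in_fock] h_def)
      have "cmod (A (ker z) w - h w0) \<le> cmod (A (ker z) w - h w) + cmod (h w - h w0)"
        using norm_triangle_ineq[of "A (ker z) w - h w" "h w - h w0"] by simp
      with 1 show ?thesis by (simp add: p B_def)
    qed
    have "((\<lambda>p. (case p of (z, w) \<Rightarrow> A (ker z) w) - h w0) \<longlongrightarrow> 0) (at q)"
      by (rule Lim_null_comparison[OF always_eventually[OF allI[OF le]] B])
    then show ?thesis
      unfolding isCont_def by (subst (asm) LIM_zero_iff) (simp add: q h_def)
  qed
  then show ?thesis by (simp add: continuous_on_eq_continuous_at)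
qed

text \<open>The conjugated parameter in the index of \<open>ker\<close> compensates the
  antiholomorphic dependence on that index. Each variable separately is then holomorphic, and
  \<open>holomorphic_on_diagonal\<close> joins them.\<close>

lemma op_ker_line_holomorphic:
  fixes A :: "(complex ^ 'n \<Rightarrow> complex) \<Rightarrow> (complex ^ 'n \<Rightarrow> complex)"
  assumes A: "fock_bounded_op A"
  shows "(\<lambda>l. A (ker (a + cnj l *s b)) (a + l *s b)) holomorphic_on UNIV"
proof (rule holomorphic_on_diagonal[where G="\<lambda>x y. A (ker (a + cnj x *s b)) (a + y *s b)"])
  fix m :: complex
  show "(\<lambda>l. A (ker (a + cnj m *s b)) (a + l *s b)) holomorphic_on UNIV"
    by (rule entire_line[OF fockD(1)[OF fock_bounded_opD(1)[OF A ker_in_fock]]])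
  obtain g where g: "g \<in> fock" "\<And>u. A (ker u) (a + m *s b) = cnj (g u)"
    by (rule bounded_op_riesz[OF A, where w="a + m *s b"]) (rule that)
  have "cnj \<circ> (\<lambda>l. g (a + l *s b)) \<circ> cnj holomorphic_on UNIV"
    using holomorphic_on_compose_cnj_cnj[OF holomorphic_on_subset[OF entire_line[OF fockD(1)[OF g(1)], of a b]], of UNIV]
    by simp
  then show "(\<lambda>l. A (ker (a + cnj l *s b)) (a + m *s b)) holomorphic_on UNIV"
    by (simp add: g(2) o_def)
next
  have "continuous_on UNIV (\<lambda>p :: complex \<times> complex. (a + cnj (fst p) *s b, a + snd p *s b))"
    by (intro continuous_intros)
  from continuous_on_compose2[OF continuous_on_op_ker[OF A] this]
  show "continuous_on UNIV (\<lambda>(x, y). A (ker (a + cnj x *s b)) (a + y *s b))"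
    by (simp add: case_prod_unfold)
qed

text \<open>Along a complex line the sesquilinear kernel becomes an entire function: it is the Berezin
  transform on the real axis and an off-diagonal entry at \<open>\<i>\<close>.\<close>

lemma off_diagonal_vanish:
  fixes A :: "(complex ^ 'n \<Rightarrow> complex) \<Rightarrow> (complex ^ 'n \<Rightarrow> complex)"
  assumes A: "fock_bounded_op A"
    and ber: "((\<lambda>z. nmod (A (nker z)) z) \<longlongrightarrow> 0) at_infinity"
  shows "((\<lambda>z. nmod (A (nker z)) (z + v)) \<longlongrightarrow> 0) at_infinity"
proof (rule tendsto_0_at_infinity_seqI)
  fix \<zeta> :: "nat \<Rightarrow> complex ^ 'n" assume \<zeta>: "filterlim \<zeta> at_infinity sequentially"
  obtain C where C: "C > 0" "\<And>h. h \<in> fock \<Longrightarrow> norm_gauss (A h) \<le> C * norm_gauss h"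
    using fock_bounded_op_bound[OF A] by blast
  \<comment> \<open>\<open>a\<close> and \<open>b\<close> are chosen so that the points a + conj l b
    and a + l b coincide for real \<open>l\<close> and are \<zeta> and \<zeta> + v at l =
    \<i>.\<close>
  define a where "a n = \<zeta> n + (1/2) *s v" for n
  define b where "b = (- \<i> / 2) *s v"
  \<comment> \<open>The normalising weight exp (- |a + x b|^2), with \<open>x\<close> real, is not
    holomorphic in the parameter; it is replaced by its holomorphic extension from the real axis,
    with x^2 read as l^2.\<close>
  define p where "p n l = A (ker (a n + cnj l *s b)) (a n + l *s b) *
      exp (- (of_real ((norm (a n))\<^sup>2) + 2 * l * of_real (a n \<bullet> b) + l\<^sup>2 * of_real ((norm b)\<^sup>2)))" for n l
  have hol: "p n holomorphic_on UNIV" for n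
    unfolding p_def by (intro holomorphic_intros op_ker_line_holomorphic[OF A])
  \<comment> \<open>The price of that replacement is the factor exp (2 (Im l)^2 |b|^2). It is 1 on
    the real axis and independent of \<open>n\<close>, so the family is locally bounded uniformly in
    \<open>n\<close>.\<close>
  have mod: "cmod (p n l) = nmod (A (nker (a n + cnj l *s b))) (a n + l *s b) * exp (2 * (Im l)\<^sup>2 * (norm b)\<^sup>2)" for n l
  proof -
    define u w where "u = a n + cnj l *s b" and "w = a n + l *s b"
    have sq: "(norm (a n + k *s b))\<^sup>2 = (norm (a n))\<^sup>2 + 2 * Re (cnj k * hdot (a n) b) + (cmod k)\<^sup>2 * (norm b)\<^sup>2" for k
    proof -
      have "(norm (a n + k *s b))\<^sup>2 = (norm (a n))\<^sup>2 + 2 * (a n \<bullet> (k *s b)) + (norm (k *s b))\<^sup>2"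
        by (simp add: power2_norm_eq_inner inner_add_left inner_add_right inner_commute)
      then show ?thesis
        unfolding Re_hdot[symmetric] hdot_smult_right norm_smult power_mult_distrib .
    qed
    have "(norm u)\<^sup>2 / 2 + (norm w)\<^sup>2 / 2
        = (norm (a n))\<^sup>2 + 2 * Re l * (a n \<bullet> b) + ((Re l)\<^sup>2 + (Im l)\<^sup>2) * (norm b)\<^sup>2"
      unfolding u_def w_def sq Re_hdot[symmetric] by (simp add: cmod_power2 field_simps)
    moreover have "Re (- (of_real ((norm (a n))\<^sup>2) + 2 * l * of_real (a n \<bullet> b) + l\<^sup>2 * of_real ((norm b)\<^sup>2)))
        = - ((norm (a n))\<^sup>2 + 2 * Re l * (a n \<bullet> b) + ((Re l)\<^sup>2 - (Im l)\<^sup>2) * (norm b)\<^sup>2)"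
      by (simp add: power2_eq_square)
    ultimately have ex: "Re (- (of_real ((norm (a n))\<^sup>2) + 2 * l * of_real (a n \<bullet> b) + l\<^sup>2 * of_real ((norm b)\<^sup>2)))
        = 2 * (Im l)\<^sup>2 * (norm b)\<^sup>2 - (norm u)\<^sup>2 / 2 - (norm w)\<^sup>2 / 2"
      unfolding distrib_right left_diff_distrib by linarith
    have e: "exp (- (norm u)\<^sup>2 / 2) * exp (- (norm w)\<^sup>2 / 2) * exp (2 * (Im l)\<^sup>2 * (norm b)\<^sup>2)
        = exp (2 * (Im l)\<^sup>2 * (norm b)\<^sup>2 - (norm u)\<^sup>2 / 2 - (norm w)\<^sup>2 / 2)"
      unfolding exp_add[symmetric] by (rule arg_cong[where f=exp]) simp
    have "nmod (A (nker u)) w * exp (2 * (Im l)\<^sup>2 * (norm b)\<^sup>2)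
        = cmod (A (ker u) w) * (exp (- (norm u)\<^sup>2 / 2) * exp (- (norm w)\<^sup>2 / 2) * exp (2 * (Im l)\<^sup>2 * (norm b)\<^sup>2))"
      by (simp add: nmod_def bounded_op_nker[OF A] norm_mult)
    then show ?thesis
      unfolding p_def norm_mult norm_exp_eq_Re e
      by (simp only: u_def[symmetric] w_def[symmetric] ex)
  qed
  have bnd: "cmod (p n l) \<le> C * exp (2 * (Im l)\<^sup>2 * (norm b)\<^sup>2)" for n l
    unfolding mod
  proof (rule mult_right_mono)
    show "nmod (A (nker (a n + cnj l *s b))) (a n + l *s b) \<le> C"
      using order_trans[OF nmod_le[OF fock_bounded_opD(1)[OF A nker_in_fock]] C(2)[OF nker_in_fock]]
      by (simp add: norm_gauss_nker)
  qed simp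
  have real: "(\<lambda>n. p n (of_real x)) \<longlonglongrightarrow> 0" for x
  proof -
    have "filterlim (\<lambda>n. \<zeta> n + ((1/2) *s v + of_real x *s b)) at_infinity sequentially"
      by (rule tendsto_add_filterlim_at_infinity'[OF \<zeta> tendsto_const])
    then have "filterlim (\<lambda>n. a n + of_real x *s b) at_infinity sequentially"
      by (simp add: a_def add.assoc)
    then have "(\<lambda>n. nmod (A (nker (a n + of_real x *s b))) (a n + of_real x *s b)) \<longlonglongrightarrow> 0"
      by (rule filterlim_compose[OF ber])
    then have "(\<lambda>n. norm (p n (of_real x))) \<longlonglongrightarrow> 0" by (simp add: mod)
    then show ?thesis by (rule tendsto_norm_zero_cancel)
  qed
  obtain r where r: "strict_mono (r :: nat \<Rightarrow> nat)" "(\<lambda>n. p (r n) \<i>) \<longlonglongrightarrow> 0"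
    by (rule entire_small_on_reals[OF hol bnd _ real, where w=\<i>]) (auto intro!: continuous_intros)
  have "(\<lambda>n. norm (p (r n) \<i>) * exp (- 2 * (norm b)\<^sup>2)) \<longlonglongrightarrow> 0 * exp (- 2 * (norm b)\<^sup>2)"
    by (intro tendsto_mult tendsto_norm_zero r(2) tendsto_const)
  moreover have "norm (p n \<i>) * exp (- 2 * (norm b)\<^sup>2) = nmod (A (nker (\<zeta> n))) (\<zeta> n + v)" for n
  proof -
    have "a n + cnj \<i> *s b = \<zeta> n" "a n + \<i> *s b = \<zeta> n + v"
      by (simp_all add: a_def b_def vec_eq_iff algebra_simps)
    then show ?thesis by (simp add: mod mult.assoc flip: exp_add)
  qed
  ultimately have "(\<lambda>n. nmod (A (nker (\<zeta> (r n)))) (\<zeta> (r n) + v)) \<longlonglongrightarrow> 0"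
    by (simp only: mult_zero_left)
  with r(1) show "\<exists>r. strict_mono (r :: nat \<Rightarrow> nat) \<and> (\<lambda>n. nmod (A (nker (\<zeta> (r n)))) (\<zeta> (r n) + v)) \<longlonglongrightarrow> 0"
    by blast
qed

section \<open>Schur test and compactness\<close>

lemma continuous_on_nmod_op:
  fixes A :: "(complex ^ 'n \<Rightarrow> complex) \<Rightarrow> (complex ^ 'n \<Rightarrow> complex)"
  assumes A: "fock_bounded_op A"
  shows "continuous_on UNIV (\<lambda>(z, w). nmod (A (nker z)) w)"
proof -
  have "(\<lambda>(z, w). nmod (A (nker z)) w)
      = (\<lambda>p. exp (- (norm (fst p))\<^sup>2 / 2) * cmod (case p of (z, w) \<Rightarrow> A (ker z) w) * exp (- (norm (snd p))\<^sup>2 / 2))"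
    by (auto simp: nmod_def bounded_op_nker[OF A] norm_mult)
  then show ?thesis
    by (simp only:) (intro continuous_intros continuous_on_op_ker[OF A], auto)
qed

text \<open>Joint measurability is what the exchange of integrals in the Schur estimate rests on; it
  comes from joint continuity.\<close>

lemma measurable_nmod_op:
  fixes A :: "(complex ^ 'n \<Rightarrow> complex) \<Rightarrow> (complex ^ 'n \<Rightarrow> complex)"
  assumes A: "fock_bounded_op A"
  shows "(\<lambda>p. nmod (A (nker (fst p))) (snd p)) \<in> borel_measurable (borel \<Otimes>\<^sub>M borel)"
  using continuous_on_nmod_op[OF A] unfolding borel_prod case_prod_unfold
  by (rule borel_measurable_continuous_onI)

lemma nmod_measurable: "h \<in> fock \<Longrightarrow> nmod h \<in> borel_measurable borel"
  using fock_borel_measurable[of h] unfolding nmod_def[abs_def] by measurable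

text \<open>The Cauchy-Schwarz half of Schur's test. Localization bounds the mass of the kernel in
  \<open>u\<close> uniformly in \<open>w\<close>, and this bound, divided by pi^(2 n), is the
  constant \<open>K\<close>.\<close>

lemma nmod_op_square_le:
  fixes A :: "(complex ^ 'n \<Rightarrow> complex) \<Rightarrow> (complex ^ 'n \<Rightarrow> complex)"
  assumes A: "fock_bounded_op A" "localized A"
  obtains K where "0 \<le> K"
    "\<And>h w. h \<in> fock \<Longrightarrow> ennreal ((nmod (A h) w)\<^sup>2)
      \<le> ennreal K * (\<integral>\<^sup>+u. ennreal (nmod (A (nker u)) w) * ennreal ((nmod h u)\<^sup>2) \<partial>lborel)"
proof -
  obtain C c where C: "0 \<le> C" "0 < c" "\<And>z w. nmod (A (nker z)) w \<le> C * exp (- c * (norm (z - w))\<^sup>2)"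
    using A(2) by (rule localizedE) blast
  define L where "L = C * sqrt (pi / c) ^ DIM(complex ^ 'n)"
  define P :: real where "P = pi ^ CARD('n)"
  have P: "P > 0" by (simp add: P_def)
  have L: "L \<ge> 0" using C by (simp add: L_def)
  note [measurable] = measurable_nmod_op[OF A(1)]
  have am[measurable]: "(\<lambda>u. nmod (A (nker u)) w) \<in> borel_measurable borel" for w
    using measurable_compose[OF _ measurable_nmod_op[OF A(1)], of "\<lambda>u. (u, w)" borel] by simp
  have Lint: "(\<integral>\<^sup>+u. ennreal (nmod (A (nker u)) w) \<partial>lborel) \<le> ennreal L" for w
  proof -
    have "(\<integral>\<^sup>+u. ennreal (nmod (A (nker u)) w) \<partial>lborel)
        \<le> (\<integral>\<^sup>+u. ennreal C * ennreal (exp (- c * (norm (u - w))\<^sup>2)) \<partial>lborel)"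
      by (intro nn_integral_mono) (simp only: ennreal_mult[OF C(1) exp_ge_zero, symmetric] ennreal_leI[OF C(3)])
    also have "\<dots> = ennreal C * ennreal (sqrt (pi / c) ^ DIM(complex ^ 'n))"
      by (subst nn_integral_cmult, simp, subst nn_integral_exp_shifted[OF C(2)], rule refl)
    also have "\<dots> = ennreal L" unfolding L_def using C by (intro ennreal_mult[symmetric]) auto
    finally show ?thesis .
  qed
  have "ennreal ((nmod (A h) w)\<^sup>2)
      \<le> ennreal (L / P\<^sup>2) * (\<integral>\<^sup>+u. ennreal (nmod (A (nker u)) w) * ennreal ((nmod h u)\<^sup>2) \<partial>lborel)"
    if h: "h \<in> fock" for h w
  proof -
    note [measurable] = nmod_measurable[OF h]
    define a where "a u = nmod (A (nker u)) w" for u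
    have [measurable]: "a \<in> borel_measurable borel" unfolding a_def by (rule am)
    have a0: "0 \<le> a u" for u by (simp add: a_def)
    have "(ennreal (nmod (A h) w))\<^sup>2 \<le> (\<integral>\<^sup>+u. ennreal (nmod h u * a u / P) \<partial>lborel)\<^sup>2"
      using nmod_op_le[OF A(1) h, of w] by (intro power_mono) (auto simp: a_def P_def)
    \<comment> \<open>The kernel \<open>a\<close> is split into two square roots, one of which stays
      with \<open>h\<close>.\<close>
    also have "\<dots> = (\<integral>\<^sup>+u. ennreal (sqrt (a u) / P) * ennreal (sqrt (a u) * nmod h u) \<partial>lborel)\<^sup>2"
    proof -
      have "ennreal (nmod h u * a u / P) = ennreal (sqrt (a u) / P) * ennreal (sqrt (a u) * nmod h u)" for u
        using a0[of u] P by (simp add: mult.commute flip: ennreal_mult)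
      then show ?thesis by simp
    qed
    also have "\<dots> \<le> (\<integral>\<^sup>+u. (ennreal (sqrt (a u) / P))\<^sup>2 \<partial>lborel) * (\<integral>\<^sup>+u. (ennreal (sqrt (a u) * nmod h u))\<^sup>2 \<partial>lborel)"
      by (rule Cauchy_Schwarz_nn_integral) measurable
    also have "(\<integral>\<^sup>+u. (ennreal (sqrt (a u) / P))\<^sup>2 \<partial>lborel) = (\<integral>\<^sup>+u. ennreal (1 / P\<^sup>2) * ennreal (a u) \<partial>lborel)"
      using a0 P by (intro nn_integral_cong) (simp add: ennreal_power power_divide flip: ennreal_mult)
    also have "\<dots> = ennreal (1 / P\<^sup>2) * (\<integral>\<^sup>+u. ennreal (a u) \<partial>lborel)"
      by (rule nn_integral_cmult) measurable
    also have "(\<integral>\<^sup>+u. (ennreal (sqrt (a u) * nmod h u))\<^sup>2 \<partial>lborel) = (\<integral>\<^sup>+u. ennreal (a u) * ennreal ((nmod h u)\<^sup>2) \<partial>lborel)"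
      using a0 by (intro nn_integral_cong) (simp add: ennreal_power power_mult_distrib flip: ennreal_mult)
    also have "ennreal (1 / P\<^sup>2) * (\<integral>\<^sup>+u. ennreal (a u) \<partial>lborel) * (\<integral>\<^sup>+u. ennreal (a u) * ennreal ((nmod h u)\<^sup>2) \<partial>lborel)
       \<le> ennreal (1 / P\<^sup>2) * ennreal L * (\<integral>\<^sup>+u. ennreal (a u) * ennreal ((nmod h u)\<^sup>2) \<partial>lborel)"
      using Lint[of w] by (intro mult_right_mono mult_left_mono) (auto simp: a_def)
    also have "ennreal (1 / P\<^sup>2) * ennreal L = ennreal (L / P\<^sup>2)"
      using L by (simp flip: ennreal_mult)
    finally show ?thesis by (simp add: a_def ennreal_power)
  qed
  moreover have "0 \<le> L / P\<^sup>2" using L by simp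
  ultimately show ?thesis by (rule that[rotated])
qed

text \<open>This is weak convergence of k_z to 0. Applied to the identity,
  \<open>nmod_op_square_le\<close> bounds the squared coefficient at \<zeta> by a Gaussian average
  of the integrable function \<open>(nmod h u)\<^sup>2\<close> around \<zeta>, and dominated
  convergence applies.\<close>

lemma nmod_vanishes:
  fixes h :: "complex ^ 'n \<Rightarrow> complex"
  assumes h: "h \<in> fock" and \<zeta>: "filterlim \<zeta> at_infinity sequentially"
  shows "(\<lambda>n. nmod h (\<zeta> n)) \<longlonglongrightarrow> 0"
proof -
  obtain K where K: "0 \<le> K" "\<And>h w. h \<in> fock \<Longrightarrow> ennreal ((nmod (id h) w)\<^sup>2)
      \<le> ennreal K * (\<integral>\<^sup>+u. ennreal (nmod (id (nker u)) w) * ennreal ((nmod h u)\<^sup>2) \<partial>(lborel :: (complex ^ 'n) measure))"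
    by (rule nmod_op_square_le[OF fock_bounded_op_id localized_id]) blast
  note [measurable] = nmod_measurable[OF h]
  define I where "I n = (\<integral>\<^sup>+u. ennreal (exp (- (norm (u - \<zeta> n))\<^sup>2 / 2)) * ennreal ((nmod h u)\<^sup>2) \<partial>lborel)" for n
  have fin: "(\<integral>\<^sup>+u. ennreal ((nmod h u)\<^sup>2) \<partial>lborel) < \<infinity>"
  proof -
    have "(\<integral>\<^sup>+u. ennreal ((nmod h u)\<^sup>2) \<partial>lborel)
        = (\<integral>\<^sup>+u. ennreal (pi ^ CARD('n)) * ennreal ((nmod h u)\<^sup>2 / pi ^ CARD('n)) \<partial>lborel)"
      by (simp flip: ennreal_mult)
    also have "\<dots> = ennreal (pi ^ CARD('n)) * ennreal ((norm_gauss h)\<^sup>2)"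
      by (subst nn_integral_cmult) (simp_all add: norm_gauss_nmod[OF h])
    also have "\<dots> < \<infinity>" by (simp add: ennreal_mult_less_top)
    finally show ?thesis .
  qed
  have "I \<longlonglongrightarrow> (\<integral>\<^sup>+(u :: complex ^ 'n). 0 \<partial>lborel)"
    unfolding I_def
  proof (rule nn_integral_dominated_convergence[OF _ _ _ _ fin])
    show "AE u in lborel. ennreal (exp (- (norm (u - \<zeta> n))\<^sup>2 / 2)) * ennreal ((nmod h u)\<^sup>2) \<le> ennreal ((nmod h u)\<^sup>2)" for n
      by (intro AE_I2) (simp add: mult_left_le_one_le flip: ennreal_mult)
    show "AE u in lborel. (\<lambda>n. ennreal (exp (- (norm (u - \<zeta> n))\<^sup>2 / 2)) * ennreal ((nmod h u)\<^sup>2)) \<longlonglongrightarrow> 0"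
    proof (rule AE_I2)
      fix u
      have "filterlim (\<lambda>n. \<zeta> n + (- u)) at_infinity sequentially"
        by (rule tendsto_add_filterlim_at_infinity'[OF \<zeta> tendsto_const])
      then have "filterlim (\<lambda>n. norm (u - \<zeta> n)) at_top sequentially"
        using filterlim_at_infinity_imp_norm_at_top by (fastforce simp: norm_minus_commute)
      then have "filterlim (\<lambda>n. (norm (u - \<zeta> n))\<^sup>2) at_top sequentially"
        by (intro filterlim_pow_at_top) auto
      then have "filterlim (\<lambda>n. (1/2) * (norm (u - \<zeta> n))\<^sup>2) at_top sequentially"
        by (rule filterlim_tendsto_pos_mult_at_top[OF tendsto_const, rotated]) simp
      then have "filterlim (\<lambda>n. - ((norm (u - \<zeta> n))\<^sup>2 / 2)) at_bot sequentially"
        by (simp add: filterlim_uminus_at_top)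
      then have "(\<lambda>n. exp (- ((norm (u - \<zeta> n))\<^sup>2 / 2))) \<longlonglongrightarrow> 0"
        by (rule filterlim_compose[OF exp_at_bot])
      then have "(\<lambda>n. ennreal (exp (- ((norm (u - \<zeta> n))\<^sup>2 / 2)) * (nmod h u)\<^sup>2)) \<longlonglongrightarrow> ennreal (0 * (nmod h u)\<^sup>2)"
        by (intro tendsto_intros)
      then show "(\<lambda>n. ennreal (exp (- (norm (u - \<zeta> n))\<^sup>2 / 2)) * ennreal ((nmod h u)\<^sup>2)) \<longlonglongrightarrow> 0"
        by (simp add: ennreal_mult)
    qed
  qed measurable
  then have "(\<lambda>n. ennreal K * I n) \<longlonglongrightarrow> ennreal K * 0"
    by (intro tendsto_mult_ennreal tendsto_const) auto
  then have KI: "(\<lambda>n. ennreal K * I n) \<longlonglongrightarrow> 0" by simp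
  have le: "ennreal ((nmod h (\<zeta> n))\<^sup>2) \<le> ennreal K * I n" for n
    using K(2)[OF h, of "\<zeta> n"] by (simp add: nmod_nker I_def)
  have "(\<lambda>n. ennreal ((nmod h (\<zeta> n))\<^sup>2)) \<longlonglongrightarrow> 0"
    by (rule tendsto_sandwich[OF _ _ tendsto_const KI]) (auto simp: le)
  then have "(\<lambda>n. (nmod h (\<zeta> n))\<^sup>2) \<longlonglongrightarrow> 0"
    by (simp add: tendsto_ennreal_iff[where x=0, simplified] flip: ennreal_0)
  then show ?thesis
    using tendsto_real_sqrt[of "\<lambda>n. (nmod h (\<zeta> n))\<^sup>2" 0] by simp
qed

text \<open>Substituting w = z + v makes the Gaussian majorant independent of \<open>z\<close>, so
  the pointwise limits from \<open>off_diagonal_vanish\<close> can be integrated over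
  \<open>v\<close>.\<close>

lemma op_kernel_mass_vanishes:
  fixes A :: "(complex ^ 'n \<Rightarrow> complex) \<Rightarrow> (complex ^ 'n \<Rightarrow> complex)"
  assumes A: "fock_bounded_op A" "localized A"
    and ber: "((\<lambda>z. nmod (A (nker z)) z) \<longlongrightarrow> 0) at_infinity"
  defines "s \<equiv> \<lambda>z. (\<integral>\<^sup>+w. ennreal (nmod (A (nker z)) w) \<partial>lborel)"
  obtains S where "\<And>z. s z \<le> ennreal S" "\<And>z. s z = ennreal (enn2real (s z))"
    "((\<lambda>z. enn2real (s z)) \<longlongrightarrow> 0) at_infinity"
proof -
  obtain C c where C: "0 \<le> C" "0 < c" "\<And>z w. nmod (A (nker z)) w \<le> C * exp (- c * (norm (z - w))\<^sup>2)"
    using A(2) by (rule localizedE) blast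
  define S where "S = C * sqrt (pi / c) ^ DIM(complex ^ 'n)"
  have S: "(\<integral>\<^sup>+(v :: complex ^ 'n). ennreal (C * exp (- c * (norm v)\<^sup>2)) \<partial>lborel) = ennreal S"
  proof -
    have "(\<integral>\<^sup>+(v :: complex ^ 'n). ennreal (C * exp (- c * (norm v)\<^sup>2)) \<partial>lborel)
        = (\<integral>\<^sup>+(v :: complex ^ 'n). ennreal C * ennreal (exp (- c * (norm v)\<^sup>2)) \<partial>lborel)"
      using C(1) by (intro nn_integral_cong ennreal_mult) auto
    also have "\<dots> = ennreal C * ennreal (sqrt (pi / c) ^ DIM(complex ^ 'n))"
      by (subst nn_integral_cmult, simp, subst nn_integral_exp_norm_square[OF C(2)], rule refl)
    also have "\<dots> = ennreal S" unfolding S_def using C by (intro ennreal_mult[symmetric]) auto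
    finally show ?thesis .
  qed
  note [measurable] = measurable_nmod_op[OF A(1)]
  have [measurable]: "nmod (A (nker z)) \<in> borel_measurable borel" for z
    by (intro nmod_measurable fock_bounded_opD(1)[OF A(1)] nker_in_fock)
  have s: "s z = (\<integral>\<^sup>+v. ennreal (nmod (A (nker z)) (z + v)) \<partial>lborel)" for z
    unfolding s_def by (rule nn_integral_lborel_shift[symmetric]) measurable
  have shifted: "nmod (A (nker z)) (z + v) \<le> C * exp (- c * (norm v)\<^sup>2)" for z v
    using C(3)[of z "z + v"] by simp
  have le: "s z \<le> ennreal S" for z
    unfolding s S[symmetric] by (intro nn_integral_mono ennreal_leI shifted)
  then have fin: "s z = ennreal (enn2real (s z))" for z
    using le_less_trans[OF le[of z] ennreal_less_top] by simp
  have "((\<lambda>z. enn2real (s z)) \<longlongrightarrow> 0) at_infinity"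
  proof (rule tendsto_0_at_infinity_seqI)
    fix \<zeta> :: "nat \<Rightarrow> complex ^ 'n" assume \<zeta>: "filterlim \<zeta> at_infinity sequentially"
    have "(\<lambda>n. s (\<zeta> n)) \<longlonglongrightarrow> (\<integral>\<^sup>+(v :: complex ^ 'n). 0 \<partial>lborel)"
      unfolding s
    proof (rule nn_integral_dominated_convergence[where w="\<lambda>v. ennreal (C * exp (- c * (norm v)\<^sup>2))"])
      show "AE v in lborel. ennreal (nmod (A (nker (\<zeta> n))) (\<zeta> n + v)) \<le> ennreal (C * exp (- c * (norm v)\<^sup>2))" for n
        by (intro AE_I2 ennreal_leI shifted)
      show "(\<integral>\<^sup>+(v :: complex ^ 'n). ennreal (C * exp (- c * (norm v)\<^sup>2)) \<partial>lborel) < \<infinity>"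
        unfolding S by simp
      show "AE v in lborel. (\<lambda>n. ennreal (nmod (A (nker (\<zeta> n))) (\<zeta> n + v))) \<longlonglongrightarrow> 0"
      proof (rule AE_I2)
        fix v
        have "(\<lambda>n. nmod (A (nker (\<zeta> n))) (\<zeta> n + v)) \<longlonglongrightarrow> 0"
          by (rule filterlim_compose[OF off_diagonal_vanish[OF A(1) ber] \<zeta>])
        then show "(\<lambda>n. ennreal (nmod (A (nker (\<zeta> n))) (\<zeta> n + v))) \<longlonglongrightarrow> 0"
          using tendsto_ennrealI by fastforce
      qed
    qed measurable
    then have "(\<lambda>n. enn2real (s (\<zeta> n))) \<longlonglongrightarrow> enn2real 0"
      by (intro tendsto_enn2real) auto
    then show "\<exists>r. strict_mono (r :: nat \<Rightarrow> nat) \<and> (\<lambda>n. enn2real (s (\<zeta> (r n)))) \<longlonglongrightarrow> 0"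
      by (intro exI[of _ id]) (simp add: strict_mono_id)
  qed
  with le fin show ?thesis by (rule that)
qed

text \<open>The row mass \<open>s\<close> acts as a multiplier: far from the origin it is small,
  while on a ball the coefficients of \<open>g n\<close> are bounded and tend to 0
  pointwise.\<close>

lemma op_norm_vanishes:
  fixes A :: "(complex ^ 'n \<Rightarrow> complex) \<Rightarrow> (complex ^ 'n \<Rightarrow> complex)"
  assumes A: "fock_bounded_op A" "localized A"
    and ber: "((\<lambda>z. nmod (A (nker z)) z) \<longlongrightarrow> 0) at_infinity"
    and g: "\<And>n. g n \<in> fock" "\<And>n. norm_gauss (g n) \<le> B"
    and lim: "\<And>u. (\<lambda>n. nmod (g n) u) \<longlonglongrightarrow> 0"
  shows "(\<lambda>n. norm_gauss (A (g n))) \<longlonglongrightarrow> 0"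
proof -
  define s where "s = (\<lambda>z. (\<integral>\<^sup>+w. ennreal (nmod (A (nker z)) w) \<partial>lborel))"
  obtain S where S: "\<And>z. s z \<le> ennreal S" "\<And>z. s z = ennreal (enn2real (s z))"
    "((\<lambda>z. enn2real (s z)) \<longlongrightarrow> 0) at_infinity"
    unfolding s_def by (rule op_kernel_mass_vanishes[OF A ber]) blast
  obtain K where K: "0 \<le> K" "\<And>h w. h \<in> fock \<Longrightarrow> ennreal ((nmod (A h) w)\<^sup>2)
      \<le> ennreal K * (\<integral>\<^sup>+u. ennreal (nmod (A (nker u)) w) * ennreal ((nmod h u)\<^sup>2) \<partial>lborel)"
    by (rule nmod_op_square_le[OF A]) blast
  have B: "B \<ge> 0" using g(2)[of 0] norm_gauss_nonneg[of "g 0"] by linarith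
  define P :: real where "P = pi ^ CARD('n)"
  have P: "P > 0" by (simp add: P_def)
  note [measurable] = measurable_nmod_op[OF A(1)]
  have [measurable]: "nmod (g n) \<in> borel_measurable borel" for n by (rule nmod_measurable[OF g(1)])
  have [measurable]: "nmod (A (g n)) \<in> borel_measurable borel" for n
    by (intro nmod_measurable fock_bounded_opD(1)[OF A(1)] g(1))
  have a1[measurable]: "(\<lambda>u. nmod (A (nker u)) w) \<in> borel_measurable borel" for w
    using measurable_compose[OF _ measurable_nmod_op[OF A(1)], of "\<lambda>u. (u, w)" borel] by simp
  have a2[measurable]: "(\<lambda>w. nmod (A (nker u)) w) \<in> borel_measurable borel" for u
    by (intro nmod_measurable fock_bounded_opD(1)[OF A(1)] nker_in_fock)
  have sm[measurable]: "s \<in> borel_measurable borel"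
    unfolding s_def by measurable
  have np: "(\<integral>\<^sup>+z. ennreal ((nmod h z)\<^sup>2) \<partial>lborel) = ennreal (P * (norm_gauss h)\<^sup>2)" if "h \<in> fock" for h :: "complex ^ 'n \<Rightarrow> complex"
  proof -
    note [measurable] = nmod_measurable[OF that]
    have "(\<integral>\<^sup>+z. ennreal ((nmod h z)\<^sup>2) \<partial>lborel) = (\<integral>\<^sup>+z. ennreal P * ennreal ((nmod h z)\<^sup>2 / P) \<partial>lborel)"
      using P by (simp flip: ennreal_mult)
    also have "\<dots> = ennreal P * ennreal ((norm_gauss h)\<^sup>2)"
      using norm_gauss_nmod[OF that] by (subst nn_integral_cmult) (simp_all add: P_def)
    finally show ?thesis using P by (simp add: ennreal_mult)
  qed
  \<comment> \<open>Integrating the pointwise estimate over \<open>w\<close> and exchanging the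
    integrals replaces the kernel by its mass \<open>s u\<close>.\<close>
  have schur: "ennreal (P * (norm_gauss (A (g n)))\<^sup>2) \<le> ennreal K * (\<integral>\<^sup>+u. s u * ennreal ((nmod (g n) u)\<^sup>2) \<partial>lborel)" for n
  proof -
    have pm: "(\<lambda>(w, u). ennreal (nmod (A (nker u)) w) * ennreal ((nmod (g n) u)\<^sup>2)) \<in> borel_measurable (lborel \<Otimes>\<^sub>M lborel)"
    proof -
      have "(\<lambda>p. nmod (A (nker (snd p))) (fst p)) \<in> borel_measurable (borel \<Otimes>\<^sub>M borel)"
        using measurable_compose[OF measurable_pair_swap' measurable_nmod_op[OF A(1)]] by (simp add: case_prod_unfold)
      moreover have "(\<lambda>p. nmod (g n) (snd p)) \<in> borel_measurable (borel \<Otimes>\<^sub>M borel)"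
        by (rule measurable_compose[OF measurable_snd]) measurable
      ultimately have "(\<lambda>p. ennreal (nmod (A (nker (snd p))) (fst p)) * ennreal ((nmod (g n) (snd p))\<^sup>2))
          \<in> borel_measurable (borel \<Otimes>\<^sub>M borel)" by measurable
      then show ?thesis
        by (simp add: case_prod_unfold cong: measurable_cong_sets sets_pair_measure_cong)
    qed
    have "ennreal (P * (norm_gauss (A (g n)))\<^sup>2) = (\<integral>\<^sup>+w. ennreal ((nmod (A (g n)) w)\<^sup>2) \<partial>lborel)"
      by (rule np[OF fock_bounded_opD(1)[OF A(1) g(1)], symmetric])
    also have "\<dots> \<le> (\<integral>\<^sup>+w. ennreal K * (\<integral>\<^sup>+u. ennreal (nmod (A (nker u)) w) * ennreal ((nmod (g n) u)\<^sup>2) \<partial>lborel) \<partial>lborel)"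
      by (intro nn_integral_mono K(2) g(1))
    also have "\<dots> = ennreal K * (\<integral>\<^sup>+w. (\<integral>\<^sup>+u. ennreal (nmod (A (nker u)) w) * ennreal ((nmod (g n) u)\<^sup>2) \<partial>lborel) \<partial>lborel)"
      by (rule nn_integral_cmult) (use lborel.borel_measurable_nn_integral[OF pm] in simp)
    also have "(\<integral>\<^sup>+w. (\<integral>\<^sup>+u. ennreal (nmod (A (nker u)) w) * ennreal ((nmod (g n) u)\<^sup>2) \<partial>lborel) \<partial>lborel)
       = (\<integral>\<^sup>+u. (\<integral>\<^sup>+w. ennreal (nmod (A (nker u)) w) * ennreal ((nmod (g n) u)\<^sup>2) \<partial>lborel) \<partial>lborel)"
      by (rule lborel_pair.Fubini'[symmetric, OF pm])
    also have "\<dots> = (\<integral>\<^sup>+u. s u * ennreal ((nmod (g n) u)\<^sup>2) \<partial>lborel)"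
      by (simp add: nn_integral_multc s_def)
    finally show ?thesis .
  qed
  have small: "\<forall>\<^sub>F n in sequentially. (norm_gauss (A (g n)))\<^sup>2 \<le> e" if e: "e > 0" for e
  proof -
    \<comment> \<open>\<open>D\<close> dominates K B^2 and remains positive when \<open>K\<close> or
      \<open>B\<close> is 0; with d = e / (2 D) the part outside the ball contributes at most half
      of \<open>e\<close>.\<close>
    define D where "D = (K + 1) * (B\<^sup>2 + 1)"
    have D: "D > 0" unfolding D_def using K(1) by (intro mult_pos_pos) (auto intro: add_nonneg_pos)
    define d where "d = e / 2 / D"
    have d: "d > 0" using e D by (simp add: d_def)
    have dle: "K * (d * B\<^sup>2) \<le> e / 2"
    proof -
      have "K * B\<^sup>2 \<le> D" unfolding D_def using K(1) by (intro mult_mono) auto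
      then have "e / 2 * (K * B\<^sup>2 / D) \<le> e / 2 * 1"
        using e D by (intro mult_left_mono) (auto simp: divide_le_eq_1_pos)
      then show ?thesis by (simp add: d_def mult_ac)
    qed
    obtain R where R: "\<And>u. norm u \<ge> R \<Longrightarrow> enn2real (s u) \<le> d"
      using tendstoD[OF S(3) d] by (auto simp: eventually_at_infinity intro: less_imp_le)
    have [measurable]: "ball (0 :: complex ^ 'n) R \<in> sets borel" by simp
    define I where "I n = (\<integral>\<^sup>+u. ennreal S * (indicator (ball 0 R) u * ennreal ((nmod (g n) u)\<^sup>2)) \<partial>lborel)" for n
    have "I \<longlonglongrightarrow> (\<integral>\<^sup>+(u :: complex ^ 'n). 0 \<partial>lborel)"
      unfolding I_def
    proof (rule nn_integral_dominated_convergence[where w="\<lambda>u. ennreal S * (indicator (ball 0 R) u * ennreal (B\<^sup>2))"])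
      show "AE u in lborel. ennreal S * (indicator (ball 0 R) u * ennreal ((nmod (g n) u)\<^sup>2))
          \<le> ennreal S * (indicator (ball 0 R) u * ennreal (B\<^sup>2))" for n
        using order_trans[OF nmod_le[OF g(1)] g(2), of n]
        by (intro AE_I2 mult_left_mono ennreal_leI power_mono) auto
      have "(\<integral>\<^sup>+(u :: complex ^ 'n). ennreal S * (indicator (ball 0 R) u * ennreal (B\<^sup>2)) \<partial>lborel)
          = ennreal S * (emeasure lborel (ball (0 :: complex ^ 'n) R) * ennreal (B\<^sup>2))"
        by (subst nn_integral_cmult) (auto simp: nn_integral_multc)
      also have "\<dots> < \<infinity>"
        using emeasure_lborel_ball_finite[of "0 :: complex ^ 'n" R] by (simp add: ennreal_mult_less_top)
      finally show "(\<integral>\<^sup>+(u :: complex ^ 'n). ennreal S * (indicator (ball 0 R) u * ennreal (B\<^sup>2)) \<partial>lborel) < \<infinity>" .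
      show "AE u in lborel. (\<lambda>n. ennreal S * (indicator (ball 0 R) u * ennreal ((nmod (g n) u)\<^sup>2))) \<longlonglongrightarrow> 0"
      proof (rule AE_I2)
        fix u
        have "(\<lambda>n. ennreal ((nmod (g n) u)\<^sup>2)) \<longlonglongrightarrow> ennreal (0\<^sup>2)"
          by (intro tendsto_intros lim)
        then have "(\<lambda>n. ennreal S * (indicator (ball 0 R) u * ennreal ((nmod (g n) u)\<^sup>2))) \<longlonglongrightarrow> ennreal S * (indicator (ball 0 R) u * 0)"
          by (intro tendsto_mult_ennreal tendsto_const) (auto simp: indicator_def)
        then show "(\<lambda>n. ennreal S * (indicator (ball 0 R) u * ennreal ((nmod (g n) u)\<^sup>2))) \<longlonglongrightarrow> 0" by simp
      qed
    qed measurable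
    then have "(\<lambda>n. ennreal K * I n) \<longlonglongrightarrow> ennreal K * 0"
      by (intro tendsto_mult_ennreal tendsto_const) auto
    then have "\<forall>\<^sub>F n in sequentially. ennreal K * I n < ennreal (P * (e / 2))"
      using e P by (intro order_tendstoD(2)[of _ 0]) auto
    then show ?thesis
    proof (rule eventually_mono)
      fix n assume n: "ennreal K * I n < ennreal (P * (e / 2))"
      have "(\<integral>\<^sup>+u. s u * ennreal ((nmod (g n) u)\<^sup>2) \<partial>lborel)
         \<le> (\<integral>\<^sup>+u. ennreal S * (indicator (ball 0 R) u * ennreal ((nmod (g n) u)\<^sup>2)) + ennreal d * ennreal ((nmod (g n) u)\<^sup>2) \<partial>lborel)"
      proof (rule nn_integral_mono)
        fix u
        show "s u * ennreal ((nmod (g n) u)\<^sup>2)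
          \<le> ennreal S * (indicator (ball 0 R) u * ennreal ((nmod (g n) u)\<^sup>2)) + ennreal d * ennreal ((nmod (g n) u)\<^sup>2)"
        proof (cases "norm u < R")
          case True
          then have "s u * ennreal ((nmod (g n) u)\<^sup>2) \<le> ennreal S * (indicator (ball 0 R) u * ennreal ((nmod (g n) u)\<^sup>2))"
            using S(1)[of u] by (simp add: mult_right_mono)
          then show ?thesis by (rule order_trans) simp
        next
          case False
          then have "s u \<le> ennreal d"
            by (subst S(2)) (intro ennreal_leI R, simp)
          then have "s u * ennreal ((nmod (g n) u)\<^sup>2) \<le> ennreal d * ennreal ((nmod (g n) u)\<^sup>2)"
            by (intro mult_right_mono) auto
          then show ?thesis by (rule order_trans) simp
        qed
      qed
      also have "\<dots> = I n + ennreal d * (\<integral>\<^sup>+u. ennreal ((nmod (g n) u)\<^sup>2) \<partial>lborel)"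
        unfolding I_def by (subst nn_integral_add) (simp_all add: nn_integral_cmult)
      also have "\<dots> \<le> I n + ennreal d * ennreal (P * B\<^sup>2)"
        unfolding np[OF g(1)]
        using g(2)[of n] P by (intro add_left_mono mult_left_mono ennreal_leI power_mono) (auto simp: norm_gauss_nonneg)
      finally have "ennreal (P * (norm_gauss (A (g n)))\<^sup>2) \<le> ennreal K * (I n + ennreal d * ennreal (P * B\<^sup>2))"
        by (intro order_trans[OF schur] mult_left_mono) auto
      also have "\<dots> = ennreal K * I n + ennreal (P * (K * (d * B\<^sup>2)))"
        using K(1) d P by (simp add: distrib_left mult_ac flip: ennreal_mult)
      also have "\<dots> \<le> ennreal (P * (e / 2)) + ennreal (P * (e / 2))"
        using n dle P by (intro add_mono ennreal_leI mult_left_mono) auto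
      also have "\<dots> = ennreal (P * e)"
        using P e by (simp flip: ennreal_plus)
      finally show "(norm_gauss (A (g n)))\<^sup>2 \<le> e"
        using P e by (simp add: ennreal_le_iff)
    qed
  qed
  have "(\<lambda>n. (norm_gauss (A (g n)))\<^sup>2) \<longlonglongrightarrow> 0"
  proof (rule tendstoI)
    fix e :: real assume "e > 0"
    then have "\<forall>\<^sub>F n in sequentially. (norm_gauss (A (g n)))\<^sup>2 \<le> e / 2" by (intro small) simp
    then show "\<forall>\<^sub>F n in sequentially. dist ((norm_gauss (A (g n)))\<^sup>2) 0 < e"
      by (rule eventually_mono) (use \<open>e > 0\<close> in auto)
  qed
  then show ?thesis
    using tendsto_real_sqrt[of "\<lambda>n. (norm_gauss (A (g n)))\<^sup>2" 0] by (simp add: norm_gauss_nonneg)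
qed

section \<open>Compactness of operators\<close>

text \<open>The unit ball is equicontinuous with modulus \<open>ker_dist\<close>, so a subsequence
  converging on a countable dense set converges at every point. Differences of far terms then tend
  to 0 pointwise, and \<open>op_norm_vanishes\<close> makes the images Cauchy; the pointwise limit
  of the \<open>h n\<close> need not be identified.\<close>

lemma op_image_convergent_subseq:
  fixes A :: "(complex ^ 'n \<Rightarrow> complex) \<Rightarrow> (complex ^ 'n \<Rightarrow> complex)"
  assumes A: "fock_bounded_op A" "localized A"
    and ber: "((\<lambda>z. nmod (A (nker z)) z) \<longlongrightarrow> 0) at_infinity"
    and h: "\<And>n. h n \<in> fock" "\<And>n. norm_gauss (h n) \<le> 1"
  obtains r l where "strict_mono (r :: nat \<Rightarrow> nat)" "l \<in> fock"
    "(\<lambda>n. norm_gauss (\<lambda>z. A (h (r n)) z - l z)) \<longlonglongrightarrow> 0"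
proof -
  obtain D :: "(complex ^ 'n) set" where D: "countable D" "\<And>X. open X \<Longrightarrow> X \<noteq> {} \<Longrightarrow> \<exists>d\<in>D. d \<in> X"
    by (rule countable_dense_setE) blast
  \<comment> \<open>Weighting makes the bound 1 uniform in \<open>z\<close>, which is the form the
    diagonal argument asks for; the weight is removed again in \<open>hd\<close>.\<close>
  define f where "f n z = h n z * of_real (exp (- (norm z)\<^sup>2 / 2))" for n z
  have f: "cmod (f n z) \<le> 1" for n z
    using order_trans[OF nmod_le[OF h(1)] h(2), of n z] by (simp add: f_def nmod_def norm_mult)
  obtain k where k: "strict_mono (k :: nat \<Rightarrow> nat)" "\<And>d. d \<in> D \<Longrightarrow> \<exists>l. (\<lambda>n. f (k n) d) \<longlonglongrightarrow> l"
    by (rule function_convergent_subsequence[OF D(1), of f 1]) (use f in auto)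
  have hd: "convergent (\<lambda>n. h (k n) d)" if "d \<in> D" for d
  proof -
    obtain l where "(\<lambda>n. f (k n) d) \<longlonglongrightarrow> l" using k(2)[OF \<open>d \<in> D\<close>] by blast
    then have "(\<lambda>n. f (k n) d * of_real (exp ((norm d)\<^sup>2 / 2))) \<longlonglongrightarrow> l * of_real (exp ((norm d)\<^sup>2 / 2))"
      by (intro tendsto_intros)
    moreover have "f (k n) d * of_real (exp ((norm d)\<^sup>2 / 2)) = h (k n) d" for n
      by (simp add: f_def mult.assoc flip: of_real_mult exp_add)
    ultimately show ?thesis by (auto simp: convergent_def)
  qed
  have equi: "cmod (h n z - h n d) \<le> ker_dist z d" for n z d
  proof -
    have "cnj (inner_gauss (h n) (\<lambda>w. ker z w - ker d w)) = inner_gauss (\<lambda>w. ker z w - ker d w) (h n)"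
      by (rule inner_gauss_commute[symmetric])
    also have "\<dots> = inner_gauss (ker z) (h n) - inner_gauss (ker d) (h n)"
      by (intro inner_gauss_diff_left fockD(2) ker_in_fock h)
    also have "\<dots> = cnj (h n z - h n d)"
      by (simp add: inner_gauss_commute[of _ "h n"] fock_reproducing[OF h(1)])
    finally have "h n z - h n d = inner_gauss (h n) (\<lambda>w. ker z w - ker d w)"
      by (metis complex_cnj_cancel_iff)
    then have "cmod (h n z - h n d) \<le> norm_gauss (h n) * ker_dist z d"
      unfolding ker_dist_def by (metis inner_gauss_le fockD(2) fock_diff ker_in_fock h(1))
    also have "\<dots> \<le> 1 * ker_dist z d"
      by (intro mult_right_mono h) (simp add: ker_dist_def norm_gauss_nonneg)
    finally show ?thesis by simp
  qed
  have conv: "Cauchy (\<lambda>n. h (k n) z)" for z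
  proof (rule metric_CauchyI)
    fix e :: real assume e: "e > 0"
    have "open {d. ker_dist d z < e / 3}"
      by (intro open_Collect_less continuous_on_ker_dist continuous_on_const)
    moreover have "z \<in> {d. ker_dist d z < e / 3}" using e by (simp add: ker_dist_self)
    ultimately obtain d where d: "d \<in> D" "ker_dist d z < e / 3" using D(2) by blast
    obtain M where M: "\<And>m n. m \<ge> M \<Longrightarrow> n \<ge> M \<Longrightarrow> dist (h (k m) d) (h (k n) d) < e / 3"
      using metric_CauchyD[OF convergent_Cauchy[OF hd[OF d(1)]], of "e / 3"] e by auto
    have "dist (h (k m) z) (h (k n) z) < e" if "m \<ge> M" "n \<ge> M" for m n
    proof -
      have "dist (h (k i) d) (h (k i) z) < e / 3" for i
        using equi[of "k i" d z] d(2) by (simp add: dist_norm)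
      from this[of m] this[of n] M[OF that] show ?thesis
        using dist_triangle[of "h (k m) z" "h (k n) z" "h (k m) d"]
          dist_triangle[of "h (k m) d" "h (k n) z" "h (k n) d"]
        by (simp add: dist_commute)
    qed
    then show "\<exists>M. \<forall>m\<ge>M. \<forall>n\<ge>M. dist (h (k m) z) (h (k n) z) < e" by blast
  qed
  have "\<exists>l\<in>fock. (\<lambda>n. norm_gauss (\<lambda>z. A (h (k n)) z - l z)) \<longlonglongrightarrow> 0"
  proof -
    have "\<exists>N. \<forall>m\<ge>N. \<forall>n\<ge>N. norm_gauss (\<lambda>z. A (h (k m)) z - A (h (k n)) z) < e" if e: "e > 0" for e
    proof (rule ccontr)
      assume "\<not> ?thesis"
      then have "\<forall>N. \<exists>m n. m \<ge> N \<and> n \<ge> N \<and> e \<le> norm_gauss (\<lambda>z. A (h (k m)) z - A (h (k n)) z)"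
        by (meson not_le)
      \<comment> \<open>If the images are not Cauchy, there are arbitrarily late pairs of indices
        whose images stay \<open>e\<close> apart; their differences form a sequence \<open>g\<close>
        that is bounded and tends to 0 pointwise.\<close>
      then obtain p q where pq: "\<And>N. p N \<ge> N" "\<And>N. q N \<ge> N"
          "\<And>N. e \<le> norm_gauss (\<lambda>z. A (h (k (p N))) z - A (h (k (q N))) z)"
        by metis
      define g where "g N = (\<lambda>z. h (k (p N)) z - h (k (q N)) z)" for N
      have g: "g N \<in> fock" for N unfolding g_def by (intro fock_diff h)
      have Ag: "A (g N) = (\<lambda>z. A (h (k (p N))) z - A (h (k (q N))) z)" for N
        unfolding g_def by (rule fock_bounded_op_diff[OF A(1) h(1) h(1)])
      have gB: "norm_gauss (g N) \<le> 2" for N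
      proof -
        have "norm_gauss (\<lambda>z. h a z - h b z) \<le> 2" for a b
        proof -
          interpret Metric_space "fock :: (complex ^ 'n \<Rightarrow> complex) set" fock_dist by (rule Metric_space_fock)
          have z: "(\<lambda>z. 0) \<in> (fock :: (complex ^ 'n \<Rightarrow> complex) set)"
            using fock_diff[OF h(1) h(1), of 0 0] by simp
          have "fock_dist (h a) (h b) \<le> fock_dist (h a) (\<lambda>z. 0) + fock_dist (\<lambda>z. 0) (h b)"
            by (rule triangle[OF h(1) z h(1)])
          also have "fock_dist (\<lambda>z. 0) (h b) = fock_dist (h b) (\<lambda>z. 0)" by (rule commute)
          finally show ?thesis using h(2)[of a] h(2)[of b] by (simp add: fock_dist_def)
        qed
        then show ?thesis by (simp add: g_def)
      qed
      have lim: "(\<lambda>N. nmod (g N) u) \<longlonglongrightarrow> 0" for u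
      proof -
        obtain y where y: "(\<lambda>n. h (k n) u) \<longlonglongrightarrow> y"
          using conv[of u] by (auto simp: Cauchy_convergent_iff convergent_def)
        have "filterlim p at_top sequentially" "filterlim q at_top sequentially"
          using pq(1,2) by (auto intro!: filterlim_at_top_mono[OF filterlim_ident] always_eventually)
        then have "(\<lambda>N. h (k (p N)) u) \<longlonglongrightarrow> y" "(\<lambda>N. h (k (q N)) u) \<longlonglongrightarrow> y"
          using filterlim_compose[OF y] by auto
        then have "(\<lambda>N. g N u) \<longlonglongrightarrow> y - y"
          unfolding g_def by (rule tendsto_diff)
        then have "(\<lambda>N. cmod (g N u) * exp (- (norm u)\<^sup>2 / 2)) \<longlonglongrightarrow> 0 * exp (- (norm u)\<^sup>2 / 2)"
          by (intro tendsto_mult tendsto_const tendsto_norm_zero) simp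
        then show ?thesis by (simp add: nmod_def)
      qed
      have "(\<lambda>N. norm_gauss (A (g N))) \<longlonglongrightarrow> 0"
        by (rule op_norm_vanishes[OF A ber g gB lim])
      then have "\<forall>\<^sub>F N in sequentially. norm_gauss (A (g N)) < e"
        using e by (rule order_tendstoD(2))
      then show False using pq(3) unfolding Ag by (auto simp: eventually_sequentially not_less[symmetric])
    qed
    then show ?thesis
      using fock_complete[of "\<lambda>n. A (h (k n))"] fock_bounded_opD(1)[OF A(1) h(1)] by blast
  qed
  then show ?thesis using that[OF k(1)] by blast
qed

lemma compact_op_berezin_vanishes:
  fixes A :: "(complex ^ 'n \<Rightarrow> complex) \<Rightarrow> (complex ^ 'n \<Rightarrow> complex)"
  assumes "fock_compact_op A"
  shows "((\<lambda>z. nmod (A (nker z)) z) \<longlongrightarrow> 0) at_infinity"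
proof (rule tendsto_0_at_infinity_seqI)
  interpret Metric_space "fock :: (complex ^ 'n \<Rightarrow> complex) set" fock_dist by (rule Metric_space_fock)
  fix \<zeta> :: "nat \<Rightarrow> complex ^ 'n" assume \<zeta>: "filterlim \<zeta> at_infinity sequentially"
  have A: "fock_bounded_op A" using assms by (simp add: fock_compact_op_def)
  let ?S = "A ` {h \<in> fock. norm_gauss h \<le> 1}"
  have sub: "?S \<subseteq> fock" using fock_bounded_opD(1)[OF A] by auto
  have comp: "compactin mtopology (mtopology closure_of ?S)"
    using assms by (simp add: fock_compact_op_def fock_topology_def)
  have "A (nker (\<zeta> n)) \<in> mtopology closure_of ?S" for n
    using closure_of_subset[of ?S mtopology] sub nker_in_fock[of "\<zeta> n"] norm_gauss_nker[of "\<zeta> n"] by auto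
  then have "range (\<lambda>n. A (nker (\<zeta> n))) \<subseteq> mtopology closure_of ?S" by auto
  then obtain l r where r: "strict_mono (r :: nat \<Rightarrow> nat)"
      "limitin mtopology ((\<lambda>n. A (nker (\<zeta> n))) \<circ> r) l sequentially"
    using comp unfolding compactin_sequentially by meson
  then have l: "l \<in> fock" and lim: "(\<lambda>n. fock_dist (A (nker (\<zeta> (r n)))) l) \<longlonglongrightarrow> 0"
    by (auto simp: limitin_metric_dist_null)
  have \<zeta>r: "filterlim (\<lambda>n. \<zeta> (r n)) at_infinity sequentially"
    by (rule filterlim_compose[OF \<zeta> filterlim_subseq[OF r(1)]])
  have "(\<lambda>n. fock_dist (A (nker (\<zeta> (r n)))) l + nmod l (\<zeta> (r n))) \<longlonglongrightarrow> 0 + 0"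
    by (intro tendsto_add lim nmod_vanishes[OF l \<zeta>r])
  then have sum: "(\<lambda>n. fock_dist (A (nker (\<zeta> (r n)))) l + nmod l (\<zeta> (r n))) \<longlonglongrightarrow> 0" by simp
  \<comment> \<open>Testing against k_z splits the diagonal entry into the distance of A k_z to
    \<open>l\<close> and the coefficient of \<open>l\<close>, which vanishes at infinity.\<close>
  have le: "nmod (A (nker z)) z \<le> fock_dist (A (nker z)) l + nmod l z" for z
  proof -
    have d: "(\<lambda>w. A (nker z) w - l w) \<in> fock"
      by (intro fock_diff fock_bounded_opD(1)[OF A] nker_in_fock l)
    have "nmod (A (nker z)) z \<le> nmod (\<lambda>w. A (nker z) w - l w) z + nmod l z"
      unfolding nmod_def distrib_right[symmetric]
      using norm_triangle_ineq[of "A (nker z) z - l z" "l z"] by (intro mult_right_mono) auto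
    also have "nmod (\<lambda>w. A (nker z) w - l w) z \<le> fock_dist (A (nker z)) l"
      unfolding fock_dist_def by (rule nmod_le[OF d])
    finally show ?thesis by simp
  qed
  have "(\<lambda>n. nmod (A (nker (\<zeta> (r n)))) (\<zeta> (r n))) \<longlonglongrightarrow> 0"
    by (rule tendsto_sandwich[OF _ _ tendsto_const sum]) (auto simp: le)
  with r(1) show "\<exists>r. strict_mono (r :: nat \<Rightarrow> nat) \<and> (\<lambda>n. nmod (A (nker (\<zeta> (r n)))) (\<zeta> (r n))) \<longlonglongrightarrow> 0"
    by blast
qed

lemma localized_berezin_vanishes_compact:
  fixes A :: "(complex ^ 'n \<Rightarrow> complex) \<Rightarrow> (complex ^ 'n \<Rightarrow> complex)"
  assumes A: "fock_bounded_op A" "localized A"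
    and ber: "((\<lambda>z. nmod (A (nker z)) z) \<longlongrightarrow> 0) at_infinity"
  shows "fock_compact_op A"
proof -
  interpret Metric_space "fock :: (complex ^ 'n \<Rightarrow> complex) set" fock_dist by (rule Metric_space_fock)
  let ?S = "A ` {h \<in> fock. norm_gauss h \<le> 1}"
  have "compactin mtopology (mtopology closure_of ?S)"
    unfolding compact_closure_of_eq_Bolzano_Weierstrass
  proof (intro allI impI)
    fix T :: "(complex ^ 'n \<Rightarrow> complex) set" assume T: "infinite T \<and> T \<subseteq> ?S \<and> T \<subseteq> fock"
    then obtain y :: "nat \<Rightarrow> complex ^ 'n \<Rightarrow> complex" where y: "inj y" "range y \<subseteq> T"
      using infinite_countable_subset by blast
    then have "\<forall>n. \<exists>h. h \<in> fock \<and> norm_gauss h \<le> 1 \<and> y n = A h" using T by blast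
    then obtain h where h: "\<And>n. h n \<in> fock" "\<And>n. norm_gauss (h n) \<le> 1" "\<And>n. y n = A (h n)"
      by metis
    obtain r l where r: "strict_mono (r :: nat \<Rightarrow> nat)" and l: "l \<in> fock"
      and lim: "(\<lambda>n. norm_gauss (\<lambda>z. A (h (r n)) z - l z)) \<longlonglongrightarrow> 0"
      by (rule op_image_convergent_subseq[OF A ber h(1,2)])
    have "l \<in> mtopology derived_set_of T"
      unfolding metric_derived_set_of
    proof (intro CollectI conjI l allI impI)
      fix e :: real assume "e > 0"
      then have "\<forall>\<^sub>F n in sequentially. norm_gauss (\<lambda>z. A (h (r n)) z - l z) < e"
        using lim by (intro order_tendstoD(2)) auto
      then obtain N where N: "\<And>n. n \<ge> N \<Longrightarrow> fock_dist (y (r n)) l < e"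
        by (auto simp: eventually_sequentially fock_dist_def h(3))
      have "y (r N) \<noteq> y (r (Suc N))"
        using injD[OF y(1)] strict_mono_less[OF r, of N "Suc N"] by fastforce
      \<comment> \<open>Two consecutive terms of the injective sequence differ, so at least one of
        them is not \<open>l\<close>; an accumulation point demands points other than
        itself.\<close>
      then obtain n where n: "n \<ge> N" "y (r n) \<noteq> l" by (metis le_Suc_eq order_refl)
      moreover have "y (r n) \<in> T" "y (r n) \<in> fock" using y(2) T by auto
      ultimately show "\<exists>y\<in>T. y \<noteq> l \<and> y \<in> mball l e"
        using N[OF n(1)] l commute[of "y (r n)" l] by (intro bexI[of _ "y (r n)"]) (auto simp: in_mball)
    qed
    then show "mtopology derived_set_of T \<noteq> {}" by blast
  qed
  then show ?thesis using A(1) by (simp add: fock_compact_op_def fock_topology_def)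
qed

theorem corollary4p13:
  fixes A :: "(complex ^ 'n \<Rightarrow> complex) \<Rightarrow> (complex ^ 'n \<Rightarrow> complex)"
  assumes "fock_bounded_op A"
    and "bmo_toeplitz_algebra A"
  shows "fock_compact_op A \<longleftrightarrow> (berezin A \<longlongrightarrow> 0) at_infinity"
proof -
  have "cmod (berezin A z) = nmod (A (nker z)) z" for z
    unfolding berezin_def by (rule cmod_inner_gauss_nker[OF fock_bounded_opD(1)[OF assms(1) nker_in_fock]])
  then have "(berezin A \<longlongrightarrow> 0) at_infinity \<longleftrightarrow> ((\<lambda>z. nmod (A (nker z)) z) \<longlongrightarrow> 0) at_infinity"
    by (subst tendsto_norm_zero_iff[symmetric]) simp
  then show ?thesis
    using compact_op_berezin_vanishes
      localized_berezin_vanishes_compact[OF assms(1) bmo_toeplitz_algebra_localized[OF assms(2)]]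
    by blast
qed

end
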